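(* Let $\mathsf{DMM}$ be the variety of De Morgan monoids, and let $\mathbf{2},S_3,S_5,C_4,D_4,C_5,C_6,C_7,C_8$ be the De Morgan monoids and $\mathsf{M}$ the subvariety of $\mathsf{DMM}$ described in the context. (i) $\mathbb{V}(\mathbf{2})$ has no join-irreducible cover within $\mathsf{DMM}$. (ii) $\mathbb{V}(S_5)$ is the only join-irreducible cover of $\mathbb{V}(S_3)$ within $\mathsf{DMM}$. (iii) If $\mathsf{K}$ is a join-irreducible cover of $\mathbb{V}(C_4)$ within $\mathsf{DMM}$, then $\mathsf{K}$ consists of anti-idempotent algebras and exactly one of the following holds: (1) $\mathsf{K}\subseteq\mathsf{M}$; (2) $\mathsf{K}=\mathbb{V}(C_n)$ for some $n\in\{5,6,7,8\}$; (3) $\mathsf{K}=\mathbb{V}(A)$ for some simple $1$-generated De Morgan monoid $A$ such that $C_4$ is a proper subalgebra of $A$. (iv) If $\mathsf{K}$ is a join-irreducible cover of $\mathbb{V}(D_4)$ within $\mathsf{DMM}$, then $\mathsf{K}=\mathbb{V}(A)$ for some simple $1$-generated De Morgan monoid $A$ such that $D_4$ is a proper subalgebra of $A$. In this case, $\mathsf{K}$ consists of anti-idempotent algebras.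
   Context: An involutive residuated lattice (IRL) is an algebra $\langle A;\cdot,\wedge,\vee,\neg,e\rangle$ where $\langle A;\cdot,e\rangle$ is a commutative monoid, $\langle A;\wedge,\vee\rangle$ is a lattice (with order $\leqslant$), and $\neg$ is a unary operation such that $\neg\neg x=x$ and ($x\cdot y\leqslant z$ iff $\neg z\cdot y\leqslant\neg x$). Put $f:=\neg e$, $x\to y:=\neg(x\cdot\neg y)$, $x^2:=x\cdot x$. It is square-increasing if $x\leqslant x^2$ holds; anti-idempotent if it is square-increasing and satisfies $x\leqslant f^2$. A De Morgan monoid is a square-increasing IRL whose lattice reduct is distributive; $\mathsf{DMM}$ is the variety of all De Morgan monoids. $\mathbb{V}(A)$ is the variety generated by $A$. An algebra is $n$-generated if it has a generating set with at most $n$ elements ($0$-generated: no proper subalgebra). A cover of a variety $\mathsf{E}'$ within $\mathsf{DMM}$ is a cover of $\mathsf{E}'$ in the lattice of subvarieties of $\mathsf{DMM}$; it is join-irreducible if it is a join-irreducible element of that lattice. Subalgebra statements are understood up to isomorphism. Algebras: $\mathbf{2}$ is the two-element Boolean algebra, with $\cdot=\wedge$ and $e$ the top element. For $n\in\{1,2\}$, $S_{2n+1}$ has universe $\{-n,\dots,-1,0,1,\dots,n\}$ with the usual total order, $\neg a=-a$, $e=0$, and $a\cdot b$ equal to the element of $\{a,b\}$ with larger absolute value if $|a|\neq|b|$, and $a\cdot b=\min\{a,b\}$ if $|a|=|b|$. $C_4$ is the chain $\mathit{0}<e<f<\mathit{1}$ and $D_4$ is the four-element lattice with bottom $\mathit{0}$,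 top $\mathit{1}$ and incomparable $e,f$; in both, $\neg$ interchanges $\mathit{0},\mathit{1}$ and interchanges $e,f$, and $\cdot$ is commutative with $e$ neutral, $\mathit{0}\cdot x=\mathit{0}$ for all $x$, $\mathit{1}\cdot x=\mathit{1}$ for $x\ne\mathit{0}$, and $f\cdot f=\mathit{1}$. By a known result of Slaney, up to isomorphism there are exactly seven nontrivial $0$-generated finitely subdirectly irreducible De Morgan monoids, all finite; three of them are $\mathbf{2}$, $D_4$ and $C_4$ (these are the simple ones), and $C_5,C_6,C_7,C_8$ denote the remaining four. In an anti-idempotent IRL put $\mathit{1}:=f^2$, $\mathit{0}:=\neg(f^2)$. $\mathsf{M}$ is the variety of anti-idempotent De Morgan monoids satisfying $e\leqslant f$ and $((f\to x)\vee(x\to e))\to\mathit{0}=\mathit{0}$. *)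

theory Defs
  imports "HOL-Algebra.Group"
begin

section \<open>Involutive residuated lattices\<close>

record 'a irl_alg = "'a monoid" +
  wedge :: "['a, 'a] \<Rightarrow> 'a" (infixl \<open>\<^bold>\<and>\<index>\<close> 68)
  vee :: "['a, 'a] \<Rightarrow> 'a" (infixl \<open>\<^bold>\<or>\<index>\<close> 67)
  neg :: "'a \<Rightarrow> 'a" (\<open>\<^bold>\<not>\<index> _\<close> [80] 80)

definition irl_le :: "('a, 'm) irl_alg_scheme \<Rightarrow> 'a \<Rightarrow> 'a \<Rightarrow> bool" (infix \<open>\<preceq>\<index>\<close> 50)
  where "x \<preceq>\<^bsub>A\<^esub> y \<longleftrightarrow> x \<^bold>\<and>\<^bsub>A\<^esub> y = x"

locale irl = comm_monoid A for A :: "('a, 'm) irl_alg_scheme" (structure) +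
  assumes wedge_closed: "\<lbrakk>x \<in> carrier A; y \<in> carrier A\<rbrakk> \<Longrightarrow> x \<^bold>\<and> y \<in> carrier A"
    and vee_closed: "\<lbrakk>x \<in> carrier A; y \<in> carrier A\<rbrakk> \<Longrightarrow> x \<^bold>\<or> y \<in> carrier A"
    and neg_closed: "x \<in> carrier A \<Longrightarrow> \<^bold>\<not> x \<in> carrier A"
    and wedge_comm: "\<lbrakk>x \<in> carrier A; y \<in> carrier A\<rbrakk> \<Longrightarrow> x \<^bold>\<and> y = y \<^bold>\<and> x"
    and vee_comm: "\<lbrakk>x \<in> carrier A; y \<in> carrier A\<rbrakk> \<Longrightarrow> x \<^bold>\<or> y = y \<^bold>\<or> x"
    and wedge_assoc: "\<lbrakk>x \<in> carrier A; y \<in> carrier A; z \<in> carrier A\<rbrakk>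
          \<Longrightarrow> (x \<^bold>\<and> y) \<^bold>\<and> z = x \<^bold>\<and> (y \<^bold>\<and> z)"
    and vee_assoc: "\<lbrakk>x \<in> carrier A; y \<in> carrier A; z \<in> carrier A\<rbrakk>
          \<Longrightarrow> (x \<^bold>\<or> y) \<^bold>\<or> z = x \<^bold>\<or> (y \<^bold>\<or> z)"
    and wedge_absorb: "\<lbrakk>x \<in> carrier A; y \<in> carrier A\<rbrakk> \<Longrightarrow> x \<^bold>\<and> (x \<^bold>\<or> y) = x"
    and vee_absorb: "\<lbrakk>x \<in> carrier A; y \<in> carrier A\<rbrakk> \<Longrightarrow> x \<^bold>\<or> (x \<^bold>\<and> y) = x"
    and neg_neg: "x \<in> carrier A \<Longrightarrow> \<^bold>\<not> (\<^bold>\<not> x) = x"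
    and residuation: "\<lbrakk>x \<in> carrier A; y \<in> carrier A; z \<in> carrier A\<rbrakk>
          \<Longrightarrow> x \<otimes> y \<preceq> z \<longleftrightarrow> (\<^bold>\<not> z) \<otimes> y \<preceq> \<^bold>\<not> x"

locale square_increasing_irl = irl +
  assumes square_increasing: "x \<in> carrier A \<Longrightarrow> x \<preceq> x \<otimes> x"

locale de_morgan_monoid = square_increasing_irl +
  assumes wedge_vee_distrib: "\<lbrakk>x \<in> carrier A; y \<in> carrier A; z \<in> carrier A\<rbrakk>
          \<Longrightarrow> x \<^bold>\<and> (y \<^bold>\<or> z) = (x \<^bold>\<and> y) \<^bold>\<or> (x \<^bold>\<and> z)"

definition irl_f :: "('a, 'm) irl_alg_scheme \<Rightarrow> 'a"
  where "irl_f A = \<^bold>\<not>\<^bsub>A\<^esub> \<one>\<^bsub>A\<^esub>"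

definition irl_imp :: "('a, 'm) irl_alg_scheme \<Rightarrow> 'a \<Rightarrow> 'a \<Rightarrow> 'a" (infixr \<open>\<^bold>\<rightarrow>\<index>\<close> 66)
  where "x \<^bold>\<rightarrow>\<^bsub>A\<^esub> y = \<^bold>\<not>\<^bsub>A\<^esub> (x \<otimes>\<^bsub>A\<^esub> (\<^bold>\<not>\<^bsub>A\<^esub> y))"

definition anti_idempotent :: "('a, 'm) irl_alg_scheme \<Rightarrow> bool"
  where "anti_idempotent A \<longleftrightarrow>
    square_increasing_irl A \<and> (\<forall>x \<in> carrier A. x \<preceq>\<^bsub>A\<^esub> irl_f A \<otimes>\<^bsub>A\<^esub> irl_f A)"

definition irl_zero :: "('a, 'm) irl_alg_scheme \<Rightarrow> 'a"
  where "irl_zero A = \<^bold>\<not>\<^bsub>A\<^esub> (irl_f A \<otimes>\<^bsub>A\<^esub> irl_f A)"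


section \<open>Subalgebras, isomorphisms, congruences\<close>

definition subuniverse :: "('a, 'm) irl_alg_scheme \<Rightarrow> 'a set \<Rightarrow> bool"
  where "subuniverse A S \<longleftrightarrow> S \<subseteq> carrier A \<and> \<one>\<^bsub>A\<^esub> \<in> S \<and>
    (\<forall>x\<in>S. \<forall>y\<in>S. x \<otimes>\<^bsub>A\<^esub> y \<in> S \<and> x \<^bold>\<and>\<^bsub>A\<^esub> y \<in> S \<and> x \<^bold>\<or>\<^bsub>A\<^esub> y \<in> S) \<and>
    (\<forall>x\<in>S. \<^bold>\<not>\<^bsub>A\<^esub> x \<in> S)"

text \<open>An arbitrary algebra in the signature \<open>\<cdot>, \<and>, \<or>, \<not>, e\<close>.\<close>

definition sig_algebra :: "('a, 'm) irl_alg_scheme \<Rightarrow> bool"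
  where "sig_algebra A \<longleftrightarrow> subuniverse A (carrier A)"

definition irl_isomorphic :: "('a, 'm) irl_alg_scheme \<Rightarrow> ('b, 'n) irl_alg_scheme \<Rightarrow> bool"
  where "irl_isomorphic A B \<longleftrightarrow> (\<exists>h \<in> iso A B. h \<one>\<^bsub>A\<^esub> = \<one>\<^bsub>B\<^esub> \<and>
    (\<forall>x \<in> carrier A. \<forall>y \<in> carrier A.
      h (x \<^bold>\<and>\<^bsub>A\<^esub> y) = h x \<^bold>\<and>\<^bsub>B\<^esub> h y \<and> h (x \<^bold>\<or>\<^bsub>A\<^esub> y) = h x \<^bold>\<or>\<^bsub>B\<^esub> h y) \<and>
    (\<forall>x \<in> carrier A. h (\<^bold>\<not>\<^bsub>A\<^esub> x) = \<^bold>\<not>\<^bsub>B\<^esub> (h x)))"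

definition proper_subalgebra_of :: "('b, 'n) irl_alg_scheme \<Rightarrow> ('a, 'm) irl_alg_scheme \<Rightarrow> bool"
  where "proper_subalgebra_of B A \<longleftrightarrow>
    (\<exists>S. subuniverse A S \<and> S \<noteq> carrier A \<and> irl_isomorphic B (A\<lparr>carrier := S\<rparr>))"

definition n_generated :: "nat \<Rightarrow> ('a, 'm) irl_alg_scheme \<Rightarrow> bool"
  where "n_generated n A \<longleftrightarrow> (\<exists>X \<subseteq> carrier A. finite X \<and> card X \<le> n \<and>
    (\<forall>S. subuniverse A S \<and> X \<subseteq> S \<longrightarrow> S = carrier A))"

definition congruence :: "('a, 'm) irl_alg_scheme \<Rightarrow> ('a \<times> 'a) set \<Rightarrow> bool"
  where "congruence A \<theta> \<longleftrightarrow> equiv (carrier A) \<theta> \<and>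
    (\<forall>(x, x') \<in> \<theta>. \<forall>(y, y') \<in> \<theta>.
      (x \<otimes>\<^bsub>A\<^esub> y, x' \<otimes>\<^bsub>A\<^esub> y') \<in> \<theta> \<and>
      (x \<^bold>\<and>\<^bsub>A\<^esub> y, x' \<^bold>\<and>\<^bsub>A\<^esub> y') \<in> \<theta> \<and>
      (x \<^bold>\<or>\<^bsub>A\<^esub> y, x' \<^bold>\<or>\<^bsub>A\<^esub> y') \<in> \<theta>) \<and>
    (\<forall>(x, x') \<in> \<theta>. (\<^bold>\<not>\<^bsub>A\<^esub> x, \<^bold>\<not>\<^bsub>A\<^esub> x') \<in> \<theta>)"

definition nontrivial :: "('a, 'm) irl_alg_scheme \<Rightarrow> bool"
  where "nontrivial A \<longleftrightarrow> (\<exists>x \<in> carrier A. \<exists>y \<in> carrier A. x \<noteq> y)"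

definition simple_alg :: "('a, 'm) irl_alg_scheme \<Rightarrow> bool"
  where "simple_alg A \<longleftrightarrow> nontrivial A \<and>
    (\<forall>\<theta>. congruence A \<theta> \<longrightarrow> \<theta> = Id_on (carrier A) \<or> \<theta> = carrier A \<times> carrier A)"

text \<open>Finitely subdirectly irreducible: the identity relation is meet-irreducible
  in the congruence lattice.\<close>

definition fsi :: "('a, 'm) irl_alg_scheme \<Rightarrow> bool"
  where "fsi A \<longleftrightarrow> (\<forall>\<theta> \<psi>. congruence A \<theta> \<and> congruence A \<psi> \<and> \<theta> \<inter> \<psi> = Id_on (carrier A)
    \<longrightarrow> \<theta> = Id_on (carrier A) \<or> \<psi> = Id_on (carrier A))"


section \<open>Varieties\<close>

datatype irl_term =
    Var nat
  | One
  | Mult irl_term irl_term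
  | Wedge irl_term irl_term
  | Vee irl_term irl_term
  | Neg irl_term

primrec eval_term :: "('a, 'm) irl_alg_scheme \<Rightarrow> (nat \<Rightarrow> 'a) \<Rightarrow> irl_term \<Rightarrow> 'a"
  where
    "eval_term A v (Var n) = v n"
  | "eval_term A v One = \<one>\<^bsub>A\<^esub>"
  | "eval_term A v (Mult s t) = eval_term A v s \<otimes>\<^bsub>A\<^esub> eval_term A v t"
  | "eval_term A v (Wedge s t) = eval_term A v s \<^bold>\<and>\<^bsub>A\<^esub> eval_term A v t"
  | "eval_term A v (Vee s t) = eval_term A v s \<^bold>\<or>\<^bsub>A\<^esub> eval_term A v t"
  | "eval_term A v (Neg t) = \<^bold>\<not>\<^bsub>A\<^esub> (eval_term A v t)"

definition satisfies_eq :: "('a, 'm) irl_alg_scheme \<Rightarrow> irl_term \<times> irl_term \<Rightarrow> bool"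
  where "satisfies_eq A \<epsilon> \<longleftrightarrow>
    (\<forall>v. range v \<subseteq> carrier A \<longrightarrow> eval_term A v (fst \<epsilon>) = eval_term A v (snd \<epsilon>))"

text \<open>Varieties are equational classes, here relativised to the algebras whose universe is
  a subset of a given type \<open>'u\<close>. When \<open>'u\<close> is infinite, every countable algebra
  has a copy over \<open>'u\<close>, so no two varieties are conflated: inclusions, joins and covers of
  varieties are the same for the relativised classes as for the unrestricted ones.\<close>

definition variety :: "'u irl_alg set \<Rightarrow> bool"
  where "variety W \<longleftrightarrow> (\<exists>\<Sigma>. W = {A. sig_algebra A \<and> (\<forall>\<epsilon> \<in> \<Sigma>. satisfies_eq A \<epsilon>)})"

text \<open>The least variety containing (a copy of) \<open>A\<close>. The universe of \<open>A\<close> may lie in a type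
  other than \<open>'u\<close>, which is why \<open>A\<close> enters only through its copies over \<open>'u\<close>.\<close>

definition generated_variety :: "('a, 'm) irl_alg_scheme \<Rightarrow> 'u irl_alg set" (\<open>\<V>\<close>)
  where "\<V> A = \<Inter>{W. variety W \<and> {B. sig_algebra B \<and> irl_isomorphic A B} \<subseteq> W}"

definition DMM :: "'u irl_alg set"
  where "DMM = {A. de_morgan_monoid A}"

definition variety_M :: "'u irl_alg set"
  where "variety_M = {A. de_morgan_monoid A \<and> anti_idempotent A \<and> \<one>\<^bsub>A\<^esub> \<preceq>\<^bsub>A\<^esub> irl_f A \<and>
    (\<forall>x \<in> carrier A.
      ((irl_f A \<^bold>\<rightarrow>\<^bsub>A\<^esub> x) \<^bold>\<or>\<^bsub>A\<^esub> (x \<^bold>\<rightarrow>\<^bsub>A\<^esub> \<one>\<^bsub>A\<^esub>)) \<^bold>\<rightarrow>\<^bsub>A\<^esub> irl_zero A = irl_zero A)}"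

definition subvariety_lattice :: "'u irl_alg set gorder"
  where "subvariety_lattice = \<lparr>carrier = {W. variety W \<and> W \<subseteq> DMM}, eq = (=), le = (\<subseteq>)\<rparr>"

definition covers :: "('a, 'm) gorder_scheme \<Rightarrow> 'a \<Rightarrow> 'a \<Rightarrow> bool"
  where "covers L y x \<longleftrightarrow> x \<in> carrier L \<and> y \<in> carrier L \<and> x \<sqsubset>\<^bsub>L\<^esub> y \<and>
    \<not> (\<exists>z \<in> carrier L. x \<sqsubset>\<^bsub>L\<^esub> z \<and> z \<sqsubset>\<^bsub>L\<^esub> y)"

definition join_irreducible :: "('a, 'm) gorder_scheme \<Rightarrow> 'a \<Rightarrow> bool"
  where "join_irreducible L x \<longleftrightarrow> x \<in> carrier L \<and> x \<noteq> \<bottom>\<^bsub>L\<^esub> \<and>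
    (\<forall>y \<in> carrier L. \<forall>z \<in> carrier L. x = y \<squnion>\<^bsub>L\<^esub> z \<longrightarrow> x = y \<or> x = z)"

definition join_irreducible_cover :: "'u irl_alg set \<Rightarrow> 'u irl_alg set \<Rightarrow> bool"
  where "join_irreducible_cover K W \<longleftrightarrow>
    covers subvariety_lattice K W \<and> join_irreducible subvariety_lattice K"


section \<open>The particular algebras\<close>

definition alg_2 :: "bool irl_alg"
  where "alg_2 = \<lparr>carrier = UNIV, mult = (\<and>), one = True,
    wedge = (\<and>), vee = (\<or>), neg = Not\<rparr>"

text \<open>\<open>sugihara n\<close> has \<open>2n + 1\<close> elements.\<close>

definition sugihara :: "nat \<Rightarrow> int irl_alg"
  where "sugihara n = \<lparr>carrier = {- int n .. int n},
    mult = (\<lambda>a b. if \<bar>a\<bar> < \<bar>b\<bar> then b else if \<bar>b\<bar> < \<bar>a\<bar> then a else min a b),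
    one = 0, wedge = min, vee = max, neg = uminus\<rparr>"

abbreviation "alg_S3 \<equiv> sugihara 1"
abbreviation "alg_S5 \<equiv> sugihara 2"

datatype four = Zero4 | E4 | F4 | One4

primrec rank4 :: "four \<Rightarrow> nat"
  where "rank4 Zero4 = 0" | "rank4 E4 = 1" | "rank4 F4 = 2" | "rank4 One4 = 3"

primrec neg4 :: "four \<Rightarrow> four"
  where "neg4 Zero4 = One4" | "neg4 E4 = F4" | "neg4 F4 = E4" | "neg4 One4 = Zero4"

definition mult4 :: "four \<Rightarrow> four \<Rightarrow> four"
  where "mult4 x y =
    (if x = E4 then y else if y = E4 then x
     else if x = Zero4 \<or> y = Zero4 then Zero4 else One4)"

definition alg_C4 :: "four irl_alg"
  where "alg_C4 = \<lparr>carrier = UNIV, mult = mult4, one = E4,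
    wedge = (\<lambda>x y. if rank4 x \<le> rank4 y then x else y),
    vee = (\<lambda>x y. if rank4 x \<le> rank4 y then y else x), neg = neg4\<rparr>"

definition alg_D4 :: "four irl_alg"
  where "alg_D4 = \<lparr>carrier = UNIV, mult = mult4, one = E4,
    wedge = (\<lambda>x y. if x = y then x else if x = One4 then y else if y = One4 then x else Zero4),
    vee = (\<lambda>x y. if x = y then x else if x = Zero4 then y else if y = Zero4 then x else One4),
    neg = neg4\<rparr>"

text \<open>\<open>C 5, \<dots>, C 8\<close> are four pairwise non-isomorphic nontrivial 0-generated finitely
  subdirectly irreducible De Morgan monoids, none of them isomorphic to \<open>2\<close>, \<open>D\<^sub>4\<close> or \<open>C\<^sub>4\<close>.
  As there are exactly seven nontrivial 0-generated finitely subdirectly irreducible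
  De Morgan monoids up to isomorphism (Slaney), this determines the family \<open>C 5, \<dots>, C 8\<close> up to
  isomorphism and order. That these seven exhaust all cases is not part of the definition.\<close>

definition remaining_four :: "(nat \<Rightarrow> 'u irl_alg) \<Rightarrow> bool"
  where "remaining_four C \<longleftrightarrow>
    (\<forall>n \<in> {5, 6, 7, 8}. de_morgan_monoid (C n) \<and> nontrivial (C n) \<and> n_generated 0 (C n) \<and>
       fsi (C n) \<and> \<not> irl_isomorphic (C n) alg_2 \<and>
       \<not> irl_isomorphic (C n) alg_D4 \<and> \<not> irl_isomorphic (C n) alg_C4) \<and>
    (\<forall>m \<in> {5, 6, 7, 8}. \<forall>n \<in> {5, 6, 7, 8}. m \<noteq> n \<longrightarrow> \<not> irl_isomorphic (C m) (C n))"

end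

theory Submission
  imports Defs
begin

text \<open>
  Every algebra of a variety \<open>K\<close> of De Morgan monoids that violates an equation has a quotient
  in which \<open>e\<close> is join-prime and which still violates it (a maximal deductive filter avoiding an
  element is prime). So it suffices to look at such prime algebras \<open>B\<close>, where every \<open>x\<close> satisfies
  \<open>e \<le> x\<close> or \<open>x \<le> f\<close>. If \<open>f \<le> e\<close>, then \<open>B\<close> is idempotent and yields \<open>2\<close>, \<open>S\<^sub>3\<close> or \<open>S\<^sub>5\<close>. If
  not, the interval between \<open>\<not>(f\<^sup>2)\<close> and \<open>f\<^sup>2\<close> is a rigorously compact subalgebra, and \<open>B\<close> has
  the quotient \<open>S\<^sub>3\<close> unless that interval is all of \<open>B\<close>; moreover \<open>D\<^sub>4\<close> embeds into \<open>B\<close>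
  if \<open>e \<and> f\<close> is the bottom, while \<open>C\<^sub>4\<close> embeds into \<open>B\<close> or a quotient of it otherwise. A
  join-irreducible cover of \<open>\<V> X\<close> is generated by each of its members outside \<open>\<V> X\<close>, so it
  cannot contain any of the other three among \<open>2\<close>, \<open>S\<^sub>3\<close>, \<open>C\<^sub>4\<close>, \<open>D\<^sub>4\<close>.

  For \<open>C\<^sub>4\<close> and \<open>D\<^sub>4\<close>: in a bounded prime algebra whose negative cone is \<open>{0, e}\<close>, an element
  \<open>x\<close> with \<open>f \<cdot> x \<noteq> 1\<close> is \<open>0\<close> or invertible, and only \<open>e\<close> is invertible. Hence every \<open>x\<close> outside
  \<open>{0, e, f, 1}\<close> has \<open>f \<cdot> x = 1 = f \<cdot> \<not>x\<close>, i.e. violates the identity defining \<open>M\<close>, and generates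
  the required simple algebra. If \<open>e \<le> f\<close> fails, then the 0-generated subalgebra generates the
  cover, and Slaney's classification of these algebras is needed.
\<close>

section \<open>Homomorphisms, quotients and varieties\<close>

text \<open>Membership in a generated variety is handled as inclusion of equational theories
  (\<open>th_le\<close>), so only subalgebras, quotients and copies are formed, all over the fixed
  type \<open>'u\<close>. A variety is left out of another by exhibiting one equation. Primeness of
  \<open>e\<close> comes from a maximality argument. If the avoided element is
  \<open>0 = f \<rightarrow> e\<close>, maximality says more: nothing remains strictly between
  \<open>0\<close> and \<open>e\<close>. Such quotients are simple, and this is where the simple
  algebras for \<open>C4\<close> come from. When \<open>e \<le> f\<close> fails and
  \<open>e \<and> f\<close> is not \<open>0\<close>, everything is computed from
  \<open>a = e \<and> f\<close> and \<open>a \<rightarrow> e\<close>, the bounds of the congruence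
  class of \<open>e\<close> modulo the filter generated by \<open>a\<close>. Six elements of this
  class, their negations and the two bounds form a table of at most 14 elements, whose operations
  are fixed up to three yes-no questions. Only four combinations of answers are consistent, and they
  determine the 0-generated algebras. As \<open>C 5\<close> to \<open>C 8\<close> are four pairwise
  non-isomorphic algebras of this kind, each combination occurs exactly once among them; this is how
  the classification enters the proof.\<close>

definition irl_hom :: "('a, 'm) irl_alg_scheme \<Rightarrow> ('b, 'n) irl_alg_scheme \<Rightarrow> ('a \<Rightarrow> 'b) set"
  where "irl_hom A B = {h. h \<in> carrier A \<rightarrow> carrier B \<and> h \<one>\<^bsub>A\<^esub> = \<one>\<^bsub>B\<^esub> \<and>
    (\<forall>x \<in> carrier A. \<forall>y \<in> carrier A. h (x \<otimes>\<^bsub>A\<^esub> y) = h x \<otimes>\<^bsub>B\<^esub> h y \<and>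
      h (x \<^bold>\<and>\<^bsub>A\<^esub> y) = h x \<^bold>\<and>\<^bsub>B\<^esub> h y \<and> h (x \<^bold>\<or>\<^bsub>A\<^esub> y) = h x \<^bold>\<or>\<^bsub>B\<^esub> h y) \<and>
    (\<forall>x \<in> carrier A. h (\<^bold>\<not>\<^bsub>A\<^esub> x) = \<^bold>\<not>\<^bsub>B\<^esub> (h x))}"

lemma irl_homD:
  assumes "h \<in> irl_hom A B"
  shows "h \<one>\<^bsub>A\<^esub> = \<one>\<^bsub>B\<^esub>"
    and "x \<in> carrier A \<Longrightarrow> h x \<in> carrier B"
    and "\<lbrakk>x \<in> carrier A; y \<in> carrier A\<rbrakk> \<Longrightarrow> h (x \<otimes>\<^bsub>A\<^esub> y) = h x \<otimes>\<^bsub>B\<^esub> h y"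
    and "\<lbrakk>x \<in> carrier A; y \<in> carrier A\<rbrakk> \<Longrightarrow> h (x \<^bold>\<and>\<^bsub>A\<^esub> y) = h x \<^bold>\<and>\<^bsub>B\<^esub> h y"
    and "\<lbrakk>x \<in> carrier A; y \<in> carrier A\<rbrakk> \<Longrightarrow> h (x \<^bold>\<or>\<^bsub>A\<^esub> y) = h x \<^bold>\<or>\<^bsub>B\<^esub> h y"
    and "x \<in> carrier A \<Longrightarrow> h (\<^bold>\<not>\<^bsub>A\<^esub> x) = \<^bold>\<not>\<^bsub>B\<^esub> (h x)"
  using assms by (auto simp: irl_hom_def)

lemma sig_algebraD:
  assumes "sig_algebra A"
  shows "\<one>\<^bsub>A\<^esub> \<in> carrier A"
    and "\<lbrakk>x \<in> carrier A; y \<in> carrier A\<rbrakk> \<Longrightarrow> x \<otimes>\<^bsub>A\<^esub> y \<in> carrier A"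
    and "\<lbrakk>x \<in> carrier A; y \<in> carrier A\<rbrakk> \<Longrightarrow> x \<^bold>\<and>\<^bsub>A\<^esub> y \<in> carrier A"
    and "\<lbrakk>x \<in> carrier A; y \<in> carrier A\<rbrakk> \<Longrightarrow> x \<^bold>\<or>\<^bsub>A\<^esub> y \<in> carrier A"
    and "x \<in> carrier A \<Longrightarrow> \<^bold>\<not>\<^bsub>A\<^esub> x \<in> carrier A"
  using assms by (auto simp: sig_algebra_def subuniverse_def)

lemma irl_isomorphic_iff:
  "irl_isomorphic A B \<longleftrightarrow> (\<exists>h \<in> irl_hom A B. bij_betw h (carrier A) (carrier B))"
  unfolding irl_isomorphic_def iso_def hom_def irl_hom_def by blast

lemma irl_isomorphic_sym:
  assumes "sig_algebra A" "irl_isomorphic A B"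
  shows "irl_isomorphic B A"
proof -
  obtain h where h: "h \<in> irl_hom A B" and bij: "bij_betw h (carrier A) (carrier B)"
    using assms(2) irl_isomorphic_iff by blast
  let ?g = "inv_into (carrier A) h"
  have g: "?g (h x) = x" if "x \<in> carrier A" for x
    using bij that by (simp add: bij_betw_def inv_into_f_f)
  have onto: "\<exists>x \<in> carrier A. y = h x" if "y \<in> carrier B" for y
    using bij that by (auto simp: bij_betw_def)
  have ball: "(\<forall>y \<in> carrier B. P y) \<longleftrightarrow> (\<forall>x \<in> carrier A. P (h x))" for P
    unfolding bij_betw_imp_surj_on[OF bij, symmetric] by simp
  have "?g \<in> irl_hom B A"
    unfolding irl_hom_def Pi_def mem_Collect_eq Ball_def[symmetric] ball
    by (simp add: g irl_homD(1,3-6)[OF h, symmetric] sig_algebraD[OF assms(1)])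
  then show ?thesis
    using bij_betw_inv_into[OF bij] irl_isomorphic_iff by blast
qed

lemma irl_isomorphic_refl: "irl_isomorphic A A"
  unfolding irl_isomorphic_iff by (intro bexI[of _ id]) (auto simp: irl_hom_def)

lemma subuniverse_hom_image:
  assumes h: "h \<in> irl_hom A B" and A: "sig_algebra A"
  shows "subuniverse B (h ` carrier A)"
  unfolding subuniverse_def
  using irl_homD(2)[OF h]
  by (auto simp: irl_homD(1,3-6)[OF h, symmetric] sig_algebraD[OF A] simp del: image_eqI
      intro!: imageI)

lemma irl_isomorphic_image:
  assumes h: "h \<in> irl_hom A B" and inj: "inj_on h (carrier A)" and A: "sig_algebra A"
  shows "irl_isomorphic A (B\<lparr>carrier := h ` carrier A\<rparr>)"
    and "subuniverse B (h ` carrier A)"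
proof -
  have "h \<in> irl_hom A (B\<lparr>carrier := h ` carrier A\<rparr>)"
    using h by (auto simp: irl_hom_def)
  then show "irl_isomorphic A (B\<lparr>carrier := h ` carrier A\<rparr>)"
    unfolding irl_isomorphic_iff by (rule bexI[rotated]) (simp add: bij_betw_def inj)
  show "subuniverse B (h ` carrier A)"
    using h A by (rule subuniverse_hom_image)
qed

section \<open>Terms and comparison of equational theories\<close>

lemma eval_term_closed:
  assumes "sig_algebra A" "range v \<subseteq> carrier A"
  shows "eval_term A v t \<in> carrier A"
  using assms(2) by (induction t) (auto simp: sig_algebraD[OF assms(1)])

lemma eval_term_hom:
  assumes "sig_algebra A" "h \<in> irl_hom A B" "range v \<subseteq> carrier A"
  shows "h (eval_term A v t) = eval_term B (h \<circ> v) t"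
  by (induction t) (use assms in \<open>simp_all add: irl_homD[OF assms(2)] eval_term_closed\<close>)

text \<open>Stands for \<open>B\<close> lying in the variety generated by \<open>A\<close>. Stated
  on theories, it compares algebras over different types, such as \<open>alg_C4\<close> and a member
  of \<open>K\<close>.\<close>

definition th_le :: "('a, 'm) irl_alg_scheme \<Rightarrow> ('b, 'n) irl_alg_scheme \<Rightarrow> bool"
  where "th_le A B \<longleftrightarrow> (\<forall>\<epsilon>. satisfies_eq A \<epsilon> \<longrightarrow> satisfies_eq B \<epsilon>)"

lemma th_le_trans: "th_le A B \<Longrightarrow> th_le B D \<Longrightarrow> th_le A D"
  by (simp add: th_le_def)

lemma th_le_surj:
  assumes A: "sig_algebra A" and h: "h \<in> irl_hom A B" and surj: "h ` carrier A = carrier B"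
  shows "th_le A B"
  unfolding th_le_def satisfies_eq_def
proof (intro allI impI)
  fix \<epsilon> :: "irl_term \<times> irl_term" and v :: "nat \<Rightarrow> 'c"
  assume sat: "\<forall>v. range v \<subseteq> carrier A \<longrightarrow> eval_term A v (fst \<epsilon>) = eval_term A v (snd \<epsilon>)"
    and v: "range v \<subseteq> carrier B"
  have "v n \<in> h ` carrier A" for n
    using v unfolding surj by (rule subsetD) (rule rangeI)
  then have "\<forall>n. \<exists>x. x \<in> carrier A \<and> h x = v n"
    by (metis imageE)
  then obtain w where w: "\<And>n. w n \<in> carrier A \<and> h (w n) = v n"
    using choice[of "\<lambda>n x. x \<in> carrier A \<and> h x = v n"] by metis
  then have r: "range w \<subseteq> carrier A" and hw: "h \<circ> w = v"
    by (blast, simp add: fun_eq_iff)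
  have "h (eval_term A w (fst \<epsilon>)) = h (eval_term A w (snd \<epsilon>))"
    using sat r by simp
  then show "eval_term B v (fst \<epsilon>) = eval_term B v (snd \<epsilon>)"
    using eval_term_hom[OF A h r] hw by simp
qed

lemma th_le_inj:
  assumes A: "sig_algebra A" and h: "h \<in> irl_hom A B" and inj: "inj_on h (carrier A)"
  shows "th_le B A"
  unfolding th_le_def satisfies_eq_def
proof (intro allI impI)
  fix \<epsilon> :: "irl_term \<times> irl_term" and v :: "nat \<Rightarrow> 'a"
  assume sat: "\<forall>v. range v \<subseteq> carrier B \<longrightarrow> eval_term B v (fst \<epsilon>) = eval_term B v (snd \<epsilon>)"
    and v: "range v \<subseteq> carrier A"
  have "range (h \<circ> v) \<subseteq> carrier B"
    using v irl_homD(2)[OF h] by auto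
  then have "h (eval_term A v (fst \<epsilon>)) = h (eval_term A v (snd \<epsilon>))"
    using sat by (simp add: eval_term_hom[OF A h v])
  then show "eval_term A v (fst \<epsilon>) = eval_term A v (snd \<epsilon>)"
    using inj_onD[OF inj] eval_term_closed[OF A v] by simp
qed

lemma th_le_iso:
  assumes "sig_algebra A" "irl_isomorphic A B"
  shows "th_le A B" "th_le B A"
proof -
  obtain h where h: "h \<in> irl_hom A B" "inj_on h (carrier A)" "h ` carrier A = carrier B"
    using assms(2) by (auto simp: irl_isomorphic_iff bij_betw_def)
  show "th_le A B" "th_le B A"
    using th_le_surj[OF assms(1) h(1,3)] th_le_inj[OF assms(1) h(1,2)] by auto
qed

lemma sig_algebra_subuniverse:
  "subuniverse A S \<Longrightarrow> sig_algebra (A\<lparr>carrier := S\<rparr>)"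
  by (simp add: sig_algebra_def subuniverse_def)

lemma th_le_subuniverse:
  assumes "subuniverse A S"
  shows "th_le A (A\<lparr>carrier := S\<rparr>)"
proof (rule th_le_inj)
  show "id \<in> irl_hom (A\<lparr>carrier := S\<rparr>) A"
    using assms by (auto simp: irl_hom_def subuniverse_def)
qed (use assms in \<open>simp_all add: sig_algebra_subuniverse\<close>)

definition generated_subuniverse :: "('a, 'm) irl_alg_scheme \<Rightarrow> 'a set \<Rightarrow> 'a set"
  where "generated_subuniverse A X = \<Inter>{S. subuniverse A S \<and> X \<subseteq> S}"

lemma generated_subuniverse:
  assumes "sig_algebra A" "X \<subseteq> carrier A"
  shows "subuniverse A (generated_subuniverse A X)" "X \<subseteq> generated_subuniverse A X"
proof -
  have car: "subuniverse A (carrier A)"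
    using assms by (simp add: sig_algebra_def)
  have "generated_subuniverse A X \<subseteq> carrier A"
    unfolding generated_subuniverse_def using car assms(2) by blast
  then show "subuniverse A (generated_subuniverse A X)"
    unfolding subuniverse_def generated_subuniverse_def by auto
  show "X \<subseteq> generated_subuniverse A X"
    unfolding generated_subuniverse_def by auto
qed

lemma n_generated_generated_subuniverse:
  assumes "sig_algebra A" "X \<subseteq> carrier A" "finite X" "card X \<le> n"
  shows "n_generated n (A\<lparr>carrier := generated_subuniverse A X\<rparr>)"
  unfolding n_generated_def
proof (intro exI[of _ X] conjI allI impI)
  let ?G = "generated_subuniverse A X"
  show "X \<subseteq> carrier (A\<lparr>carrier := ?G\<rparr>)"
    using generated_subuniverse[OF assms(1,2)] by simp
  fix S assume S: "subuniverse (A\<lparr>carrier := ?G\<rparr>) S \<and> X \<subseteq> S"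
  then have "subuniverse A S"
    using generated_subuniverse[OF assms(1,2)] by (auto simp: subuniverse_def)
  then have "?G \<subseteq> S"
    using S by (auto simp: generated_subuniverse_def)
  then show "S = carrier (A\<lparr>carrier := ?G\<rparr>)"
    using S by (auto simp: subuniverse_def)
qed (use assms in auto)

section \<open>Quotient algebras\<close>

definition congruence_rep :: "('a \<times> 'a) set \<Rightarrow> 'a \<Rightarrow> 'a"
  where "congruence_rep \<theta> x = (SOME y. (x, y) \<in> \<theta>)"

text \<open>The quotient by a congruence is carried by a transversal, so that it lives over the
  same type.\<close>

definition quotient_alg :: "('a, 'm) irl_alg_scheme \<Rightarrow> ('a \<times> 'a) set \<Rightarrow> 'a irl_alg"
  where "quotient_alg A \<theta> = \<lparr>carrier = congruence_rep \<theta> ` carrier A,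
    mult = (\<lambda>x y. congruence_rep \<theta> (x \<otimes>\<^bsub>A\<^esub> y)), one = congruence_rep \<theta> \<one>\<^bsub>A\<^esub>,
    wedge = (\<lambda>x y. congruence_rep \<theta> (x \<^bold>\<and>\<^bsub>A\<^esub> y)), vee = (\<lambda>x y. congruence_rep \<theta> (x \<^bold>\<or>\<^bsub>A\<^esub> y)),
    neg = (\<lambda>x. congruence_rep \<theta> (\<^bold>\<not>\<^bsub>A\<^esub> x))\<rparr>"

lemma
  assumes A: "sig_algebra A" and c: "congruence A \<theta>"
  shows congruence_rep_eq_iff:
      "\<lbrakk>x \<in> carrier A; y \<in> carrier A\<rbrakk> \<Longrightarrow> congruence_rep \<theta> x = congruence_rep \<theta> y \<longleftrightarrow> (x, y) \<in> \<theta>"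
    and congruence_rep_hom: "congruence_rep \<theta> \<in> irl_hom A (quotient_alg A \<theta>)"
    and congruence_rep_surj: "congruence_rep \<theta> ` carrier A = carrier (quotient_alg A \<theta>)"
    and sig_algebra_quotient: "sig_algebra (quotient_alg A \<theta>)"
    and th_le_quotient: "th_le A (quotient_alg A \<theta>)"
proof -
  have eq: "equiv (carrier A) \<theta>"
    using c by (simp add: congruence_def)
  let ?r = "congruence_rep \<theta>"
  have rel: "(x, ?r x) \<in> \<theta>" if "x \<in> carrier A" for x
    unfolding congruence_rep_def by (rule someI[of _ x]) (use eq that in \<open>auto simp: equiv_def refl_on_def\<close>)
  have car: "?r x \<in> carrier A" if "x \<in> carrier A" for x
    using rel[OF that] eq by (auto simp: equiv_def refl_on_def)
  have cong: "?r x = ?r y" if "(x, y) \<in> \<theta>" for x y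
    unfolding congruence_rep_def
    using that eq by (metis equivE symD transD)
  show iff: "?r x = ?r y \<longleftrightarrow> (x, y) \<in> \<theta>" if "x \<in> carrier A" "y \<in> carrier A" for x y
    using rel[OF that(1)] rel[OF that(2)] cong eq by (metis equivE symD transD)
  have ops: "(x \<otimes>\<^bsub>A\<^esub> y, x' \<otimes>\<^bsub>A\<^esub> y') \<in> \<theta>" "(x \<^bold>\<and>\<^bsub>A\<^esub> y, x' \<^bold>\<and>\<^bsub>A\<^esub> y') \<in> \<theta>" "(x \<^bold>\<or>\<^bsub>A\<^esub> y, x' \<^bold>\<or>\<^bsub>A\<^esub> y') \<in> \<theta>"
    "(\<^bold>\<not>\<^bsub>A\<^esub> x, \<^bold>\<not>\<^bsub>A\<^esub> x') \<in> \<theta>"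
    if "(x, x') \<in> \<theta>" "(y, y') \<in> \<theta>" for x x' y y'
    using c that unfolding congruence_def by blast+
  note neg = ops(4)[OF rel rel]
  show hom: "?r \<in> irl_hom A (quotient_alg A \<theta>)"
    unfolding irl_hom_def quotient_alg_def
    using ops(1-3) rel neg by (auto intro!: cong)
  show surj: "?r ` carrier A = carrier (quotient_alg A \<theta>)"
    by (simp add: quotient_alg_def)
  show "sig_algebra (quotient_alg A \<theta>)"
    unfolding sig_algebra_def subuniverse_def quotient_alg_def
    by (auto intro!: imageI simp: sig_algebraD[OF A] car)
  show "th_le A (quotient_alg A \<theta>)"
    using th_le_surj[OF A hom surj] .
qed

section \<open>Generated varieties as model classes, joins of subvarieties\<close>

lemma sig_algebra_copy:
  fixes g :: "'a \<Rightarrow> 'u"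
  assumes A: "sig_algebra A" and inj: "inj_on g (carrier A)"
  shows "\<exists>B :: 'u irl_alg. sig_algebra B \<and> irl_isomorphic A B"
proof -
  let ?k = "inv_into (carrier A) g"
  let ?B = "\<lparr>carrier = g ` carrier A, mult = (\<lambda>x y. g (?k x \<otimes>\<^bsub>A\<^esub> ?k y)), one = g \<one>\<^bsub>A\<^esub>,
    wedge = (\<lambda>x y. g (?k x \<^bold>\<and>\<^bsub>A\<^esub> ?k y)), vee = (\<lambda>x y. g (?k x \<^bold>\<or>\<^bsub>A\<^esub> ?k y)),
    neg = (\<lambda>x. g (\<^bold>\<not>\<^bsub>A\<^esub> (?k x)))\<rparr> :: 'u irl_alg"
  have k: "?k (g x) = x" if "x \<in> carrier A" for x
    using inj that by (simp add: inv_into_f_f)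
  have "g \<in> irl_hom A ?B"
    by (auto simp: irl_hom_def k)
  then have "irl_isomorphic A ?B"
    unfolding irl_isomorphic_iff by (rule bexI[rotated]) (simp add: bij_betw_def inj)
  moreover have "sig_algebra ?B"
    unfolding sig_algebra_def subuniverse_def by (auto simp: k sig_algebraD[OF A])
  ultimately show ?thesis
    by blast
qed

lemma sig_algebra_finite_copy:
  assumes "sig_algebra A" "finite (carrier A)" "infinite (UNIV :: 'u set)"
  shows "\<exists>B :: 'u irl_alg. sig_algebra B \<and> irl_isomorphic A B"
proof -
  obtain T :: "'u set" where "finite T" "card T = card (carrier A)"
    using infinite_arbitrarily_large[OF assms(3)] by metis
  then obtain g where "bij_betw g (carrier A) T"
    using finite_same_card_bij[OF assms(2)] by metis
  then show ?thesis
    using sig_algebra_copy[OF assms(1)] by (auto simp: bij_betw_def)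
qed

text \<open>Every variety in the intersection contains the copy \<open>B\<close>, whose theory is
  that of \<open>A\<close>. Without a copy over \<open>'u\<close> the intersection would be the
  variety of trivial algebras.\<close>

lemma generated_variety_eq:
  fixes B :: "'u irl_alg"
  assumes "sig_algebra A" "sig_algebra B" "irl_isomorphic A B"
  shows "\<V> A = {D :: 'u irl_alg. sig_algebra D \<and> th_le A D}"
proof (intro equalityI subsetI)
  fix D :: "'u irl_alg" assume D: "D \<in> \<V> A"
  let ?W = "{D :: 'u irl_alg. sig_algebra D \<and> th_le A D}"
  have "variety ?W"
    unfolding variety_def
    by (rule exI[of _ "{\<epsilon>. satisfies_eq A \<epsilon>}"]) (auto simp: th_le_def)
  moreover have "{B. sig_algebra B \<and> irl_isomorphic A B} \<subseteq> ?W"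
    using th_le_iso[OF assms(1)] by blast
  ultimately show "D \<in> ?W"
    using D unfolding generated_variety_def by blast
next
  fix D :: "'u irl_alg" assume D: "D \<in> {D. sig_algebra D \<and> th_le A D}"
  show "D \<in> \<V> A"
    unfolding generated_variety_def
  proof (rule InterI)
    fix W :: "'u irl_alg set" assume W: "W \<in> {W. variety W \<and> {B. sig_algebra B \<and> irl_isomorphic A B} \<subseteq> W}"
    then obtain \<Sigma> where \<Sigma>: "W = {A. sig_algebra A \<and> (\<forall>\<epsilon> \<in> \<Sigma>. satisfies_eq A \<epsilon>)}"
      by (auto simp: variety_def)
    have "B \<in> W"
      using W assms by blast
    then have "\<forall>\<epsilon>\<in>\<Sigma>. satisfies_eq A \<epsilon>"
      using th_le_iso[OF assms(1,3)] \<Sigma> by (auto simp: th_le_def)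
    then show "D \<in> W"
      using D \<Sigma> by (auto simp: th_le_def)
  qed
qed

lemma generated_variety_self:
  fixes A :: "'u irl_alg"
  assumes "sig_algebra A"
  shows "\<V> A = {D :: 'u irl_alg. sig_algebra D \<and> th_le A D}"
  using generated_variety_eq[OF assms assms irl_isomorphic_refl] .

lemma generated_variety_finite:
  assumes "sig_algebra A" "finite (carrier A)" "infinite (UNIV :: 'u set)"
  shows "\<V> A = {D :: 'u irl_alg. sig_algebra D \<and> th_le A D}"
  using sig_algebra_finite_copy[OF assms] generated_variety_eq[OF assms(1)] by blast

lemma variety_models: "variety {D :: 'u irl_alg. sig_algebra D \<and> th_le A D}"
  unfolding variety_def
  by (rule exI[of _ "{\<epsilon>. satisfies_eq A \<epsilon>}"]) (auto simp: th_le_def)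

lemma variety_sig: "variety W \<Longrightarrow> A \<in> W \<Longrightarrow> sig_algebra A"
  by (auto simp: variety_def)

lemma variety_closed: "\<lbrakk>variety W; A \<in> W; sig_algebra B; th_le A B\<rbrakk> \<Longrightarrow> B \<in> W"
  by (auto simp: variety_def th_le_def)

definition variety_join :: "'u irl_alg set \<Rightarrow> 'u irl_alg set \<Rightarrow> 'u irl_alg set"
  where "variety_join W Z =
    {A. sig_algebra A \<and> (\<forall>\<epsilon>. (\<forall>B \<in> W \<union> Z. satisfies_eq B \<epsilon>) \<longrightarrow> satisfies_eq A \<epsilon>)}"

lemma variety_variety_join: "variety (variety_join W Z)"
  unfolding variety_def variety_join_def
  by (rule exI[of _ "{\<epsilon>. \<forall>B \<in> W \<union> Z. satisfies_eq B \<epsilon>}"]) auto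

lemma variety_join_upper: "variety W \<Longrightarrow> variety Z \<Longrightarrow> W \<union> Z \<subseteq> variety_join W Z"
  by (auto simp: variety_join_def variety_sig)

lemma variety_join_least: "variety K \<Longrightarrow> W \<union> Z \<subseteq> K \<Longrightarrow> variety_join W Z \<subseteq> K"
  unfolding variety_def variety_join_def by (elim exE) (simp add: subset_iff Ball_def)

text \<open>The join of a \<open>gorder\<close> is a choice among least upper bounds, so it has a
  definite value only once the least upper bound is known to exist and to be unique.\<close>

lemma join_subvariety_lattice:
  assumes W: "W \<in> carrier subvariety_lattice" and Z: "Z \<in> carrier subvariety_lattice"
    and DMM: "variety_join W Z \<subseteq> DMM"
  shows "W \<squnion>\<^bsub>subvariety_lattice\<^esub> Z = variety_join W Z"
proof -
  have up: "J \<in> Upper subvariety_lattice {W, Z} \<longleftrightarrow> variety J \<and> J \<subseteq> DMM \<and> W \<union> Z \<subseteq> J" for J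
    using W Z by (auto simp: Upper_def subvariety_lattice_def)
  have J: "variety_join W Z \<in> Upper subvariety_lattice {W, Z}"
    unfolding up using W Z DMM variety_join_upper[of W Z] variety_variety_join[of W Z]
    by (simp add: subvariety_lattice_def)
  have "least subvariety_lattice J (Upper subvariety_lattice {W, Z}) \<longleftrightarrow> J = variety_join W Z" for J
  proof
    assume J': "least subvariety_lattice J (Upper subvariety_lattice {W, Z})"
    then have "J \<subseteq> variety_join W Z"
      using J by (auto simp: least_def subvariety_lattice_def)
    moreover have "variety_join W Z \<subseteq> J"
      using J' up[of J] by (intro variety_join_least) (auto simp: least_def)
    ultimately show "J = variety_join W Z"
      by blast
  next
    assume "J = variety_join W Z"
    moreover have "Upper subvariety_lattice {W, Z} \<subseteq> carrier subvariety_lattice"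
      by (rule Upper_closed)
    moreover have "variety_join W Z \<sqsubseteq>\<^bsub>subvariety_lattice\<^esub> Y"
      if "Y \<in> Upper subvariety_lattice {W, Z}" for Y
      using that variety_join_least[of Y W Z] unfolding up by (simp add: subvariety_lattice_def)
    ultimately show "least subvariety_lattice J (Upper subvariety_lattice {W, Z})"
      unfolding least_def using J by blast
  qed
  then show ?thesis
    by (simp add: join_def sup_def)
qed

text \<open>If \<open>B\<close> lies in \<open>K\<close> but not in \<open>W\<close>, then \<open>K\<close> is the join of \<open>W\<close> and \<open>\<V> B\<close>.\<close>

lemma join_irreducible_cover_eq:
  fixes K :: "'u irl_alg set"
  assumes K: "join_irreducible_cover K W" and B: "B \<in> K" "B \<notin> W"
  shows "K = \<V> B"
proof -
  let ?L = "subvariety_lattice :: 'u irl_alg set gorder"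
  have cov: "covers ?L K W" and irr: "join_irreducible ?L K"
    using K by (simp_all add: join_irreducible_cover_def)
  have WL: "W \<in> carrier ?L" and KL: "K \<in> carrier ?L" and lt: "W \<sqsubset>\<^bsub>?L\<^esub> K"
    using cov by (simp_all add: covers_def)
  have W: "variety W" "W \<subseteq> DMM" and KK: "variety K" "K \<subseteq> DMM" and sub: "W \<subseteq> K"
    using WL KL lt by (simp_all add: subvariety_lattice_def lless_def)
  have nb: "\<not> J \<subset> K" if J: "variety J" "J \<subseteq> DMM" "W \<subset> J" for J
  proof
    assume "J \<subset> K"
    then have "J \<in> carrier ?L" "W \<sqsubset>\<^bsub>?L\<^esub> J" "J \<sqsubset>\<^bsub>?L\<^esub> K"
      using J by (auto simp: subvariety_lattice_def lless_def)
    then show False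
      using cov unfolding covers_def by blast
  qed
  have sB: "sig_algebra B"
    using B KK variety_sig by blast
  note VB_eq = generated_variety_self[OF sB]
  have VB: "variety (\<V> B :: 'u irl_alg set)"
    unfolding VB_eq by (rule variety_models)
  have BV: "B \<in> \<V> B"
    unfolding VB_eq using sB by (simp add: th_le_def)
  have VBK: "\<V> B \<subseteq> K"
    unfolding VB_eq using variety_closed[OF KK(1) B(1)] by blast
  let ?J = "variety_join W (\<V> B)"
  have up: "W \<union> \<V> B \<subseteq> ?J" and lo: "?J \<subseteq> K"
    using variety_join_upper[OF W(1) VB] variety_join_least[OF KK(1)] sub VBK by auto
  have "W \<subset> ?J"
    using up BV B by blast
  then have JK: "?J = K"
    using nb[OF variety_variety_join] lo KK by blast
  have VL: "\<V> B \<in> carrier ?L"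
    using VB VBK KK by (auto simp: subvariety_lattice_def)
  have "K = W \<squnion>\<^bsub>?L\<^esub> \<V> B"
    using join_subvariety_lattice[OF WL VL] JK KK by simp
  then have "K = W \<or> K = \<V> B"
    using irr WL VL unfolding join_irreducible_def by blast
  then show ?thesis
    using B by blast
qed

section \<open>Arithmetic of involutive residuated lattices\<close>

context irl
begin

lemmas irl_closed = m_closed one_closed wedge_closed vee_closed neg_closed
declare irl_closed [simp]

abbreviation "\<f> \<equiv> irl_f A"
abbreviation "\<t> \<equiv> \<f> \<otimes> \<f>"
abbreviation "\<z> \<equiv> irl_zero A"

lemma ff_closed [simp]: "\<f> \<in> carrier A"
  and zz_closed [simp]: "\<z> \<in> carrier A"
  by (simp_all add: irl_f_def irl_zero_def)

lemma imp_closed [simp]: "\<lbrakk>x \<in> carrier A; y \<in> carrier A\<rbrakk> \<Longrightarrow> x \<^bold>\<rightarrow> y \<in> carrier A"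
  by (simp add: irl_imp_def)

lemma sig_algebra: "sig_algebra A"
  by (auto simp: sig_algebra_def subuniverse_def)

lemma neg_simps [simp]:
  "x \<in> carrier A \<Longrightarrow> \<^bold>\<not> (\<^bold>\<not> x) = x" "\<^bold>\<not> \<one> = \<f>" "\<^bold>\<not> \<f> = \<one>" "\<^bold>\<not> \<t> = \<z>" "\<^bold>\<not> \<z> = \<t>"
  by (simp_all add: neg_neg irl_f_def irl_zero_def)

lemma neg_inject: "\<lbrakk>x \<in> carrier A; y \<in> carrier A\<rbrakk> \<Longrightarrow> \<^bold>\<not> x = \<^bold>\<not> y \<longleftrightarrow> x = y"
  using neg_neg by metis

lemma wedge_idem [simp]: "x \<in> carrier A \<Longrightarrow> x \<^bold>\<and> x = x"
  using wedge_absorb[of x "x \<^bold>\<and> x"] vee_absorb[of x x] by simp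

lemma vee_idem [simp]: "x \<in> carrier A \<Longrightarrow> x \<^bold>\<or> x = x"
  using vee_absorb[of x "x \<^bold>\<or> x"] wedge_absorb[of x x] by simp

lemma le_refl [simp]: "x \<in> carrier A \<Longrightarrow> x \<preceq> x"
  by (simp add: irl_le_def)

lemma le_antisym: "\<lbrakk>x \<preceq> y; y \<preceq> x; x \<in> carrier A; y \<in> carrier A\<rbrakk> \<Longrightarrow> x = y"
  using wedge_comm by (simp add: irl_le_def)

lemma le_trans: "\<lbrakk>x \<preceq> y; y \<preceq> z; x \<in> carrier A; y \<in> carrier A; z \<in> carrier A\<rbrakk> \<Longrightarrow> x \<preceq> z"
  unfolding irl_le_def by (metis wedge_assoc)

lemma le_iff_vee: "\<lbrakk>x \<in> carrier A; y \<in> carrier A\<rbrakk> \<Longrightarrow> x \<preceq> y \<longleftrightarrow> x \<^bold>\<or> y = y"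
  unfolding irl_le_def by (metis wedge_absorb vee_absorb wedge_comm vee_comm)

lemma wedge_le1 [simp]: "\<lbrakk>x \<in> carrier A; y \<in> carrier A\<rbrakk> \<Longrightarrow> x \<^bold>\<and> y \<preceq> x"
  and wedge_le2 [simp]: "\<lbrakk>x \<in> carrier A; y \<in> carrier A\<rbrakk> \<Longrightarrow> x \<^bold>\<and> y \<preceq> y"
  unfolding irl_le_def by (metis wedge_assoc wedge_comm wedge_idem wedge_closed)+

lemma le_wedge_iff: "\<lbrakk>x \<in> carrier A; y \<in> carrier A; z \<in> carrier A\<rbrakk>
    \<Longrightarrow> z \<preceq> x \<^bold>\<and> y \<longleftrightarrow> z \<preceq> x \<and> z \<preceq> y"
  using le_trans[of z "x \<^bold>\<and> y" x] le_trans[of z "x \<^bold>\<and> y" y] wedge_assoc[of z x y]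
  by (auto simp: irl_le_def[of A z])

lemma vee_ge1 [simp]: "\<lbrakk>x \<in> carrier A; y \<in> carrier A\<rbrakk> \<Longrightarrow> x \<preceq> x \<^bold>\<or> y"
  and vee_ge2 [simp]: "\<lbrakk>x \<in> carrier A; y \<in> carrier A\<rbrakk> \<Longrightarrow> y \<preceq> x \<^bold>\<or> y"
  unfolding irl_le_def by (metis wedge_absorb vee_comm)+

lemma vee_le_iff: "\<lbrakk>x \<in> carrier A; y \<in> carrier A; z \<in> carrier A\<rbrakk>
    \<Longrightarrow> x \<^bold>\<or> y \<preceq> z \<longleftrightarrow> x \<preceq> z \<and> y \<preceq> z"
  using le_trans[of x "x \<^bold>\<or> y" z] le_trans[of y "x \<^bold>\<or> y" z] vee_assoc[of x y z]
  by (auto simp: le_iff_vee[of _ z])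

lemma neg_le_neg_iff: "\<lbrakk>x \<in> carrier A; y \<in> carrier A\<rbrakk> \<Longrightarrow> \<^bold>\<not> y \<preceq> \<^bold>\<not> x \<longleftrightarrow> x \<preceq> y"
  using residuation[of x \<one> y] by simp

lemma neg_le_iff: "\<lbrakk>x \<in> carrier A; y \<in> carrier A\<rbrakk> \<Longrightarrow> \<^bold>\<not> x \<preceq> y \<longleftrightarrow> \<^bold>\<not> y \<preceq> x"
  using neg_le_neg_iff[of "\<^bold>\<not> y" x] by simp

lemma le_neg_iff: "\<lbrakk>x \<in> carrier A; y \<in> carrier A\<rbrakk> \<Longrightarrow> x \<preceq> \<^bold>\<not> y \<longleftrightarrow> y \<preceq> \<^bold>\<not> x"
  using neg_le_neg_iff[of x "\<^bold>\<not> y"] by simp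

lemma le_f_iff: "x \<in> carrier A \<Longrightarrow> x \<preceq> \<f> \<longleftrightarrow> \<one> \<preceq> \<^bold>\<not> x"
  using le_neg_iff[of x \<one>] by simp

lemma f_le_iff: "x \<in> carrier A \<Longrightarrow> \<f> \<preceq> x \<longleftrightarrow> \<^bold>\<not> x \<preceq> \<one>"
  using neg_le_iff[of \<one> x] by simp

lemma mult_le_f_iff: "\<lbrakk>x \<in> carrier A; y \<in> carrier A\<rbrakk> \<Longrightarrow> x \<otimes> y \<preceq> \<f> \<longleftrightarrow> x \<preceq> \<^bold>\<not> y"
  using residuation[of x y \<f>] le_neg_iff[of y x] by simp

lemma le_iff_mult: "\<lbrakk>x \<in> carrier A; y \<in> carrier A\<rbrakk> \<Longrightarrow> x \<preceq> y \<longleftrightarrow> x \<otimes> \<^bold>\<not> y \<preceq> \<f>"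
  using mult_le_f_iff[of x "\<^bold>\<not> y"] by simp

lemma mult_le_iff: "\<lbrakk>x \<in> carrier A; y \<in> carrier A; z \<in> carrier A\<rbrakk>
    \<Longrightarrow> x \<otimes> y \<preceq> z \<longleftrightarrow> x \<preceq> y \<^bold>\<rightarrow> z"
  unfolding irl_imp_def
  using le_iff_mult[of "x \<otimes> y" z] mult_le_f_iff[of x "y \<otimes> \<^bold>\<not> z"] by (simp add: m_assoc)

lemma mult_imp_le: "\<lbrakk>x \<in> carrier A; y \<in> carrier A\<rbrakk> \<Longrightarrow> x \<otimes> (x \<^bold>\<rightarrow> y) \<preceq> y"
  using mult_le_iff[of "x \<^bold>\<rightarrow> y" x y] by (simp add: m_comm)

lemma one_le_imp_iff: "\<lbrakk>x \<in> carrier A; y \<in> carrier A\<rbrakk> \<Longrightarrow> \<one> \<preceq> x \<^bold>\<rightarrow> y \<longleftrightarrow> x \<preceq> y"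
  using mult_le_iff[of \<one> x y] by simp

lemma imp_one_left [simp]: "x \<in> carrier A \<Longrightarrow> \<one> \<^bold>\<rightarrow> x = x"
  by (simp add: irl_imp_def)

lemma imp_imp: "\<lbrakk>x \<in> carrier A; y \<in> carrier A; z \<in> carrier A\<rbrakk>
    \<Longrightarrow> x \<^bold>\<rightarrow> (y \<^bold>\<rightarrow> z) = (x \<otimes> y) \<^bold>\<rightarrow> z"
  by (simp add: irl_imp_def m_assoc)

lemma mult_mono_left:
  assumes "x \<preceq> y" "x \<in> carrier A" "y \<in> carrier A" "z \<in> carrier A"
  shows "x \<otimes> z \<preceq> y \<otimes> z"
proof -
  have "y \<preceq> z \<^bold>\<rightarrow> y \<otimes> z"
    using assms mult_le_iff[of y z "y \<otimes> z"] by simp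
  then show ?thesis
    using assms mult_le_iff[of x z "y \<otimes> z"] le_trans[of x y "z \<^bold>\<rightarrow> y \<otimes> z"] by simp
qed

lemma mult_mono:
  assumes "x \<preceq> y" "u \<preceq> v" "x \<in> carrier A" "y \<in> carrier A" "u \<in> carrier A" "v \<in> carrier A"
  shows "x \<otimes> u \<preceq> y \<otimes> v"
proof (rule le_trans)
  show "x \<otimes> u \<preceq> y \<otimes> u"
    using assms by (simp add: mult_mono_left)
  show "y \<otimes> u \<preceq> y \<otimes> v"
    using assms mult_mono_left[of u v y] by (simp add: m_comm)
qed (use assms in simp_all)

lemma vee_mult_distrib:
  assumes "x \<in> carrier A" "y \<in> carrier A" "z \<in> carrier A"
  shows "(x \<^bold>\<or> y) \<otimes> z = (x \<otimes> z) \<^bold>\<or> (y \<otimes> z)"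
proof (rule le_antisym)
  have "x \<^bold>\<or> y \<preceq> z \<^bold>\<rightarrow> ((x \<otimes> z) \<^bold>\<or> (y \<otimes> z))"
    using assms mult_le_iff[of x z "(x \<otimes> z) \<^bold>\<or> (y \<otimes> z)"] mult_le_iff[of y z "(x \<otimes> z) \<^bold>\<or> (y \<otimes> z)"]
    by (simp add: vee_le_iff)
  then show "(x \<^bold>\<or> y) \<otimes> z \<preceq> (x \<otimes> z) \<^bold>\<or> (y \<otimes> z)"
    using assms mult_le_iff[of "x \<^bold>\<or> y" z "(x \<otimes> z) \<^bold>\<or> (y \<otimes> z)"] by simp
qed (use assms in \<open>simp_all add: vee_le_iff mult_mono_left\<close>)

lemma mult_vee_distrib:
  assumes "x \<in> carrier A" "y \<in> carrier A" "z \<in> carrier A"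
  shows "z \<otimes> (x \<^bold>\<or> y) = (z \<otimes> x) \<^bold>\<or> (z \<otimes> y)"
  using vee_mult_distrib[OF assms] assms by (simp add: m_comm)

lemma neg_wedge:
  assumes "x \<in> carrier A" "y \<in> carrier A"
  shows "\<^bold>\<not> (x \<^bold>\<and> y) = \<^bold>\<not> x \<^bold>\<or> \<^bold>\<not> y"
proof (rule le_antisym)
  show "\<^bold>\<not> (x \<^bold>\<and> y) \<preceq> \<^bold>\<not> x \<^bold>\<or> \<^bold>\<not> y"
    using assms by (simp add: neg_le_iff[of "x \<^bold>\<and> y"] le_wedge_iff neg_le_iff[of "\<^bold>\<not> x \<^bold>\<or> \<^bold>\<not> y"])
  show "\<^bold>\<not> x \<^bold>\<or> \<^bold>\<not> y \<preceq> \<^bold>\<not> (x \<^bold>\<and> y)"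
    using assms by (simp add: vee_le_iff neg_le_neg_iff)
qed (use assms in simp_all)

lemma neg_vee:
  assumes "x \<in> carrier A" "y \<in> carrier A"
  shows "\<^bold>\<not> (x \<^bold>\<or> y) = \<^bold>\<not> x \<^bold>\<and> \<^bold>\<not> y"
  using neg_wedge[of "\<^bold>\<not> x" "\<^bold>\<not> y"] assms neg_neg by (metis neg_closed wedge_closed)

lemma neg_mult: "\<lbrakk>x \<in> carrier A; y \<in> carrier A\<rbrakk> \<Longrightarrow> \<^bold>\<not> (x \<otimes> y) = x \<^bold>\<rightarrow> \<^bold>\<not> y"
  by (simp add: irl_imp_def)

lemma neg_imp: "\<lbrakk>x \<in> carrier A; y \<in> carrier A\<rbrakk> \<Longrightarrow> \<^bold>\<not> (x \<^bold>\<rightarrow> y) = x \<otimes> \<^bold>\<not> y"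
  by (simp add: irl_imp_def)

lemma mult_neg_self_le: "x \<in> carrier A \<Longrightarrow> x \<otimes> \<^bold>\<not> x \<preceq> \<f>"
  by (simp add: mult_le_f_iff)

lemma zz_eq_imp: "\<z> = \<f> \<^bold>\<rightarrow> \<one>"
  by (simp add: irl_imp_def)

lemma bottom_mult:
  assumes "\<And>y. y \<in> carrier A \<Longrightarrow> b \<preceq> y" "b \<in> carrier A" "x \<in> carrier A"
  shows "b \<otimes> x = b"
proof (rule le_antisym)
  show "b \<otimes> x \<preceq> b"
    using assms by (simp add: mult_le_iff)
qed (use assms in simp_all)

end

context square_increasing_irl
begin

lemma mult_self_le_one: "\<lbrakk>p \<preceq> \<one>; p \<in> carrier A\<rbrakk> \<Longrightarrow> p \<otimes> p = p"
  using mult_mono[of p \<one> p p] square_increasing by (auto intro: le_antisym)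

text \<open>Multiply \<open>u \<preceq> u \<otimes> u\<close> by the inverse
  \<open>v\<close>.\<close>

lemma invertible_one_le:
  assumes "u \<otimes> v = \<one>" "u \<in> carrier A" "v \<in> carrier A"
  shows "\<one> \<preceq> u"
proof -
  have "u \<otimes> v \<preceq> (u \<otimes> u) \<otimes> v"
    using assms by (intro mult_mono_left) (simp_all add: square_increasing)
  moreover have "(u \<otimes> u) \<otimes> v = u"
    using assms by (simp add: m_assoc)
  ultimately show ?thesis
    using assms by simp
qed

lemma wedge_neg_le_f:
  assumes "x \<in> carrier A"
  shows "x \<^bold>\<and> \<^bold>\<not> x \<preceq> \<f>"
proof -
  have "x \<^bold>\<and> \<^bold>\<not> x \<preceq> (x \<^bold>\<and> \<^bold>\<not> x) \<otimes> (x \<^bold>\<and> \<^bold>\<not> x)"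
    using assms by (simp add: square_increasing)
  moreover have "(x \<^bold>\<and> \<^bold>\<not> x) \<otimes> (x \<^bold>\<and> \<^bold>\<not> x) \<preceq> x \<otimes> \<^bold>\<not> x"
    using assms by (simp add: mult_mono)
  ultimately have "x \<^bold>\<and> \<^bold>\<not> x \<preceq> x \<otimes> \<^bold>\<not> x"
    by (rule le_trans) (use assms in simp_all)
  then show ?thesis
    by (rule le_trans) (use assms mult_neg_self_le in simp_all)
qed

lemma one_le_vee_neg:
  assumes "x \<in> carrier A"
  shows "\<one> \<preceq> x \<^bold>\<or> \<^bold>\<not> x"
  using wedge_neg_le_f[OF assms] assms by (simp add: le_f_iff neg_wedge vee_comm)

lemma wedge_le_mult:
  assumes "x \<in> carrier A" "y \<in> carrier A"
  shows "x \<^bold>\<and> y \<preceq> x \<otimes> y"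
proof (rule le_trans)
  show "x \<^bold>\<and> y \<preceq> (x \<^bold>\<and> y) \<otimes> (x \<^bold>\<and> y)"
    using assms by (simp add: square_increasing)
  show "(x \<^bold>\<and> y) \<otimes> (x \<^bold>\<and> y) \<preceq> x \<otimes> y"
    using assms by (simp add: mult_mono)
qed (use assms in simp_all)

lemma f_le_tt: "\<f> \<preceq> \<t>"
  by (simp add: square_increasing)

lemma zz_le_one: "\<z> \<preceq> \<one>"
  using neg_le_neg_iff[of \<f> \<t>] f_le_tt by simp

lemma zz_idem [simp]: "\<z> \<otimes> \<z> = \<z>"
  by (simp add: mult_self_le_one zz_le_one)

text \<open>From \<open>f \<otimes> z \<preceq> \<one>\<close>, where
  \<open>z = f \<rightarrow> \<one>\<close>, squaring and multiplying by \<open>f\<close> gives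
  \<open>f \<otimes> f \<otimes> f \<otimes> z \<preceq> f\<close>, because \<open>z\<close> is
  idempotent. This is the inequality between the third and the second power of \<open>f\<close>,
  since \<open>z\<close> is the negation of the latter.\<close>

lemma tt_mult_ff: "\<t> \<otimes> \<f> = \<t>"
proof (rule le_antisym)
  have fz: "\<f> \<otimes> \<z> \<preceq> \<one>"
    unfolding zz_eq_imp by (simp add: mult_imp_le)
  have "(\<f> \<otimes> \<z>) \<otimes> (\<f> \<otimes> \<z>) \<preceq> \<one> \<otimes> \<one>"
    using fz by (intro mult_mono) simp_all
  then have "\<f> \<otimes> ((\<f> \<otimes> \<z>) \<otimes> (\<f> \<otimes> \<z>)) \<preceq> \<f> \<otimes> \<one>"
    by (intro mult_mono) simp_all
  moreover have "\<f> \<otimes> ((\<f> \<otimes> \<z>) \<otimes> (\<f> \<otimes> \<z>)) = (\<f> \<otimes> \<f> \<otimes> \<f>) \<otimes> (\<z> \<otimes> \<z>)"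
    by (simp only: m_ac ff_closed zz_closed m_closed)
  ultimately show "\<t> \<otimes> \<f> \<preceq> \<t>"
    using le_iff_mult[of "\<t> \<otimes> \<f>" \<t>] by simp
  show "\<t> \<preceq> \<t> \<otimes> \<f>"
    using mult_mono_left[OF f_le_tt, of \<f>] by simp
qed simp_all

lemma tt_mult_tt [simp]: "\<t> \<otimes> \<t> = \<t>"
  using tt_mult_ff by (simp add: m_assoc[symmetric])

text \<open>Here \<open>f \<otimes> f \<preceq> f\<close>. Squaring the negation of \<open>x\<close>
  bounds \<open>x \<otimes> x \<otimes> \<not>x\<close> by the square of
  \<open>x \<otimes> \<not>x\<close>, hence by \<open>f \<otimes> f\<close> and by \<open>f\<close>;
  this says \<open>x \<otimes> x \<preceq> x\<close>.\<close>

lemma f_le_one_idem: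
  assumes f: "\<f> \<preceq> \<one>" and x: "x \<in> carrier A"
  shows "x \<otimes> x = x"
proof (rule le_antisym)
  have ff: "\<t> \<preceq> \<f>"
    using f by (simp add: mult_le_f_iff)
  have "\<^bold>\<not> x \<preceq> \<^bold>\<not> x \<otimes> \<^bold>\<not> x"
    using x by (simp add: square_increasing)
  then have "(x \<otimes> x) \<otimes> \<^bold>\<not> x \<preceq> (x \<otimes> x) \<otimes> (\<^bold>\<not> x \<otimes> \<^bold>\<not> x)"
    using x by (simp add: mult_mono)
  also have "(x \<otimes> x) \<otimes> (\<^bold>\<not> x \<otimes> \<^bold>\<not> x) = (x \<otimes> \<^bold>\<not> x) \<otimes> (x \<otimes> \<^bold>\<not> x)"
    using x by (simp add: m_ac)
  finally have 1: "(x \<otimes> x) \<otimes> \<^bold>\<not> x \<preceq> (x \<otimes> \<^bold>\<not> x) \<otimes> (x \<otimes> \<^bold>\<not> x)" .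
  have "(x \<otimes> \<^bold>\<not> x) \<otimes> (x \<otimes> \<^bold>\<not> x) \<preceq> \<t>"
    using x by (simp add: mult_mono mult_neg_self_le)
  then have "(x \<otimes> \<^bold>\<not> x) \<otimes> (x \<otimes> \<^bold>\<not> x) \<preceq> \<f>"
    by (rule le_trans[OF _ ff]) (use x in simp_all)
  with 1 have "(x \<otimes> x) \<otimes> \<^bold>\<not> x \<preceq> \<f>"
    by (rule le_trans) (use x in simp_all)
  then show "x \<otimes> x \<preceq> x"
    using x by (simp add: le_iff_mult[symmetric])
qed (use x in \<open>simp_all add: square_increasing\<close>)

text \<open>Products stay inside because both bounds are idempotent; the hypothesis puts
  \<open>\<one>\<close> below the upper bound.\<close>

lemma subuniverse_interval:
  assumes e: "\<one> \<preceq> \<t>"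
  shows "subuniverse A {x \<in> carrier A. \<z> \<preceq> x \<and> x \<preceq> \<t>}"
proof -
  have closed: "\<z> \<preceq> x \<otimes> y \<and> x \<otimes> y \<preceq> \<t> \<and> \<z> \<preceq> x \<^bold>\<and> y \<and> x \<^bold>\<and> y \<preceq> \<t> \<and> \<z> \<preceq> x \<^bold>\<or> y \<and> x \<^bold>\<or> y \<preceq> \<t>
      \<and> \<z> \<preceq> \<^bold>\<not> x \<and> \<^bold>\<not> x \<preceq> \<t>"
    if "x \<in> carrier A" "\<z> \<preceq> x" "x \<preceq> \<t>" "y \<in> carrier A" "\<z> \<preceq> y" "y \<preceq> \<t>" for x y
  proof (intro conjI)
    show "\<z> \<preceq> x \<otimes> y"
      using mult_mono[of \<z> x \<z> y] that by simp
    show "x \<otimes> y \<preceq> \<t>"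
      using mult_mono[of x \<t> y \<t>] that by simp
    show "x \<^bold>\<and> y \<preceq> \<t>"
      using that le_trans[of "x \<^bold>\<and> y" x \<t>] by simp
    show "\<z> \<preceq> x \<^bold>\<or> y"
      using that le_trans[of \<z> x "x \<^bold>\<or> y"] by simp
    show "\<z> \<preceq> \<^bold>\<not> x" "\<^bold>\<not> x \<preceq> \<t>"
      using that neg_le_neg_iff[of x \<t>] neg_le_neg_iff[of \<z> x] by simp_all
  qed (use that in \<open>simp_all add: le_wedge_iff vee_le_iff\<close>)
  then show ?thesis
    unfolding subuniverse_def using e zz_le_one by auto
qed

end

context de_morgan_monoid
begin

lemma vee_wedge_distrib: "\<lbrakk>x \<in> carrier A; y \<in> carrier A; z \<in> carrier A\<rbrakk>
    \<Longrightarrow> (y \<^bold>\<or> z) \<^bold>\<and> x = (y \<^bold>\<and> x) \<^bold>\<or> (z \<^bold>\<and> x)"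
  using wedge_vee_distrib[of x y z] by (simp add: wedge_comm)

lemma vee_wedge_distrib2:
  assumes "x \<in> carrier A" "y \<in> carrier A" "z \<in> carrier A"
  shows "x \<^bold>\<or> (y \<^bold>\<and> z) = (x \<^bold>\<or> y) \<^bold>\<and> (x \<^bold>\<or> z)"
  using assms wedge_vee_distrib[of "\<^bold>\<not> x" "\<^bold>\<not> y" "\<^bold>\<not> z"]
    neg_inject[of "x \<^bold>\<or> (y \<^bold>\<and> z)" "(x \<^bold>\<or> y) \<^bold>\<and> (x \<^bold>\<or> z)"]
  by (simp add: neg_vee neg_wedge)

end

section \<open>An equational basis for De Morgan monoids\<close>

definition val3 :: "'a \<Rightarrow> 'a \<Rightarrow> 'a \<Rightarrow> nat \<Rightarrow> 'a"
  where "val3 x y z n = (if n = 0 then x else if n = 1 then y else z)"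

lemma val3_simps [simp]: "val3 x y z 0 = x" "val3 x y z 1 = y" "val3 x y z (Suc 0) = y" "val3 x y z 2 = z"
  by (simp_all add: val3_def)

lemma satisfies_eq_val3:
  "\<lbrakk>satisfies_eq A (s, t); x \<in> carrier A; y \<in> carrier A; z \<in> carrier A\<rbrakk>
    \<Longrightarrow> eval_term A (val3 x y z) s = eval_term A (val3 x y z) t"
  unfolding satisfies_eq_def by (simp add: image_subset_iff val3_def)

lemma satisfies_eqI:
  "(\<And>v. (\<And>n. v n \<in> carrier A) \<Longrightarrow> eval_term A v s = eval_term A v t) \<Longrightarrow> satisfies_eq A (s, t)"
  unfolding satisfies_eq_def by auto

text \<open>The last three identities replace the residuation law; the very last one is
  \<open>x \<cdot> (x \<rightarrow> \<not>y) \<le> \<not>y\<close>.\<close>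

definition dmm_identities :: "(irl_term \<times> irl_term) set"
  where "dmm_identities = (let x = Var 0; y = Var 1; z = Var 2 in
   {(Mult (Mult x y) z, Mult x (Mult y z)), (Mult x y, Mult y x), (Mult One x, x),
    (Wedge x y, Wedge y x), (Vee x y, Vee y x),
    (Wedge (Wedge x y) z, Wedge x (Wedge y z)), (Vee (Vee x y) z, Vee x (Vee y z)),
    (Wedge x (Vee x y), x), (Vee x (Wedge x y), x),
    (Wedge x (Vee y z), Vee (Wedge x y) (Wedge x z)),
    (Neg (Neg x), x), (Wedge x (Mult x x), x),
    (Neg (Wedge x y), Vee (Neg x) (Neg y)),
    (Mult x (Vee y z), Vee (Mult x y) (Mult x z)),
    (Wedge (Mult x (Neg (Mult x y))) (Neg y), Mult x (Neg (Mult x y)))})"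

lemma (in de_morgan_monoid) satisfies_dmm_identities:
  assumes "\<epsilon> \<in> dmm_identities"
  shows "satisfies_eq A \<epsilon>"
proof -
  have res: "a \<otimes> \<^bold>\<not> (a \<otimes> b) \<preceq> \<^bold>\<not> b" if "a \<in> carrier A" "b \<in> carrier A" for a b
    using that mult_imp_le[of a "\<^bold>\<not> b"] by (simp add: irl_imp_def)
  show ?thesis
    using assms unfolding dmm_identities_def Let_def
    by (elim insertE emptyE; simp only: prod.inject; intro satisfies_eqI)
      (simp add: m_assoc wedge_assoc vee_assoc wedge_absorb vee_absorb
        wedge_vee_distrib neg_wedge mult_vee_distrib square_increasing[unfolded irl_le_def]
        res[unfolded irl_le_def]; fail | simp add: m_comm wedge_comm vee_comm)+
qed

lemma de_morgan_monoid_if_identities: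
  fixes B (structure)
  assumes B: "sig_algebra B" and sat: "\<And>\<epsilon>. \<epsilon> \<in> dmm_identities \<Longrightarrow> satisfies_eq B \<epsilon>"
  shows "de_morgan_monoid B"
proof -
  let ?X = "Var 0" and ?Y = "Var 1" and ?Z = "Var 2"
  note [simp] = sig_algebraD[OF B]
  have eq: "eval_term B (val3 x y z) s = eval_term B (val3 x y z) t"
    if "(s, t) \<in> dmm_identities" "x \<in> carrier B" "y \<in> carrier B" "z \<in> carrier B" for s t x y z
    using satisfies_eq_val3[OF sat[OF that(1)] that(2-4)] .
  note ids = eq[unfolded dmm_identities_def Let_def]
  have assoc: "x \<otimes> y \<otimes> z = x \<otimes> (y \<otimes> z)"
    and lattice3: "(x \<^bold>\<and> y) \<^bold>\<and> z = x \<^bold>\<and> (y \<^bold>\<and> z)" "(x \<^bold>\<or> y) \<^bold>\<or> z = x \<^bold>\<or> (y \<^bold>\<or> z)"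
      "x \<^bold>\<and> (y \<^bold>\<or> z) = (x \<^bold>\<and> y) \<^bold>\<or> (x \<^bold>\<and> z)"
    and dist: "x \<otimes> (y \<^bold>\<or> z) = (x \<otimes> y) \<^bold>\<or> (x \<otimes> z)"
    if "x \<in> carrier B" "y \<in> carrier B" "z \<in> carrier B" for x y z
    using ids[OF _ that, of "Mult (Mult ?X ?Y) ?Z" "Mult ?X (Mult ?Y ?Z)"]
      ids[OF _ that, of "Wedge (Wedge ?X ?Y) ?Z" "Wedge ?X (Wedge ?Y ?Z)"]
      ids[OF _ that, of "Vee (Vee ?X ?Y) ?Z" "Vee ?X (Vee ?Y ?Z)"]
      ids[OF _ that, of "Wedge ?X (Vee ?Y ?Z)" "Vee (Wedge ?X ?Y) (Wedge ?X ?Z)"]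
      ids[OF _ that, of "Mult ?X (Vee ?Y ?Z)" "Vee (Mult ?X ?Y) (Mult ?X ?Z)"]
    by simp_all
  have comm: "x \<otimes> y = y \<otimes> x"
    and lattice: "x \<^bold>\<and> y = y \<^bold>\<and> x" "x \<^bold>\<or> y = y \<^bold>\<or> x"
      "x \<^bold>\<and> (x \<^bold>\<or> y) = x" "x \<^bold>\<or> (x \<^bold>\<and> y) = x"
    and dm: "\<^bold>\<not> (x \<^bold>\<and> y) = \<^bold>\<not> x \<^bold>\<or> \<^bold>\<not> y"
    and res: "x \<otimes> (\<^bold>\<not> (x \<otimes> y)) \<^bold>\<and> \<^bold>\<not> y = x \<otimes> (\<^bold>\<not> (x \<otimes> y))"
    if "x \<in> carrier B" "y \<in> carrier B" for x y
    using ids[OF _ that that(1), of "Mult ?X ?Y" "Mult ?Y ?X"]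
      ids[OF _ that that(1), of "Wedge ?X ?Y" "Wedge ?Y ?X"]
      ids[OF _ that that(1), of "Vee ?X ?Y" "Vee ?Y ?X"]
      ids[OF _ that that(1), of "Wedge ?X (Vee ?X ?Y)" ?X]
      ids[OF _ that that(1), of "Vee ?X (Wedge ?X ?Y)" ?X]
      ids[OF _ that that(1), of "Neg (Wedge ?X ?Y)" "Vee (Neg ?X) (Neg ?Y)"]
      ids[OF _ that that(1), of "Wedge (Mult ?X (Neg (Mult ?X ?Y))) (Neg ?Y)"
        "Mult ?X (Neg (Mult ?X ?Y))"]
    by (simp_all only: insert_iff simp_thms prod.inject eval_term.simps val3_simps)
  have one: "\<one> \<otimes> x = x" and neg: "\<^bold>\<not> (\<^bold>\<not> x) = x" and sq: "x \<^bold>\<and> (x \<otimes> x) = x"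
    if "x \<in> carrier B" for x
    using ids[OF _ that that that, of "Mult One ?X" ?X]
      ids[OF _ that that that, of "Neg (Neg ?X)" ?X]
      ids[OF _ that that that, of "Wedge ?X (Mult ?X ?X)" ?X]
    by simp_all
  have le_vee: "x \<preceq> y \<longleftrightarrow> x \<^bold>\<or> y = y" if "x \<in> carrier B" "y \<in> carrier B" for x y
    unfolding irl_le_def using lattice that by metis
  have trans: "x \<preceq> z" if "x \<preceq> y" "y \<preceq> z" "x \<in> carrier B" "y \<in> carrier B" "z \<in> carrier B" for x y z
    using that lattice3(1) unfolding irl_le_def by metis
  \<comment> \<open>From \<open>x \<otimes> y \<preceq> z\<close> the De Morgan law gives
    \<open>\<not>z \<preceq> \<not>(x \<otimes> y)\<close>. Multiplication by \<open>y\<close> is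
    isotone by distributivity over joins, and the last identity bounds the result by
    \<open>\<not>x\<close>. The converse of the residuation law is the same implication applied to
    negations.\<close>
  have half: "\<^bold>\<not> z \<otimes> y \<preceq> \<^bold>\<not> x"
    if le: "x \<otimes> y \<preceq> z" and car: "x \<in> carrier B" "y \<in> carrier B" "z \<in> carrier B" for x y z
  proof (rule trans)
    have "\<^bold>\<not> z \<^bold>\<or> \<^bold>\<not> (x \<otimes> y) = \<^bold>\<not> (x \<otimes> y)"
      using le car dm[of z "x \<otimes> y"] lattice(1)[of z "x \<otimes> y"] by (simp add: irl_le_def)
    then show "\<^bold>\<not> z \<otimes> y \<preceq> y \<otimes> \<^bold>\<not> (y \<otimes> x)"
      using car dist[of y "\<^bold>\<not> z" "\<^bold>\<not> (x \<otimes> y)"] by (simp add: le_vee comm)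
    show "y \<otimes> \<^bold>\<not> (y \<otimes> x) \<preceq> \<^bold>\<not> x"
      using res[OF car(2,1)] by (simp add: irl_le_def)
  qed (use car in simp_all)
  have residuation: "x \<otimes> y \<preceq> z \<longleftrightarrow> \<^bold>\<not> z \<otimes> y \<preceq> \<^bold>\<not> x"
    if "x \<in> carrier B" "y \<in> carrier B" "z \<in> carrier B" for x y z
    using half[of x y z] half[of "\<^bold>\<not> z" y "\<^bold>\<not> x"] that neg by auto
  have sq': "x \<preceq> x \<otimes> x" if "x \<in> carrier B" for x
    using sq that by (simp add: irl_le_def)
  have one': "x \<otimes> \<one> = x" if "x \<in> carrier B" for x
    using one that comm by simp
  show ?thesis
    by unfold_locales
      (assumption | rule sig_algebraD[OF B] assoc comm one one' lattice lattice3 neg sq' residuation)+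
qed

lemma de_morgan_monoid_th_le:
  assumes "de_morgan_monoid A" "sig_algebra B" "th_le A B"
  shows "de_morgan_monoid B"
  using assms de_morgan_monoid.satisfies_dmm_identities[of A]
  by (intro de_morgan_monoid_if_identities) (auto simp: th_le_def)

lemma variety_DMM: "variety (DMM :: 'u irl_alg set)"
proof -
  have "de_morgan_monoid A \<longleftrightarrow> sig_algebra A \<and> (\<forall>\<epsilon> \<in> dmm_identities. satisfies_eq A \<epsilon>)"
    for A :: "'u irl_alg"
  proof
    assume "de_morgan_monoid A"
    then interpret de_morgan_monoid A .
    show "sig_algebra A \<and> (\<forall>\<epsilon> \<in> dmm_identities. satisfies_eq A \<epsilon>)"
      using sig_algebra satisfies_dmm_identities by simp
  qed (use de_morgan_monoid_if_identities in blast)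
  then show ?thesis
    unfolding variety_def DMM_def by blast
qed

section \<open>Deductive filters and prime quotients\<close>

lemma irl_hom_derived:
  assumes "h \<in> irl_hom A B" "sig_algebra A"
  shows "h (irl_f A) = irl_f B" "h (irl_zero A) = irl_zero B"
    and "\<lbrakk>x \<in> carrier A; y \<in> carrier A\<rbrakk> \<Longrightarrow> h (x \<^bold>\<rightarrow>\<^bsub>A\<^esub> y) = h x \<^bold>\<rightarrow>\<^bsub>B\<^esub> h y"
    and "\<lbrakk>x \<in> carrier A; y \<in> carrier A; x \<preceq>\<^bsub>A\<^esub> y\<rbrakk> \<Longrightarrow> h x \<preceq>\<^bsub>B\<^esub> h y"
proof -
  note [simp] = irl_homD[OF assms(1)] sig_algebraD[OF assms(2)]
  show "h (irl_f A) = irl_f B" "h (irl_zero A) = irl_zero B"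
    by (simp_all add: irl_f_def irl_zero_def)
  show "h (x \<^bold>\<rightarrow>\<^bsub>A\<^esub> y) = h x \<^bold>\<rightarrow>\<^bsub>B\<^esub> h y" if "x \<in> carrier A" "y \<in> carrier A"
    using that by (simp add: irl_imp_def)
  show "h x \<preceq>\<^bsub>B\<^esub> h y" if "x \<in> carrier A" "y \<in> carrier A" "x \<preceq>\<^bsub>A\<^esub> y"
    using that irl_homD(4)[OF assms(1), of x y] by (simp add: irl_le_def)
qed

text \<open>Stands in for finite subdirect irreducibility, which implies it
  (\<open>fsi_prime\<close>). It is a condition on elements, is inherited by subalgebras, and is
  what maximal filters produce.\<close>

locale prime_dmm = de_morgan_monoid +
  assumes one_prime: "\<lbrakk>x \<in> carrier A; y \<in> carrier A; \<one> \<preceq> x \<^bold>\<or> y\<rbrakk> \<Longrightarrow> \<one> \<preceq> x \<or> \<one> \<preceq> y"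

definition deductive_filter :: "('a, 'm) irl_alg_scheme \<Rightarrow> 'a set \<Rightarrow> bool"
  where "deductive_filter A F \<longleftrightarrow> F \<subseteq> carrier A \<and> \<one>\<^bsub>A\<^esub> \<in> F \<and>
    (\<forall>x\<in>F. \<forall>y\<in>F. x \<^bold>\<and>\<^bsub>A\<^esub> y \<in> F) \<and> (\<forall>x\<in>F. \<forall>y\<in>carrier A. x \<preceq>\<^bsub>A\<^esub> y \<longrightarrow> y \<in> F)"

text \<open>As \<open>g \<otimes> x \<preceq> y\<close> means
  \<open>g \<preceq> x \<rightarrow> y\<close>, this is the usual relation that both residuals lie
  in \<open>F\<close>; a common \<open>g\<close> is available because filters are closed under
  meets.\<close>

definition filter_congruence :: "('a, 'm) irl_alg_scheme \<Rightarrow> 'a set \<Rightarrow> ('a \<times> 'a) set"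
  where "filter_congruence A F = {(x, y). x \<in> carrier A \<and> y \<in> carrier A \<and>
    (\<exists>g\<in>F. g \<otimes>\<^bsub>A\<^esub> x \<preceq>\<^bsub>A\<^esub> y \<and> g \<otimes>\<^bsub>A\<^esub> y \<preceq>\<^bsub>A\<^esub> x)}"

lemma deductive_filterD:
  assumes "deductive_filter A F"
  shows "x \<in> F \<Longrightarrow> x \<in> carrier A" "\<one>\<^bsub>A\<^esub> \<in> F" "\<lbrakk>x \<in> F; y \<in> F\<rbrakk> \<Longrightarrow> x \<^bold>\<and>\<^bsub>A\<^esub> y \<in> F"
    "\<lbrakk>x \<in> F; x \<preceq>\<^bsub>A\<^esub> y; y \<in> carrier A\<rbrakk> \<Longrightarrow> y \<in> F"
  using assms by (auto simp: deductive_filter_def)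

context de_morgan_monoid
begin

lemma deductive_filter_principal:
  assumes "p \<preceq> \<one>" "p \<in> carrier A"
  shows "deductive_filter A {x \<in> carrier A. p \<preceq> x}"
  using assms le_trans[of p] by (auto simp: deductive_filter_def le_wedge_iff)

lemma deductive_filter_mult:
  assumes F: "deductive_filter A F" and "x \<in> F" "y \<in> F"
  shows "x \<otimes> y \<in> F"
  using deductive_filterD[OF F] assms wedge_le_mult[of x y] by (meson m_closed)

text \<open>Two witnesses are merged into their meet (\<open>le\<close>). The merged
  \<open>g\<close> serves for meets and joins, and \<open>g \<otimes> g\<close>, again in the
  filter, for transitivity and products; negation is the residuation law.\<close>

lemma congruence_filter_congruence:
  assumes F: "deductive_filter A F"
  shows "congruence A (filter_congruence A F)"
proof -
  let ?T = "filter_congruence A F"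
  note car = deductive_filterD(1)[OF F]
  have le: "\<exists>g\<in>F. g \<otimes> x \<preceq> y \<and> g \<otimes> y \<preceq> x \<and> g \<otimes> u \<preceq> v \<and> g \<otimes> v \<preceq> u"
    if xy: "(x, y) \<in> ?T" and uv: "(u, v) \<in> ?T" for x y u v
  proof -
    obtain g h where gh: "g \<in> F" "h \<in> F" "g \<otimes> x \<preceq> y" "g \<otimes> y \<preceq> x" "h \<otimes> u \<preceq> v" "h \<otimes> v \<preceq> u"
      using xy uv by (auto simp: filter_congruence_def)
    have c: "x \<in> carrier A" "y \<in> carrier A" "u \<in> carrier A" "v \<in> carrier A" "g \<in> carrier A" "h \<in> carrier A"
      using xy uv gh car by (auto simp: filter_congruence_def)
    have "(g \<^bold>\<and> h) \<otimes> a \<preceq> b" if "g \<otimes> a \<preceq> b \<or> h \<otimes> a \<preceq> b" "a \<in> carrier A" "b \<in> carrier A" for a b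
      using that c le_trans[of "(g \<^bold>\<and> h) \<otimes> a" "g \<otimes> a" b] le_trans[of "(g \<^bold>\<and> h) \<otimes> a" "h \<otimes> a" b]
      by (auto simp: mult_mono_left)
    then show ?thesis
      using gh c deductive_filterD(3)[OF F] by (intro bexI[of _ "g \<^bold>\<and> h"]) auto
  qed
  have eq: "equiv (carrier A) ?T"
  proof (rule equivI)
    show "?T \<subseteq> carrier A \<times> carrier A"
      by (auto simp: filter_congruence_def)
    show "refl_on (carrier A) ?T"
      using deductive_filterD(2)[OF F]
      by (auto simp: refl_on_def filter_congruence_def intro!: bexI[of _ \<one>])
    show "sym ?T"
      by (auto simp: sym_def filter_congruence_def)
    show "trans ?T"
    proof (rule transI)
      fix x y z assume xy: "(x, y) \<in> ?T" "(y, z) \<in> ?T"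
      obtain g where g: "g \<in> F" "g \<otimes> x \<preceq> y" "g \<otimes> y \<preceq> x" "g \<otimes> y \<preceq> z" "g \<otimes> z \<preceq> y"
        using le[OF xy] by blast
      have c: "x \<in> carrier A" "y \<in> carrier A" "z \<in> carrier A" "g \<in> carrier A"
        using xy g car by (auto simp: filter_congruence_def)
      have "(g \<otimes> g) \<otimes> a \<preceq> b"
        if "g \<otimes> a \<preceq> y" "g \<otimes> y \<preceq> b" "a \<in> carrier A" "b \<in> carrier A" for a b
        using that c le_trans[of "g \<otimes> (g \<otimes> a)" "g \<otimes> y" b] mult_mono[of g g "g \<otimes> a" y]
        by (simp add: m_assoc)
      then show "(x, z) \<in> ?T"
        using g c deductive_filter_mult[OF F] unfolding filter_congruence_def by blast
    qed
  qed
  have ops: "(x \<otimes> u, y \<otimes> v) \<in> ?T \<and> (x \<^bold>\<and> u, y \<^bold>\<and> v) \<in> ?T \<and> (x \<^bold>\<or> u, y \<^bold>\<or> v) \<in> ?T"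
    if xy: "(x, y) \<in> ?T" and uv: "(u, v) \<in> ?T" for x y u v
  proof -
    obtain g where g: "g \<in> F" "g \<otimes> x \<preceq> y" "g \<otimes> y \<preceq> x" "g \<otimes> u \<preceq> v" "g \<otimes> v \<preceq> u"
      using le[OF xy uv] by blast
    have c: "x \<in> carrier A" "y \<in> carrier A" "u \<in> carrier A" "v \<in> carrier A" "g \<in> carrier A"
      using xy uv g car by (auto simp: filter_congruence_def)
    have m: "(g \<otimes> g) \<otimes> (a \<otimes> a') \<preceq> b \<otimes> b'" "g \<otimes> (a \<^bold>\<and> a') \<preceq> b \<^bold>\<and> b'" "g \<otimes> (a \<^bold>\<or> a') \<preceq> b \<^bold>\<or> b'"
      if gg: "g \<otimes> a \<preceq> b" "g \<otimes> a' \<preceq> b'" and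
        cc: "a \<in> carrier A" "a' \<in> carrier A" "b \<in> carrier A" "b' \<in> carrier A" for a a' b b'
    proof -
      show "(g \<otimes> g) \<otimes> (a \<otimes> a') \<preceq> b \<otimes> b'"
        using mult_mono[OF gg] cc c(5) by (simp add: m_ac)
      have "g \<otimes> (a \<^bold>\<and> a') \<preceq> g \<otimes> a" "g \<otimes> (a \<^bold>\<and> a') \<preceq> g \<otimes> a'"
        using cc c(5) by (simp_all add: mult_mono)
      then show "g \<otimes> (a \<^bold>\<and> a') \<preceq> b \<^bold>\<and> b'"
        using gg cc c(5) le_trans[of "g \<otimes> (a \<^bold>\<and> a')"] by (simp add: le_wedge_iff)
      have "g \<otimes> a \<preceq> b \<^bold>\<or> b'" "g \<otimes> a' \<preceq> b \<^bold>\<or> b'"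
        using gg cc c(5) le_trans[of "g \<otimes> a" b] le_trans[of "g \<otimes> a'" b'] by simp_all
      then show "g \<otimes> (a \<^bold>\<or> a') \<preceq> b \<^bold>\<or> b'"
        using cc c(5) by (simp add: mult_vee_distrib vee_le_iff)
    qed
    show ?thesis
      unfolding filter_congruence_def
      using c g m[of x y u v] m[of y x v u] deductive_filter_mult[OF F] by auto
  qed
  have neg: "(\<^bold>\<not> x, \<^bold>\<not> y) \<in> ?T" if xy: "(x, y) \<in> ?T" for x y
  proof -
    obtain g where g: "g \<in> F" "g \<otimes> x \<preceq> y" "g \<otimes> y \<preceq> x"
      using xy by (auto simp: filter_congruence_def)
    have c: "x \<in> carrier A" "y \<in> carrier A" "g \<in> carrier A"
      using xy g car by (auto simp: filter_congruence_def)
    have "g \<otimes> \<^bold>\<not> y \<preceq> \<^bold>\<not> x" "g \<otimes> \<^bold>\<not> x \<preceq> \<^bold>\<not> y"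
      using g c residuation[of x g y] residuation[of y g x] by (simp_all add: m_comm)
    then show ?thesis
      unfolding filter_congruence_def using g c by auto
  qed
  show ?thesis
    unfolding congruence_def using eq ops neg by (auto simp: split_beta)
qed

text \<open>Recovers the filter from its congruence: in the quotient, lying above
  \<open>\<one>\<close> means coming from \<open>F\<close>.\<close>

lemma filter_congruence_one_iff:
  assumes F: "deductive_filter A F" and x: "x \<in> carrier A"
  shows "(\<one> \<^bold>\<and> x, \<one>) \<in> filter_congruence A F \<longleftrightarrow> x \<in> F"
proof
  assume "(\<one> \<^bold>\<and> x, \<one>) \<in> filter_congruence A F"
  then obtain g where g: "g \<in> F" "g \<otimes> \<one> \<preceq> \<one> \<^bold>\<and> x"
    by (auto simp: filter_congruence_def)
  then show "x \<in> F"
    using deductive_filterD(4)[OF F g(1) _ x] deductive_filterD(1)[OF F g(1)] x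
    by (simp add: le_wedge_iff)
next
  assume "x \<in> F"
  then have "\<one> \<^bold>\<and> x \<in> F"
    using deductive_filterD[OF F] by blast
  moreover have "(\<one> \<^bold>\<and> x) \<otimes> (\<one> \<^bold>\<and> x) \<preceq> \<one>"
    using x mult_mono[of "\<one> \<^bold>\<and> x" \<one> "\<one> \<^bold>\<and> x" \<one>] by simp
  ultimately show "(\<one> \<^bold>\<and> x, \<one>) \<in> filter_congruence A F"
    using x unfolding filter_congruence_def by auto
qed

text \<open>Zorn's lemma. The last property is maximality spelled out: the filter generated by
  \<open>F\<close> and \<open>z\<close> must contain \<open>x\<close>.\<close>

lemma maximal_deductive_filter:
  assumes F0: "deductive_filter A F0" and x: "x \<in> carrier A" "x \<notin> F0"
  obtains F where "deductive_filter A F" "F0 \<subseteq> F" "x \<notin> F"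
    "\<And>z. \<lbrakk>z \<in> carrier A; z \<notin> F\<rbrakk> \<Longrightarrow> \<exists>g\<in>F. g \<otimes> (z \<^bold>\<and> \<one>) \<preceq> x"
proof -
  let ?\<A> = "{F. deductive_filter A F \<and> F0 \<subseteq> F \<and> x \<notin> F}"
  have chain: "\<Union>\<C> \<in> ?\<A>" if C: "\<C> \<noteq> {}" "subset.chain ?\<A> \<C>" for \<C>
  proof -
    have mem: "\<And>F. F \<in> \<C> \<Longrightarrow> deductive_filter A F \<and> F0 \<subseteq> F \<and> x \<notin> F"
      using C(2) by (auto simp: subset_chain_def)
    have wedge: "y \<^bold>\<and> z \<in> \<Union>\<C>" if yz: "y \<in> \<Union>\<C>" "z \<in> \<Union>\<C>" for y z
    proof -
      obtain F G where FG: "F \<in> \<C>" "G \<in> \<C>" "y \<in> F" "z \<in> G"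
        using yz by blast
      then have "F \<subseteq> G \<or> G \<subseteq> F"
        using C(2) by (auto simp: subset_chain_def)
      then show ?thesis
        using FG mem deductive_filterD(3) by (metis Union_iff subset_iff)
    qed
    have sub: "F \<subseteq> carrier A" and one: "\<one> \<in> F" and up: "\<forall>x\<in>F. \<forall>y\<in>carrier A. x \<preceq> y \<longrightarrow> y \<in> F"
      if "F \<in> \<C>" for F
      using mem[OF that] by (simp_all add: deductive_filter_def)
    have "\<one> \<in> \<Union>\<C>"
      using one C(1) by blast
    moreover have "\<Union>\<C> \<subseteq> carrier A"
      using sub by (rule Union_least)
    ultimately have "deductive_filter A (\<Union>\<C>)"
      unfolding deductive_filter_def using wedge up by (meson UnionE UnionI)
    then show ?thesis
      using mem C(1) by blast
  qed
  obtain F where F: "F \<in> ?\<A>" and max: "\<And>G. G \<in> ?\<A> \<Longrightarrow> F \<subseteq> G \<Longrightarrow> G = F"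
    using subset_Zorn_nonempty[of ?\<A>] chain assms by (metis (mono_tags, lifting) empty_iff mem_Collect_eq order_refl)
  have dF: "deductive_filter A F"
    using F by simp
  note car = deductive_filterD(1)[OF dF]
  have "\<exists>g\<in>F. g \<otimes> (z \<^bold>\<and> \<one>) \<preceq> x" if z: "z \<in> carrier A" "z \<notin> F" for z
  proof -
    \<comment> \<open>The filter generated by \<open>F\<close> and \<open>z\<close>. Replacing
      \<open>z\<close> by \<open>z \<and> \<one>\<close> keeps the elements of \<open>F\<close>
      inside, since then \<open>g \<otimes> (z \<and> \<one>) \<preceq> g\<close>.\<close>
    let ?G = "{y \<in> carrier A. \<exists>g\<in>F. g \<otimes> (z \<^bold>\<and> \<one>) \<preceq> y}"
    have "deductive_filter A ?G"
      unfolding deductive_filter_def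
    proof (intro conjI ballI impI)
      show "\<one> \<in> ?G"
        using z deductive_filterD(2)[OF dF] by (auto intro!: bexI[of _ \<one>])
      fix y assume y: "y \<in> ?G"
      then obtain g where g: "g \<in> F" "g \<otimes> (z \<^bold>\<and> \<one>) \<preceq> y" and y': "y \<in> carrier A"
        by blast
      {
        fix u assume "u \<in> ?G"
        then obtain h where h: "h \<in> F" "h \<otimes> (z \<^bold>\<and> \<one>) \<preceq> u" and u: "u \<in> carrier A"
          by blast
        have "(g \<^bold>\<and> h) \<otimes> (z \<^bold>\<and> \<one>) \<preceq> y" "(g \<^bold>\<and> h) \<otimes> (z \<^bold>\<and> \<one>) \<preceq> u"
          using le_trans[OF mult_mono_left[of "g \<^bold>\<and> h" g "z \<^bold>\<and> \<one>"] g(2)] y' u z car[OF g(1)] car[OF h(1)]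
            le_trans[OF mult_mono_left[of "g \<^bold>\<and> h" h "z \<^bold>\<and> \<one>"] h(2)]
          by simp_all
        then show "y \<^bold>\<and> u \<in> ?G"
          using y' u z g h car deductive_filterD(3)[OF dF] by (auto simp: le_wedge_iff)
      }
      {
        fix u assume "u \<in> carrier A" "y \<preceq> u"
        then show "u \<in> ?G"
          using le_trans[OF g(2), of u] g y' z car by auto
      }
    qed auto
    moreover have "F \<subseteq> ?G"
    proof
      fix g assume "g \<in> F"
      then show "g \<in> ?G"
        using mult_mono[of g g "z \<^bold>\<and> \<one>" \<one>] z car[of g] by auto
    qed
    moreover have "z \<in> ?G"
      using z deductive_filterD(2)[OF dF] by (auto intro!: bexI[of _ \<one>])
    ultimately have "x \<in> ?G"
      using max[of ?G] F z by blast
    then show ?thesis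
      by blast
  qed
  then show thesis
    using that F by blast
qed

text \<open>Maximality forces everything not above \<open>\<one>\<close> to meet
  \<open>\<one>\<close> below \<open>r x\<close>. If \<open>u\<close> and \<open>v\<close> are both
  of this kind, then by distributivity so is their join, which therefore is not above
  \<open>\<one>\<close>: this is primeness.\<close>

lemma prime_quotient:
  assumes F0: "deductive_filter A F0" and x: "x \<in> carrier A" "x \<notin> F0"
  obtains B :: "'a irl_alg" and r
  where "r \<in> irl_hom A B" "r ` carrier A = carrier B" "th_le A B" "prime_dmm B"
    "\<And>y. y \<in> F0 \<Longrightarrow> \<one>\<^bsub>B\<^esub> \<preceq>\<^bsub>B\<^esub> r y" "\<not> \<one>\<^bsub>B\<^esub> \<preceq>\<^bsub>B\<^esub> r x"
    "\<And>y. \<lbrakk>y \<in> carrier B; \<not> \<one>\<^bsub>B\<^esub> \<preceq>\<^bsub>B\<^esub> y\<rbrakk> \<Longrightarrow> y \<^bold>\<and>\<^bsub>B\<^esub> \<one>\<^bsub>B\<^esub> \<preceq>\<^bsub>B\<^esub> r x"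
proof -
  obtain F where F: "deductive_filter A F" "F0 \<subseteq> F" "x \<notin> F"
    and max: "\<And>z. \<lbrakk>z \<in> carrier A; z \<notin> F\<rbrakk> \<Longrightarrow> \<exists>g\<in>F. g \<otimes> (z \<^bold>\<and> \<one>) \<preceq> x"
    using maximal_deductive_filter[OF assms] by blast
  note con = congruence_filter_congruence[OF F(1)]
  note car = deductive_filterD(1)[OF F(1)]
  define r where "r = congruence_rep (filter_congruence A F)"
  define B where "B = quotient_alg A (filter_congruence A F)"
  have hom: "r \<in> irl_hom A B" and surj: "r ` carrier A = carrier B" and th: "th_le A B"
    and sig: "sig_algebra B"
    and eq: "\<And>x y. \<lbrakk>x \<in> carrier A; y \<in> carrier A\<rbrakk> \<Longrightarrow> r x = r y \<longleftrightarrow> (x, y) \<in> filter_congruence A F"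
    unfolding r_def B_def
    using congruence_rep_hom[OF sig_algebra con] congruence_rep_surj[OF sig_algebra con]
      th_le_quotient[OF sig_algebra con] sig_algebra_quotient[OF sig_algebra con]
      congruence_rep_eq_iff[OF sig_algebra con] by auto
  interpret B: de_morgan_monoid B
    using de_morgan_monoid_th_le[OF _ sig th] by (simp add: de_morgan_monoid_axioms)
  note homD = irl_homD[OF hom]
  have one: "\<one>\<^bsub>B\<^esub> \<preceq>\<^bsub>B\<^esub> r y \<longleftrightarrow> y \<in> F" if "y \<in> carrier A" for y
    using that eq[of "\<one> \<^bold>\<and> y" \<one>] filter_congruence_one_iff[OF F(1) that] homD(1) homD(4)[of \<one> y]
    by (simp add: irl_le_def)
  have max': "r z \<^bold>\<and>\<^bsub>B\<^esub> \<one>\<^bsub>B\<^esub> \<preceq>\<^bsub>B\<^esub> r x" if z: "z \<in> carrier A" "z \<notin> F" for z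
  proof -
    obtain g where g: "g \<in> F" "g \<otimes> (z \<^bold>\<and> \<one>) \<preceq> x"
      using max z by blast
    have c: "r g \<in> carrier B" "r z \<in> carrier B" "r x \<in> carrier B" "g \<in> carrier A"
      using homD(2) car g z x by auto
    have "\<one>\<^bsub>B\<^esub> \<preceq>\<^bsub>B\<^esub> r g"
      using one g c by simp
    then have "r z \<^bold>\<and>\<^bsub>B\<^esub> \<one>\<^bsub>B\<^esub> \<preceq>\<^bsub>B\<^esub> r g \<otimes>\<^bsub>B\<^esub> (r z \<^bold>\<and>\<^bsub>B\<^esub> \<one>\<^bsub>B\<^esub>)"
      using B.mult_mono_left[of "\<one>\<^bsub>B\<^esub>" "r g" "r z \<^bold>\<and>\<^bsub>B\<^esub> \<one>\<^bsub>B\<^esub>"] c by simp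
    moreover have "r g \<otimes>\<^bsub>B\<^esub> (r z \<^bold>\<and>\<^bsub>B\<^esub> \<one>\<^bsub>B\<^esub>) \<preceq>\<^bsub>B\<^esub> r x"
      using irl_hom_derived(4)[OF hom sig_algebra _ _ g(2)] c z x by (simp add: homD)
    ultimately show ?thesis
      by (rule B.le_trans) (use c in simp_all)
  qed
  have "prime_dmm B"
  proof (intro prime_dmm.intro prime_dmm_axioms.intro)
    show "de_morgan_monoid B" ..
    fix u v assume uv: "u \<in> carrier B" "v \<in> carrier B" and le: "\<one>\<^bsub>B\<^esub> \<preceq>\<^bsub>B\<^esub> u \<^bold>\<or>\<^bsub>B\<^esub> v"
    obtain y z where yz: "u = r y" "v = r z" "y \<in> carrier A" "z \<in> carrier A"
      using uv surj by blast
    show "\<one>\<^bsub>B\<^esub> \<preceq>\<^bsub>B\<^esub> u \<or> \<one>\<^bsub>B\<^esub> \<preceq>\<^bsub>B\<^esub> v"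
    proof (rule ccontr)
      assume "\<not> ?thesis"
      then have "r y \<^bold>\<and>\<^bsub>B\<^esub> \<one>\<^bsub>B\<^esub> \<preceq>\<^bsub>B\<^esub> r x" "r z \<^bold>\<and>\<^bsub>B\<^esub> \<one>\<^bsub>B\<^esub> \<preceq>\<^bsub>B\<^esub> r x"
        using max' yz one by simp_all
      moreover have rx: "r x \<in> carrier B"
        using homD(2) x by simp
      ultimately have "(u \<^bold>\<or>\<^bsub>B\<^esub> v) \<^bold>\<and>\<^bsub>B\<^esub> \<one>\<^bsub>B\<^esub> \<preceq>\<^bsub>B\<^esub> r x"
        using uv yz by (simp add: B.vee_wedge_distrib B.vee_le_iff)
      then have "\<one>\<^bsub>B\<^esub> \<preceq>\<^bsub>B\<^esub> r x"
        using le uv rx B.wedge_comm[of "u \<^bold>\<or>\<^bsub>B\<^esub> v" "\<one>\<^bsub>B\<^esub>"] by (simp add: irl_le_def[of B "\<one>\<^bsub>B\<^esub>" "u \<^bold>\<or>\<^bsub>B\<^esub> v"])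
      then show False
        using one x F by simp
    qed
  qed
  moreover have "\<one>\<^bsub>B\<^esub> \<preceq>\<^bsub>B\<^esub> r y" if "y \<in> F0" for y
    using one car F(2) that by blast
  moreover have "\<not> \<one>\<^bsub>B\<^esub> \<preceq>\<^bsub>B\<^esub> r x"
    using one x F by blast
  moreover have "y \<^bold>\<and>\<^bsub>B\<^esub> \<one>\<^bsub>B\<^esub> \<preceq>\<^bsub>B\<^esub> r x" if y: "y \<in> carrier B" "\<not> \<one>\<^bsub>B\<^esub> \<preceq>\<^bsub>B\<^esub> y" for y
  proof -
    obtain z where "y = r z" "z \<in> carrier A"
      using y surj by blast
    then show ?thesis
      using y one[of z] max'[of z] by simp
  qed
  ultimately show thesis
    using that hom surj th by blast
qed

text \<open>One of the two inequalities between the sides fails, say \<open>s \<preceq> t\<close>;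
  then \<open>s \<rightarrow> t\<close> is outside the filter of all elements above
  \<open>\<one>\<close>, and the quotient keeps it from rising above \<open>\<one>\<close>.\<close>

lemma prime_quotient_not_satisfies:
  assumes "\<not> satisfies_eq A \<epsilon>"
  obtains B :: "'a irl_alg" where "prime_dmm B" "th_le A B" "\<not> satisfies_eq B \<epsilon>"
proof -
  obtain v where v: "range v \<subseteq> carrier A" and ne: "eval_term A v (fst \<epsilon>) \<noteq> eval_term A v (snd \<epsilon>)"
    using assms by (auto simp: satisfies_eq_def)
  note c = eval_term_closed[OF sig_algebra v]
  obtain s t where st: "{s, t} = {fst \<epsilon>, snd \<epsilon>}" and le: "\<not> eval_term A v s \<preceq> eval_term A v t"
    using le_antisym c ne by (metis insert_commute)
  let ?x = "eval_term A v s \<^bold>\<rightarrow> eval_term A v t"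
  have x: "?x \<in> carrier A" "?x \<notin> {x \<in> carrier A. \<one> \<preceq> x}"
    using le c one_le_imp_iff by simp_all
  have F: "deductive_filter A {x \<in> carrier A. \<one> \<preceq> x}"
    by (rule deductive_filter_principal) simp_all
  obtain B :: "'a irl_alg" and r where r: "r \<in> irl_hom A B" and th: "th_le A B" and B: "prime_dmm B"
    and n: "\<not> \<one>\<^bsub>B\<^esub> \<preceq>\<^bsub>B\<^esub> r ?x"
    using prime_quotient[OF F x] by metis
  interpret B: prime_dmm B
    by fact
  have "r ?x = eval_term B (r \<circ> v) s \<^bold>\<rightarrow>\<^bsub>B\<^esub> eval_term B (r \<circ> v) t"
    using irl_hom_derived(3)[OF r sig_algebra] c eval_term_hom[OF sig_algebra r v] by simp
  moreover have rv: "range (r \<circ> v) \<subseteq> carrier B"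
    using v irl_homD(2)[OF r] by auto
  ultimately have "eval_term B (r \<circ> v) s \<noteq> eval_term B (r \<circ> v) t"
    using n eval_term_closed[OF B.sig_algebra rv] B.one_le_imp_iff by auto
  then have "eval_term B (r \<circ> v) (fst \<epsilon>) \<noteq> eval_term B (r \<circ> v) (snd \<epsilon>)"
    using st by (metis doubleton_eq_iff)
  then show thesis
    using that[OF B th] rv unfolding satisfies_eq_def by blast
qed

end

section \<open>Algebras with \<open>f \<le> e\<close>\<close>

definition embeds :: "('b, 'n) irl_alg_scheme \<Rightarrow> ('a, 'm) irl_alg_scheme \<Rightarrow> bool"
  where "embeds B A \<longleftrightarrow> (\<exists>h \<in> irl_hom B A. inj_on h (carrier B))"

lemma embedsD:
  assumes "embeds B A" "sig_algebra B"
  shows "\<exists>S. subuniverse A S \<and> irl_isomorphic B (A\<lparr>carrier := S\<rparr>)" "th_le A B"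
  using assms irl_isomorphic_image th_le_inj unfolding embeds_def by blast+

lemma ball_bool: "(\<forall>x :: bool. P x) \<longleftrightarrow> P True \<and> P False"
  by (metis (full_types))

lemma ball_four: "(\<forall>x. P x) \<longleftrightarrow> P Zero4 \<and> P E4 \<and> P F4 \<and> P One4"
  by (metis four.exhaust)

lemma UNIV_four: "UNIV = {Zero4, E4, F4, One4}"
  using four.exhaust by auto

lemma carrier_S3: "carrier alg_S3 = {-1, 0, 1}"
  by (auto simp: sugihara_def)

lemma carrier_S5: "carrier alg_S5 = {-2, -1, 0, 1, 2}"
  by (auto simp: sugihara_def)

context irl
begin

lemma le_lattice:
  assumes "x \<preceq> y" "x \<in> carrier A" "y \<in> carrier A"
  shows "x \<^bold>\<and> y = x" "y \<^bold>\<and> x = x" "x \<^bold>\<or> y = y" "y \<^bold>\<or> x = y"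
  using assms le_iff_vee[of x y] wedge_comm[of x y] vee_comm[of x y] by (simp_all add: irl_le_def)

end

context de_morgan_monoid
begin

lemma two_hom:
  assumes "\<f> \<preceq> \<one>"
  shows "(\<lambda>b. if b then \<one> else \<f>) \<in> irl_hom alg_2 A"
  unfolding irl_hom_def alg_2_def
  by (simp add: ball_bool le_lattice[OF assms(1)] f_le_one_idem[OF assms(1)])

lemma embeds_2:
  assumes "\<f> \<preceq> \<one>" "\<f> \<noteq> \<one>"
  shows "embeds alg_2 A"
  unfolding embeds_def
  using assms(2) by (intro bexI[OF _ two_hom[OF assms(1)]]) (auto simp: inj_on_def split: if_splits)

lemma two_th_le:
  assumes "\<f> \<preceq> \<one>" "carrier A = {\<one>, \<f>}"
  shows "th_le alg_2 A"
  by (rule th_le_surj[OF _ two_hom[OF assms(1)]])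
    (auto simp: alg_2_def assms(2) sig_algebra_def subuniverse_def)

text \<open>By idempotence \<open>(x \<otimes> \<not>x) \<otimes> x = x \<otimes> \<not>x \<preceq>
  f\<close>, hence \<open>x \<otimes> \<not>x \<preceq> \<not>x\<close>; the other inequality is
  \<open>\<one> \<preceq> x\<close> multiplied by the negation.\<close>

lemma odd_mult:
  assumes odd: "\<f> = \<one>" and x: "\<one> \<preceq> x" "x \<in> carrier A"
  shows "x \<otimes> x = x" "\<^bold>\<not> x \<otimes> \<^bold>\<not> x = \<^bold>\<not> x" "x \<otimes> \<^bold>\<not> x = \<^bold>\<not> x" "\<^bold>\<not> x \<otimes> x = \<^bold>\<not> x" "\<^bold>\<not> x \<preceq> \<one>" "\<^bold>\<not> \<one> = \<one>"
proof -
  show i: "x \<otimes> x = x" "\<^bold>\<not> x \<otimes> \<^bold>\<not> x = \<^bold>\<not> x"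
    using odd x by (simp_all add: f_le_one_idem)
  show "x \<otimes> \<^bold>\<not> x = \<^bold>\<not> x"
  proof (rule le_antisym)
    have "(x \<otimes> \<^bold>\<not> x) \<otimes> x = (x \<otimes> x) \<otimes> \<^bold>\<not> x"
      using x by (simp add: m_ac)
    then have "(x \<otimes> \<^bold>\<not> x) \<otimes> x \<preceq> \<f>"
      using mult_neg_self_le[of x] x i by simp
    then show "x \<otimes> \<^bold>\<not> x \<preceq> \<^bold>\<not> x"
      using x by (simp add: mult_le_f_iff)
    show "\<^bold>\<not> x \<preceq> x \<otimes> \<^bold>\<not> x"
      using mult_mono_left[OF x(1), of "\<^bold>\<not> x"] x by simp
  qed (use x in simp_all)
  then show "\<^bold>\<not> x \<otimes> x = \<^bold>\<not> x"
    using x by (simp add: m_comm)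
  show "\<^bold>\<not> x \<preceq> \<one>"
    using x odd f_le_iff[of x] by simp
  show "\<^bold>\<not> \<one> = \<one>"
    using odd by simp
qed

lemma S3_hom:
  assumes odd: "\<f> = \<one>" and x: "\<one> \<preceq> x" "x \<noteq> \<one>" "x \<in> carrier A"
  obtains h where "h \<in> irl_hom alg_S3 A" "inj_on h (carrier alg_S3)" "h ` carrier alg_S3 = {\<^bold>\<not> x, \<one>, x}"
proof -
  define h :: "int \<Rightarrow> 'a" where "h i = (if i = 0 then \<one> else if i = 1 then x else \<^bold>\<not> x)" for i
  note om = odd_mult[OF odd x(1,3)]
  have nx: "\<^bold>\<not> x \<preceq> x"
    using le_trans[OF om(5) x(1)] x by simp
  have ne: "\<^bold>\<not> x \<noteq> \<one>" "\<^bold>\<not> x \<noteq> x"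
    using x om(5) odd le_antisym[of x \<one>] neg_inject[of x \<one>] by auto
  note [simp] = om(1-4) le_lattice[OF x(1) _ x(3)] le_lattice[OF om(5)] le_lattice[OF nx]
  have "h \<in> irl_hom alg_S3 A"
    unfolding irl_hom_def carrier_S3 using x odd by (simp add: sugihara_def h_def)
  moreover have "inj_on h (carrier alg_S3)"
    unfolding carrier_S3 using ne x(2) by (auto simp: h_def)
  moreover have "h ` carrier alg_S3 = {\<^bold>\<not> x, \<one>, x}"
    unfolding carrier_S3 by (auto simp: h_def)
  ultimately show thesis
    using that by blast
qed

text \<open>Order and idempotence yield the whole multiplication table except for
  \<open>y \<otimes> \<not>x\<close>, which is the hypothesis \<open>prod\<close>;
  \<open>odd_embeds_S5\<close> obtains it from primeness.\<close>

lemma S5_hom: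
  assumes odd: "\<f> = \<one>" and x: "\<one> \<preceq> x" "x \<noteq> \<one>" "x \<in> carrier A"
    and y: "x \<preceq> y" "x \<noteq> y" "y \<in> carrier A" and prod: "y \<otimes> \<^bold>\<not> x = y"
  shows "embeds alg_S5 A"
proof -
  define h :: "int \<Rightarrow> 'a"
    where "h i = (if i = 0 then \<one> else if i = 1 then x else if i = 2 then y else if i = -1 then \<^bold>\<not> x else \<^bold>\<not> y)" for i
  have y1: "\<one> \<preceq> y"
    using le_trans[OF x(1) y(1)] x y by simp
  note ox = odd_mult[OF odd x(1,3)] and oy = odd_mult[OF odd y1 y(3)]
  have nn: "\<^bold>\<not> y \<preceq> \<^bold>\<not> x"
    using x y by (simp add: neg_le_neg_iff)
  have chain: "\<^bold>\<not> x \<preceq> x" "\<^bold>\<not> y \<preceq> x" "\<^bold>\<not> y \<preceq> y" "\<^bold>\<not> x \<preceq> y"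
    using le_trans[OF ox(5) x(1)] le_trans[OF oy(5) x(1)] le_trans[OF oy(5) y1] le_trans[OF ox(5) y1] x y
    by simp_all
  have xy: "x \<otimes> y = y"
  proof (rule le_antisym)
    show "x \<otimes> y \<preceq> y"
      using mult_mono_left[OF y(1) x(3) y(3) y(3)] oy(1) by simp
    show "y \<preceq> x \<otimes> y"
      using mult_mono_left[OF x(1) _ x(3) y(3)] y by simp
  qed (use x y in simp_all)
  have xny: "x \<otimes> \<^bold>\<not> y = \<^bold>\<not> y"
  proof (rule le_antisym)
    show "x \<otimes> \<^bold>\<not> y \<preceq> \<^bold>\<not> y"
      using mult_mono_left[OF y(1) x(3) y(3), of "\<^bold>\<not> y"] oy(3) y by simp
    show "\<^bold>\<not> y \<preceq> x \<otimes> \<^bold>\<not> y"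
      using mult_mono_left[OF x(1) _ x(3), of "\<^bold>\<not> y"] y by simp
  qed (use x y in simp_all)
  have nxny: "\<^bold>\<not> x \<otimes> \<^bold>\<not> y = \<^bold>\<not> y"
  proof (rule le_antisym)
    show "\<^bold>\<not> x \<otimes> \<^bold>\<not> y \<preceq> \<^bold>\<not> y"
      using mult_mono_left[OF ox(5), of "\<^bold>\<not> y"] x y by simp
    show "\<^bold>\<not> y \<preceq> \<^bold>\<not> x \<otimes> \<^bold>\<not> y"
      using mult_mono_left[OF nn, of "\<^bold>\<not> y"] x y oy(2) by simp
  qed (use x y in simp_all)
  have comm: "y \<otimes> x = y" "\<^bold>\<not> y \<otimes> x = \<^bold>\<not> y" "\<^bold>\<not> y \<otimes> \<^bold>\<not> x = \<^bold>\<not> y" "\<^bold>\<not> x \<otimes> y = y"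
    using xy xny nxny prod x y by (simp_all add: m_comm)
  have ny: "y \<noteq> \<one>"
    using x y le_antisym[of x \<one>] by auto
  have nle: "\<not> y \<preceq> \<one>" "\<not> x \<preceq> \<one>"
    using le_antisym[of y \<one>] le_antisym[of x \<one>] y1 ny x y by auto
  have ne: "\<^bold>\<not> x \<noteq> \<one>" "\<^bold>\<not> y \<noteq> \<one>" "\<^bold>\<not> x \<noteq> x" "\<^bold>\<not> y \<noteq> y" "\<^bold>\<not> x \<noteq> y" "\<^bold>\<not> y \<noteq> x" "\<^bold>\<not> x \<noteq> \<^bold>\<not> y"
    using ox(5) oy(5) nle ny x y neg_inject[of x y] neg_inject[of x \<one>] neg_inject[of y \<one>] ox(6) by auto
  note [simp] = ox(1-4) oy(1-4) xy xny nxny prod comm le_lattice[OF x(1) _ x(3)] le_lattice[OF ox(5)]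
    le_lattice[OF y1 _ y(3)] le_lattice[OF oy(5)] le_lattice[OF y(1)] le_lattice[OF nn]
    le_lattice[OF chain(1)] le_lattice[OF chain(2)] le_lattice[OF chain(3)] le_lattice[OF chain(4)]
  have "h \<in> irl_hom alg_S5 A"
    unfolding irl_hom_def carrier_S5 using x y odd by (simp add: sugihara_def h_def)
  moreover have "inj_on h (carrier alg_S5)"
    unfolding carrier_S5 using ne ne[symmetric] x(2) y(2) ny by (simp add: h_def)
  ultimately show ?thesis
    unfolding embeds_def by blast
qed

end

context prime_dmm
begin

text \<open>Primeness applied to the excluded middle, which holds because the algebra is
  square-increasing.\<close>

lemma one_le_or_le_f: "x \<in> carrier A \<Longrightarrow> \<one> \<preceq> x \<or> x \<preceq> \<f>"
  using one_prime[of x "\<^bold>\<not> x"] one_le_vee_neg[of x] le_f_iff[of x] by simp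

lemma odd_embeds_S3:
  assumes odd: "\<f> = \<one>" and x: "x \<in> carrier A" "x \<noteq> \<one>"
  shows "embeds alg_S3 A"
proof -
  have "\<exists>y \<in> carrier A. \<one> \<preceq> y \<and> y \<noteq> \<one>"
  proof (cases "\<one> \<preceq> x")
    case False
    then have "\<one> \<preceq> \<^bold>\<not> x"
      using one_le_or_le_f[of x] le_f_iff x by simp
    moreover have "\<^bold>\<not> x \<noteq> \<one>"
      using x odd neg_inject[of x \<one>] by simp
    ultimately show ?thesis
      using x by (intro bexI[of _ "\<^bold>\<not> x"]) simp_all
  next
    case True
    then show ?thesis
      using x by (intro bexI[of _ x]) simp_all
  qed
  then obtain y where y: "\<one> \<preceq> y" "y \<noteq> \<one>" "y \<in> carrier A"
    by blast
  obtain h where "h \<in> irl_hom alg_S3 A" "inj_on h (carrier alg_S3)"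
    using S3_hom[OF odd y] .
  then show ?thesis
    unfolding embeds_def by blast
qed

text \<open>For incomparable \<open>x\<close> and \<open>y\<close>, primeness puts both
  \<open>x \<otimes> \<not>y\<close> and \<open>y \<otimes> \<not>x\<close> above
  \<open>\<one>\<close>. Their product regroups to \<open>\<not>x \<otimes> \<not>y\<close>, which
  is below \<open>\<not>x\<close>, so \<open>x\<close> would be \<open>\<one>\<close>.\<close>

lemma odd_chain:
  assumes odd: "\<f> = \<one>" and x: "\<one> \<preceq> x" "x \<noteq> \<one>" "x \<in> carrier A"
    and y: "\<one> \<preceq> y" "y \<noteq> \<one>" "y \<in> carrier A"
  shows "x \<preceq> y \<or> y \<preceq> x"
proof (rule ccontr)
  assume "\<not> ?thesis"
  then have "\<one> \<preceq> x \<otimes> \<^bold>\<not> y" "\<one> \<preceq> y \<otimes> \<^bold>\<not> x"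
    using one_le_or_le_f[of "x \<otimes> \<^bold>\<not> y"] one_le_or_le_f[of "y \<otimes> \<^bold>\<not> x"] x y
    by (auto simp: le_iff_mult[symmetric])
  then have "\<one> \<otimes> \<one> \<preceq> (x \<otimes> \<^bold>\<not> y) \<otimes> (y \<otimes> \<^bold>\<not> x)"
    using x y by (intro mult_mono) simp_all
  also have "(x \<otimes> \<^bold>\<not> y) \<otimes> (y \<otimes> \<^bold>\<not> x) = (x \<otimes> \<^bold>\<not> x) \<otimes> (y \<otimes> \<^bold>\<not> y)"
    using x y by (simp add: m_ac)
  also have "\<dots> = \<^bold>\<not> x \<otimes> \<^bold>\<not> y"
    using odd_mult(3)[OF odd] x y by simp
  finally have "\<one> \<preceq> \<^bold>\<not> x \<otimes> \<^bold>\<not> y"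
    by simp
  moreover have "\<^bold>\<not> x \<otimes> \<^bold>\<not> y \<preceq> \<^bold>\<not> x \<otimes> \<one>"
    using odd_mult(5)[OF odd y(1,3)] x y by (intro mult_mono) simp_all
  ultimately have "\<one> \<preceq> \<^bold>\<not> x"
    using x y le_trans[of \<one> "\<^bold>\<not> x \<otimes> \<^bold>\<not> y" "\<^bold>\<not> x"] by simp
  then have "\<^bold>\<not> x = \<one>"
    using odd_mult(5)[OF odd x(1,3)] x by (intro le_antisym) simp_all
  then show False
    using x odd neg_inject[of x \<one>] by simp
qed

lemma odd_embeds_S5:
  assumes odd: "\<f> = \<one>" and x: "\<one> \<preceq> x" "x \<noteq> \<one>" "x \<in> carrier A"
    and y: "\<one> \<preceq> y" "y \<noteq> \<one>" "y \<in> carrier A" and ne: "x \<noteq> y"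
  shows "embeds alg_S5 A"
proof -
  have *: "embeds alg_S5 A"
    if xy: "x \<preceq> y" "x \<noteq> y" and x: "\<one> \<preceq> x" "x \<noteq> \<one>" "x \<in> carrier A" and y: "\<one> \<preceq> y" "y \<in> carrier A" for x y
  proof (rule S5_hom[OF odd x xy y(2)])
    show "y \<otimes> \<^bold>\<not> x = y"
    proof (rule le_antisym)
      show "y \<otimes> \<^bold>\<not> x \<preceq> y"
        using odd_mult(5)[OF odd x(1,3)] x y mult_mono[of y y "\<^bold>\<not> x" \<one>] by simp
      \<comment> \<open>Since \<open>y \<preceq> x\<close> means
        \<open>y \<otimes> \<not>x \<preceq> f\<close>, its failure and primeness give
        \<open>\<one> \<preceq> y \<otimes> \<not>x\<close>; multiplying by the idempotent
        \<open>y\<close> gives the claim.\<close>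
      have "\<not> y \<preceq> x"
        using le_antisym[of x y] xy x y by auto
      then have "\<one> \<preceq> y \<otimes> \<^bold>\<not> x"
        using one_le_or_le_f[of "y \<otimes> \<^bold>\<not> x"] x y by (auto simp: le_iff_mult[symmetric])
      then have "y \<otimes> \<one> \<preceq> y \<otimes> (y \<otimes> \<^bold>\<not> x)"
        using x y by (intro mult_mono) simp_all
      then show "y \<preceq> y \<otimes> \<^bold>\<not> x"
        using odd_mult(1)[OF odd y] x y by (simp add: m_assoc[symmetric])
    qed (use x y in simp_all)
  qed
  show ?thesis
    using odd_chain[OF odd x y] *[of x y] *[of y x] x y ne by blast
qed

text \<open>Without \<open>S5\<close> at most one element lies strictly above \<open>\<one>\<close>,
  and all others are \<open>\<one>\<close> or its negation; so the algebra is trivial or an image of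
  \<open>S3\<close>.\<close>

lemma odd_th_le_S3:
  assumes odd: "\<f> = \<one>" and S5: "\<not> embeds alg_S5 A"
  shows "th_le alg_S3 A"
proof (cases "carrier A = {\<one>}")
  case True
  then have "eval_term A v s = \<one>" if "range v \<subseteq> carrier A" for v s
    using eval_term_closed[OF sig_algebra that, of s] by simp
  then show ?thesis
    by (simp add: th_le_def satisfies_eq_def)
next
  case False
  then obtain u where u: "u \<in> carrier A" "u \<noteq> \<one>"
    using one_closed by blast
  have ex: "\<one> \<preceq> w \<or> \<one> \<preceq> \<^bold>\<not> w" if "w \<in> carrier A" for w
    using one_le_or_le_f[OF that] le_f_iff[OF that] by simp
  have nu: "\<^bold>\<not> u \<noteq> \<one>"
    using u odd neg_inject[of u \<one>] by simp
  obtain x where x: "\<one> \<preceq> x" "x \<noteq> \<one>" "x \<in> carrier A"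
    using ex[OF u(1)] u nu by auto
  have "w \<in> {\<^bold>\<not> x, \<one>, x}" if w: "w \<in> carrier A" for w
  proof (cases "\<one> \<preceq> w")
    case True
    then show ?thesis
      using odd_embeds_S5[OF odd x, of w] S5 w by blast
  next
    case False
    then have "\<one> \<preceq> \<^bold>\<not> w" "\<^bold>\<not> w \<noteq> \<one>"
      using ex w False odd neg_inject[of w \<one>] by auto
    then have "\<^bold>\<not> w = x"
      using odd_embeds_S5[OF odd x, of "\<^bold>\<not> w"] S5 w by auto
    then show ?thesis
      using w by auto
  qed
  then have car: "carrier A = {\<^bold>\<not> x, \<one>, x}"
    using x by auto
  obtain h where "h \<in> irl_hom alg_S3 A" "h ` carrier alg_S3 = carrier A"
    using S3_hom[OF odd x] car by metis
  moreover have "sig_algebra alg_S3"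
    unfolding sig_algebra_def subuniverse_def carrier_S3 by (simp add: sugihara_def)
  ultimately show ?thesis
    by (metis th_le_surj)
qed

end

section \<open>Bounded algebras\<close>

context de_morgan_monoid
begin

text \<open>The quotient by a filter containing both \<open>f\<close> and \<open>f \<rightarrow> e\<close> satisfies \<open>e = f\<close>.\<close>

lemma quotient_embeds_S3:
  assumes F: "deductive_filter A F" "\<f> \<in> F" "\<z> \<in> F" and x: "x \<in> carrier A" "x \<notin> F"
  obtains B :: "'a irl_alg" where "th_le A B" "prime_dmm B" "embeds alg_S3 B"
proof -
  obtain B :: "'a irl_alg" and r where r: "r \<in> irl_hom A B" and th: "th_le A B" and B: "prime_dmm B"
    and F0: "\<And>y. y \<in> F \<Longrightarrow> \<one>\<^bsub>B\<^esub> \<preceq>\<^bsub>B\<^esub> r y" and n: "\<not> \<one>\<^bsub>B\<^esub> \<preceq>\<^bsub>B\<^esub> r x"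
    using prime_quotient[OF F(1) x] by metis
  interpret B: prime_dmm B
    by fact
  note der = irl_hom_derived[OF r sig_algebra]
  have "\<one>\<^bsub>B\<^esub> \<preceq>\<^bsub>B\<^esub> irl_f B" "irl_f B \<preceq>\<^bsub>B\<^esub> \<one>\<^bsub>B\<^esub>"
    using F0[OF F(2)] F0[OF F(3)] der(1,2) by (simp_all add: B.zz_eq_imp B.one_le_imp_iff)
  then have "irl_f B = \<one>\<^bsub>B\<^esub>"
    by (intro B.le_antisym) simp_all
  moreover have "r x \<in> carrier B" "r x \<noteq> \<one>\<^bsub>B\<^esub>"
    using irl_homD(2)[OF r x(1)] n by auto
  ultimately show thesis
    using that th B B.odd_embeds_S3 by blast
qed

text \<open>In the principal filter of \<open>f\<close>: \<open>z = f \<rightarrow> \<one>\<close>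
  belongs to it because \<open>f \<otimes> f = f \<preceq> \<one>\<close>, and the negation of
  \<open>x\<close> is outside by contraposition.\<close>

lemma not_le_one_quotient_S3:
  assumes f: "\<f> \<preceq> \<one>" and x: "x \<in> carrier A" "\<not> x \<preceq> \<one>"
  obtains B :: "'a irl_alg" where "th_le A B" "prime_dmm B" "embeds alg_S3 B"
proof (rule quotient_embeds_S3)
  show "deductive_filter A {y \<in> carrier A. \<f> \<preceq> y}"
    by (rule deductive_filter_principal) (use f in simp_all)
  have "\<f> \<preceq> \<z>"
    unfolding zz_eq_imp using f f_le_one_idem[OF f, of \<f>] mult_le_iff[of \<f> \<f> \<one>] by simp
  then show "\<z> \<in> {y \<in> carrier A. \<f> \<preceq> y}"
    by simp
  show "\<^bold>\<not> x \<notin> {y \<in> carrier A. \<f> \<preceq> y}"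
    using x f_le_iff[of "\<^bold>\<not> x"] by simp
qed (use x that in simp_all)

text \<open>The same with the principal filter of \<open>z\<close>: it contains \<open>f\<close>
  because \<open>\<one> \<preceq> t\<close>, and misses the negation of \<open>x\<close>.\<close>

lemma not_le_t_quotient_S3:
  assumes e: "\<one> \<preceq> \<t>" and x: "x \<in> carrier A" "\<not> x \<preceq> \<t>"
  obtains B :: "'a irl_alg" where "th_le A B" "prime_dmm B" "embeds alg_S3 B"
proof (rule quotient_embeds_S3)
  show "deductive_filter A {y \<in> carrier A. \<z> \<preceq> y}"
    by (rule deductive_filter_principal) (use zz_le_one in simp_all)
  show "\<f> \<in> {y \<in> carrier A. \<z> \<preceq> y}"
    using e neg_le_neg_iff[of \<one> \<t>] by simp
  show "\<^bold>\<not> x \<notin> {y \<in> carrier A. \<z> \<preceq> y}"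
    using x neg_le_neg_iff[of x \<t>] by simp
qed (use x that in simp_all)

lemma trivial_if_one_least:
  assumes "\<And>y. y \<in> carrier A \<Longrightarrow> \<one> \<preceq> y"
  shows "\<not> nontrivial A"
proof -
  have "y = \<one>" if y: "y \<in> carrier A" for y
    using assms[OF y] assms[of "\<^bold>\<not> y"] bottom_mult[of \<one> y] assms y by simp
  then show ?thesis
    by (auto simp: nontrivial_def)
qed

text \<open>The principal filter of \<open>p\<close> induces the identity or the full congruence:
  the former means \<open>p = \<one>\<close>, the latter that every \<open>y\<close> lies above
  \<open>p\<close>.\<close>

lemma simple_negative_cone:
  assumes simple: "simple_alg A" and p: "p \<preceq> \<one>" "p \<in> carrier A" and y: "y \<in> carrier A"
  shows "p = \<one> \<or> p \<preceq> y"
proof -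
  let ?F = "{x \<in> carrier A. p \<preceq> x}"
  have F: "deductive_filter A ?F"
    using p by (rule deductive_filter_principal)
  have "filter_congruence A ?F = Id_on (carrier A) \<or> filter_congruence A ?F = carrier A \<times> carrier A"
    using simple congruence_filter_congruence[OF F] by (simp add: simple_alg_def)
  then show ?thesis
  proof
    assume "filter_congruence A ?F = Id_on (carrier A)"
    then have "(\<one> \<^bold>\<and> p, \<one>) \<in> Id_on (carrier A)"
      using filter_congruence_one_iff[OF F, of p] p by simp
    then show ?thesis
      using p le_lattice[OF p(1)] by auto
  next
    assume "filter_congruence A ?F = carrier A \<times> carrier A"
    then show ?thesis
      using filter_congruence_one_iff[OF F y] y by simp
  qed
qed

end

context prime_dmm
begin

lemma one_le_t: "\<not> \<f> \<preceq> \<one> \<Longrightarrow> \<one> \<preceq> \<t>"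
  using one_le_or_le_f[of \<t>] mult_le_f_iff[of \<f> \<f>] by simp

end

locale bounded_prime_dmm = prime_dmm +
  assumes not_f_le_one: "\<not> irl_f A \<preceq> \<one>"
    and le_t: "x \<in> carrier A \<Longrightarrow> x \<preceq> irl_f A \<otimes> irl_f A"
begin

lemma z_le: "x \<in> carrier A \<Longrightarrow> \<z> \<preceq> x"
  using le_t[of "\<^bold>\<not> x"] neg_le_neg_iff[of "\<^bold>\<not> x" \<t>] by simp

lemma z_mult [simp]: "x \<in> carrier A \<Longrightarrow> \<z> \<otimes> x = \<z>" "x \<in> carrier A \<Longrightarrow> x \<otimes> \<z> = \<z>"
  using bottom_mult[of \<z> x] z_le by (simp_all add: m_comm)

lemma le_z_iff: "x \<in> carrier A \<Longrightarrow> x \<preceq> \<z> \<longleftrightarrow> x = \<z>"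
  using le_antisym z_le by (metis zz_closed)

lemma t_le_iff: "x \<in> carrier A \<Longrightarrow> \<t> \<preceq> x \<longleftrightarrow> x = \<t>"
  using le_antisym[of \<t> x] le_t by auto

lemma neg_eq_t_iff: "x \<in> carrier A \<Longrightarrow> \<^bold>\<not> x = \<t> \<longleftrightarrow> x = \<z>"
  and neg_eq_z_iff: "x \<in> carrier A \<Longrightarrow> \<^bold>\<not> x = \<z> \<longleftrightarrow> x = \<t>"
  using neg_inject[of x \<z>] neg_inject[of x \<t>] by simp_all

lemma constants_distinct: "\<one> \<noteq> \<f>" "\<one> \<noteq> \<t>" "\<one> \<noteq> \<z>" "\<f> \<noteq> \<t>" "\<f> \<noteq> \<z>" "\<t> \<noteq> \<z>"
proof -
  show "\<one> \<noteq> \<f>" "\<f> \<noteq> \<z>"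
    using not_f_le_one zz_le_one by auto
  show "\<one> \<noteq> \<t>"
    using not_f_le_one f_le_tt by auto
  have nt: "\<not> \<t> \<preceq> \<f>"
    using not_f_le_one by (simp add: mult_le_f_iff)
  then show "\<f> \<noteq> \<t>" "\<t> \<noteq> \<z>"
    using z_le[of \<f>] by auto
  then show "\<one> \<noteq> \<z>"
    using neg_eq_t_iff[of \<one>] by auto
qed

text \<open>Rigorous compactness. Unless \<open>x\<close> is the bottom,
  \<open>t \<otimes> x \<preceq> f\<close> fails, so \<open>\<one> \<preceq> t \<otimes> x\<close>
  by primeness; multiply by the idempotent \<open>t\<close>.\<close>

lemma t_mult: 
  assumes x: "x \<in> carrier A" "x \<noteq> \<z>"
  shows "\<t> \<otimes> x = \<t>" "x \<otimes> \<t> = \<t>"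
proof -
  have "\<not> \<t> \<otimes> x \<preceq> \<f>"
    using mult_le_f_iff[of x \<t>] le_z_iff x by (simp add: m_comm)
  then have "\<one> \<preceq> \<t> \<otimes> x"
    using one_le_or_le_f[of "\<t> \<otimes> x"] x by simp
  then have "\<t> \<otimes> \<one> \<preceq> \<t> \<otimes> (\<t> \<otimes> x)"
    using x by (intro mult_mono) simp_all
  then have "\<t> \<preceq> \<t> \<otimes> x"
    using x tt_mult_tt by (simp add: m_assoc[symmetric])
  then show "\<t> \<otimes> x = \<t>"
    using t_le_iff x by simp
  then show "x \<otimes> \<t> = \<t>"
    using x by (simp add: m_comm)
qed

lemma mult_eq_z_iff:
  assumes "x \<in> carrier A" "y \<in> carrier A"
  shows "x \<otimes> y = \<z> \<longleftrightarrow> x = \<z> \<or> y = \<z>"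
proof
  assume xy: "x \<otimes> y = \<z>"
  show "x = \<z> \<or> y = \<z>"
  proof (rule ccontr)
    assume "\<not> ?thesis"
    then have "\<t> = \<t> \<otimes> (x \<otimes> y)"
      using assms t_mult by (simp add: m_assoc[symmetric])
    then show False
      using xy constants_distinct by simp
  qed
qed (use assms in auto)

lemma z_lattice [simp]:
  assumes "x \<in> carrier A"
  shows "\<z> \<^bold>\<and> x = \<z>" "x \<^bold>\<and> \<z> = \<z>" "\<z> \<^bold>\<or> x = x" "x \<^bold>\<or> \<z> = x"
  using le_lattice[OF z_le] assms by simp_all

lemma t_lattice:
  assumes "x \<in> carrier A"
  shows "\<t> \<^bold>\<and> x = x" "x \<^bold>\<and> \<t> = x" "\<t> \<^bold>\<or> x = \<t>" "x \<^bold>\<or> \<t> = \<t>"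
  using le_lattice[OF le_t] assms by simp_all

lemma imp_z: "x \<in> carrier A \<Longrightarrow> x \<noteq> \<z> \<Longrightarrow> x \<^bold>\<rightarrow> \<z> = \<z>"
  by (simp add: irl_imp_def t_mult)

text \<open>One map serves \<open>alg_C4\<close> and \<open>alg_D4\<close>: they share product, unit
  and negation and differ only in the lattice.\<close>

abbreviation four_hom :: "four \<Rightarrow> 'a"
  where "four_hom \<equiv> rec_four \<z> \<one> \<f> \<t>"

lemma four_hom_inj: "inj four_hom"
  unfolding inj_def ball_four using constants_distinct constants_distinct[symmetric] by simp

lemma four_hom_range: "range four_hom = {\<z>, \<one>, \<f>, \<t>}"
  unfolding UNIV_four by simp

lemma C4_hom:
  assumes "\<one> \<preceq> \<f>"
  shows "four_hom \<in> irl_hom alg_C4 A"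
  unfolding irl_hom_def alg_C4_def Pi_def Ball_def ball_four
  using constants_distinct
  by (simp add: ball_four mult4_def t_mult t_lattice le_lattice[OF assms])

lemma D4_hom:
  assumes "\<one> \<^bold>\<and> \<f> = \<z>"
  shows "four_hom \<in> irl_hom alg_D4 A"
proof -
  have v: "\<one> \<^bold>\<or> \<f> = \<t>"
    using neg_wedge[of \<one> \<f>] assms by (simp add: vee_comm)
  show ?thesis
    unfolding irl_hom_def alg_D4_def Pi_def Ball_def ball_four
    using constants_distinct assms v
    by (simp add: ball_four mult4_def t_mult t_lattice wedge_comm[of \<f> \<one>] vee_comm[of \<f> \<one>])
qed

lemma embeds_C4: "\<one> \<preceq> \<f> \<Longrightarrow> embeds alg_C4 A"
  unfolding embeds_def using C4_hom four_hom_inj by (auto intro: inj_on_subset)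

lemma embeds_D4: "\<one> \<^bold>\<and> \<f> = \<z> \<Longrightarrow> embeds alg_D4 A"
  unfolding embeds_def using D4_hom four_hom_inj by (auto intro: inj_on_subset)

text \<open>\<open>prime_quotient\<close> with \<open>z\<close> as the avoided element. As
  \<open>z = f \<rightarrow> \<one>\<close>, avoiding it keeps \<open>f\<close> from falling below
  \<open>\<one>\<close>, and its maximality clause leaves only \<open>z\<close> strictly below
  \<open>\<one>\<close>.\<close>

lemma bounded_quotient:
  assumes F: "deductive_filter A F" "\<z> \<notin> F"
  obtains B :: "'a irl_alg" and r where "r \<in> irl_hom A B" "th_le A B" "bounded_prime_dmm B"
    "\<And>y. y \<in> F \<Longrightarrow> \<one>\<^bsub>B\<^esub> \<preceq>\<^bsub>B\<^esub> r y"
    "\<And>y. \<lbrakk>y \<in> carrier B; y \<preceq>\<^bsub>B\<^esub> \<one>\<^bsub>B\<^esub>\<rbrakk> \<Longrightarrow> y = \<one>\<^bsub>B\<^esub> \<or> y = irl_zero B"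
proof -
  obtain B :: "'a irl_alg" and r where r: "r \<in> irl_hom A B" "r ` carrier A = carrier B"
    and th: "th_le A B" and B: "prime_dmm B"
    and F0: "\<And>y. y \<in> F \<Longrightarrow> \<one>\<^bsub>B\<^esub> \<preceq>\<^bsub>B\<^esub> r y" and n: "\<not> \<one>\<^bsub>B\<^esub> \<preceq>\<^bsub>B\<^esub> r \<z>"
    and max: "\<And>y. \<lbrakk>y \<in> carrier B; \<not> \<one>\<^bsub>B\<^esub> \<preceq>\<^bsub>B\<^esub> y\<rbrakk> \<Longrightarrow> y \<^bold>\<and>\<^bsub>B\<^esub> \<one>\<^bsub>B\<^esub> \<preceq>\<^bsub>B\<^esub> r \<z>"
    using prime_quotient[OF F(1) zz_closed F(2)] by metis
  interpret B: prime_dmm B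
    by fact
  note der = irl_hom_derived[OF r(1) sig_algebra]
  have "bounded_prime_dmm B"
  proof (intro bounded_prime_dmm.intro bounded_prime_dmm_axioms.intro)
    show "prime_dmm B" by fact
    show "\<not> irl_f B \<preceq>\<^bsub>B\<^esub> \<one>\<^bsub>B\<^esub>"
      using n der(2) by (simp add: B.zz_eq_imp B.one_le_imp_iff)
    fix y assume "y \<in> carrier B"
    then obtain x where "y = r x" "x \<in> carrier A"
      using r(2) by blast
    then show "y \<preceq>\<^bsub>B\<^esub> irl_f B \<otimes>\<^bsub>B\<^esub> irl_f B"
      using der(4)[of x \<t>] le_t[of x] der(1) irl_homD(3)[OF r(1), of \<f> \<f>] by simp
  qed
  then interpret B: bounded_prime_dmm B .
  have "y = \<one>\<^bsub>B\<^esub> \<or> y = irl_zero B" if y: "y \<in> carrier B" "y \<preceq>\<^bsub>B\<^esub> \<one>\<^bsub>B\<^esub>" for y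
  proof (cases "\<one>\<^bsub>B\<^esub> \<preceq>\<^bsub>B\<^esub> y")
    case True
    then show ?thesis
      using y B.le_antisym by simp
  next
    case False
    then have "y \<preceq>\<^bsub>B\<^esub> irl_zero B"
      using max[OF y(1) False] y der(2) B.le_lattice[OF y(2)] by simp
    then show ?thesis
      using y B.le_z_iff by simp
  qed
  then show thesis
    using that r(1) th F0 B.bounded_prime_dmm_axioms by blast
qed

text \<open>The principal filter of \<open>\<one> \<and> f\<close> forces
  \<open>\<one> \<preceq> f\<close> in the quotient and misses \<open>z\<close> exactly when that
  meet is not the bottom.\<close>

lemma C4_quotient:
  assumes "\<one> \<^bold>\<and> \<f> \<noteq> \<z>"
  obtains B :: "'a irl_alg" where "th_le A B" "bounded_prime_dmm B" "embeds alg_C4 B"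
proof -
  let ?F = "{y \<in> carrier A. \<one> \<^bold>\<and> \<f> \<preceq> y}"
  have F: "deductive_filter A ?F"
    by (rule deductive_filter_principal) simp_all
  have "\<z> \<notin> ?F"
    using assms le_z_iff by simp
  then obtain B :: "'a irl_alg" and r where r: "r \<in> irl_hom A B" "th_le A B" and B: "bounded_prime_dmm B"
    and F0: "\<And>y. y \<in> ?F \<Longrightarrow> \<one>\<^bsub>B\<^esub> \<preceq>\<^bsub>B\<^esub> r y"
    using bounded_quotient[OF F] by metis
  have "\<one>\<^bsub>B\<^esub> \<preceq>\<^bsub>B\<^esub> irl_f B"
    using F0[of \<f>] irl_hom_derived(1)[OF r(1) sig_algebra] by simp
  then show thesis
    using that r B bounded_prime_dmm.embeds_C4 by blast
qed

text \<open>If a congruence identifies \<open>x\<close> and \<open>y\<close> with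
  \<open>x \<preceq> y\<close> failing, then \<open>(x \<rightarrow> y) \<and> \<one>\<close> is not
  \<open>\<one>\<close>, hence is \<open>z\<close>, yet it is congruent to
  \<open>(y \<rightarrow> y) \<and> \<one> = \<one>\<close>. Multiplying \<open>z\<close> and
  \<open>\<one>\<close> by any element collapses everything.\<close>

lemma simple_if_negative_cone:
  assumes cone: "\<And>y. \<lbrakk>y \<in> carrier A; y \<preceq> \<one>\<rbrakk> \<Longrightarrow> y = \<one> \<or> y = \<z>"
  shows "simple_alg A"
  unfolding simple_alg_def
proof (intro conjI allI impI)
  show "nontrivial A"
    unfolding nontrivial_def using constants_distinct(1) one_closed ff_closed by blast
  fix \<theta> assume con: "congruence A \<theta>"
  let ?r = "congruence_rep \<theta>"
  note r = congruence_rep_hom[OF sig_algebra con]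
  note eq = congruence_rep_eq_iff[OF sig_algebra con]
  have sub: "\<theta> \<subseteq> carrier A \<times> carrier A" and refl: "Id_on (carrier A) \<subseteq> \<theta>"
    using con by (auto simp: congruence_def equiv_def refl_on_def)
  show "\<theta> = Id_on (carrier A) \<or> \<theta> = carrier A \<times> carrier A"
  proof (cases "\<theta> \<subseteq> Id_on (carrier A)")
    case False
    then obtain u v where uv: "(u, v) \<in> \<theta>" "u \<noteq> v"
      using sub by auto
    then have c: "u \<in> carrier A" "v \<in> carrier A"
      using sub by auto
    obtain x y where xy: "x \<in> carrier A" "y \<in> carrier A" "?r x = ?r y" "\<not> x \<preceq> y"
      using le_antisym[of u v] uv c eq by metis
    let ?p = "(x \<^bold>\<rightarrow> y) \<^bold>\<and> \<one>"
    have "?p \<noteq> \<one>"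
      using xy one_le_imp_iff[of x y] wedge_comm[of \<one> "x \<^bold>\<rightarrow> y"] by (simp add: irl_le_def)
    then have p: "?p = \<z>"
      using cone[of ?p] xy by simp
    have "?r ?p = ?r ((y \<^bold>\<rightarrow> y) \<^bold>\<and> \<one>)"
      using xy irl_homD[OF r] irl_hom_derived(3)[OF r sig_algebra] by simp
    also have "(y \<^bold>\<rightarrow> y) \<^bold>\<and> \<one> = \<one>"
      using xy one_le_imp_iff[of y y] le_lattice[of \<one> "y \<^bold>\<rightarrow> y"] by simp
    finally have rz: "?r \<z> = ?r \<one>"
      using p by simp
    have "?r x = ?r \<z>" if "x \<in> carrier A" for x
      using rz irl_homD(3)[OF r, of \<z> x] irl_homD(3)[OF r, of \<one> x] that by simp
    then have "(x, y) \<in> \<theta>" if "x \<in> carrier A" "y \<in> carrier A" for x y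
      using eq that by metis
    then show ?thesis
      using sub by auto
  qed (use refl in auto)
qed

text \<open>If \<open>f \<cdot> x \<noteq> 1\<close>, then \<open>x\<close> is invertible, with inverse \<open>x \<rightarrow> e\<close>; but \<open>e\<close> is the only
  invertible element of a square-increasing algebra.\<close>

lemma f_mult_eq_t:
  assumes cone: "\<And>y. \<lbrakk>y \<in> carrier A; y \<preceq> \<one>\<rbrakk> \<Longrightarrow> y = \<one> \<or> y = \<z>"
    and x: "x \<in> carrier A" "x \<noteq> \<one>" "x \<noteq> \<z>"
  shows "\<f> \<otimes> x = \<t>"
proof (rule ccontr)
  let ?y = "x \<^bold>\<rightarrow> \<one>"
  assume "\<f> \<otimes> x \<noteq> \<t>"
  moreover have "?y = \<^bold>\<not> (\<f> \<otimes> x)"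
    using x by (simp add: irl_imp_def m_comm)
  ultimately have "?y \<noteq> \<z>"
    using neg_eq_z_iff x by simp
  then have "x \<otimes> ?y \<noteq> \<z>"
    using mult_eq_z_iff x by simp
  then have xy: "x \<otimes> ?y = \<one>"
    using cone[of "x \<otimes> ?y"] mult_imp_le x by simp
  have "\<one> \<preceq> x" "\<one> \<preceq> ?y"
    using invertible_one_le[of x ?y] invertible_one_le[of ?y x] xy x by (simp_all add: m_comm)
  then have "x \<otimes> \<one> \<preceq> x \<otimes> ?y"
    using x by (intro mult_mono) simp_all
  then have "x = \<one>"
    using xy \<open>\<one> \<preceq> x\<close> x le_antisym by simp
  then show False
    using x by simp
qed

lemma f_mult_both_eq_t:
  assumes cone: "\<And>y. \<lbrakk>y \<in> carrier A; y \<preceq> \<one>\<rbrakk> \<Longrightarrow> y = \<one> \<or> y = \<z>"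
    and x: "x \<in> carrier A" "x \<notin> {\<z>, \<one>, \<f>, \<t>}"
  shows "\<f> \<otimes> x = \<t>" "\<f> \<otimes> \<^bold>\<not> x = \<t>"
proof -
  show "\<f> \<otimes> x = \<t>"
    using f_mult_eq_t[OF cone] x by blast
  have "\<^bold>\<not> x \<noteq> \<one>" "\<^bold>\<not> x \<noteq> \<z>"
    using x neg_inject[of x \<f>] neg_eq_z_iff by auto
  then show "\<f> \<otimes> \<^bold>\<not> x = \<t>"
    using f_mult_eq_t[OF cone] x by simp
qed

text \<open>Since \<open>u \<rightarrow> z = z\<close> for every \<open>u\<close> other than
  \<open>z\<close>, the identity fails exactly when both disjuncts are the bottom, and these are the
  negations of \<open>f \<otimes> \<not>x\<close> and \<open>f \<otimes> x\<close>.\<close>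

lemma M_identity_fails_iff:
  assumes x: "x \<in> carrier A"
  shows "((\<f> \<^bold>\<rightarrow> x) \<^bold>\<or> (x \<^bold>\<rightarrow> \<one>)) \<^bold>\<rightarrow> \<z> \<noteq> \<z> \<longleftrightarrow> \<f> \<otimes> x = \<t> \<and> \<f> \<otimes> \<^bold>\<not> x = \<t>"
proof -
  have eq: "\<f> \<^bold>\<rightarrow> x = \<^bold>\<not> (\<f> \<otimes> \<^bold>\<not> x)" "x \<^bold>\<rightarrow> \<one> = \<^bold>\<not> (\<f> \<otimes> x)"
    using x by (simp_all add: irl_imp_def m_comm)
  have "\<z> \<^bold>\<rightarrow> \<z> = \<t>"
    by (simp add: irl_imp_def)
  then have "((\<f> \<^bold>\<rightarrow> x) \<^bold>\<or> (x \<^bold>\<rightarrow> \<one>)) \<^bold>\<rightarrow> \<z> \<noteq> \<z> \<longleftrightarrow> (\<f> \<^bold>\<rightarrow> x) \<^bold>\<or> (x \<^bold>\<rightarrow> \<one>) = \<z>"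
    using imp_z x constants_distinct by (metis imp_closed vee_closed ff_closed one_closed)
  also have "\<dots> \<longleftrightarrow> \<f> \<^bold>\<rightarrow> x = \<z> \<and> x \<^bold>\<rightarrow> \<one> = \<z>"
    using x vee_le_iff[of "\<f> \<^bold>\<rightarrow> x" "x \<^bold>\<rightarrow> \<one>" \<z>] le_z_iff by simp
  also have "\<dots> \<longleftrightarrow> \<f> \<otimes> x = \<t> \<and> \<f> \<otimes> \<^bold>\<not> x = \<t>"
    unfolding eq using x neg_eq_z_iff by auto
  finally show ?thesis .
qed

end

section \<open>Algebras with \<open>C\<^sub>4\<close> as a proper quotient\<close>

text \<open>The case in which the constants form neither \<open>C4\<close>
  (\<open>embeds_C4\<close>) nor \<open>D4\<close> (\<open>embeds_D4\<close>).\<close>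

locale crystalline_dmm = bounded_prime_dmm +
  assumes not_one_le_f: "\<not> \<one> \<preceq> irl_f A"
    and one_wedge_f: "\<one> \<^bold>\<and> irl_f A \<noteq> irl_zero A"
begin

text \<open>Modulo the filter generated by \<open>e \<and> f\<close>, the algebra is \<open>C\<^sub>4\<close>. The six elements \<open>ca\<close>, \<open>cg\<close>,
  \<open>cd\<close>, \<open>e\<close>, \<open>ck\<close>, \<open>cc\<close> form a sublattice, the product of the chains \<open>ca \<le> cg \<le> cd\<close> and
  \<open>ca \<le> e\<close>, possibly with some of them equal. If the algebra is 0-generated, they make up the
  congruence class of \<open>e\<close> and their negations that of \<open>f\<close>.\<close>

definition "ca = \<one> \<^bold>\<and> \<f>"
text \<open>\<open>ca\<close> and \<open>cc\<close> bound the class of \<open>\<one>\<close>: modulo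
  the filter generated by \<open>ca\<close>, an element \<open>x\<close> is congruent to
  \<open>\<one>\<close> iff \<open>ca \<preceq> x\<close> and
  \<open>ca \<otimes> x \<preceq> \<one>\<close>. In this class \<open>cd\<close> is the greatest
  element below \<open>f\<close>.\<close>

definition "cc = ca \<^bold>\<rightarrow> \<one>"
definition "cd = cc \<^bold>\<and> \<f>"
text \<open>The greatest element of the class of \<open>\<one>\<close> whose product with
  \<open>cc\<close> stays below \<open>f\<close>.\<close>

definition "cg = cc \<^bold>\<and> \<^bold>\<not> cc"
definition "ck = \<one> \<^bold>\<or> cg"

lemma c_closed [simp]:
  "ca \<in> carrier A" "cc \<in> carrier A" "cd \<in> carrier A" "cg \<in> carrier A" "ck \<in> carrier A"
  by (simp_all add: ca_def cc_def cd_def cg_def ck_def)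

lemma le_f_iff': "x \<in> carrier A \<Longrightarrow> x \<preceq> \<f> \<longleftrightarrow> \<not> \<one> \<preceq> x"
  using one_le_or_le_f le_trans not_one_le_f by (metis one_closed ff_closed)

lemma ca_le: "ca \<preceq> \<one>" "ca \<preceq> \<f>" "ca \<noteq> \<z>"
  using one_wedge_f by (simp_all add: ca_def)

lemma le_ca: "\<lbrakk>x \<preceq> \<one>; x \<preceq> \<f>; x \<in> carrier A\<rbrakk> \<Longrightarrow> x \<preceq> ca"
  by (simp add: ca_def le_wedge_iff)

lemma ca_idem: "ca \<otimes> ca = ca"
  using ca_le by (simp add: mult_self_le_one)

lemma one_le_cc: "\<one> \<preceq> cc"
  unfolding cc_def using ca_le by (simp add: one_le_imp_iff)

lemma ca_le_cc: "ca \<preceq> cc"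
  using le_trans[OF ca_le(1) one_le_cc] by simp

lemma ca_cc: "ca \<otimes> cc = ca"
proof (rule le_antisym)
  have "ca \<otimes> cc \<preceq> \<one>"
    unfolding cc_def by (simp add: mult_imp_le)
  then have "ca \<otimes> (ca \<otimes> cc) \<preceq> ca \<otimes> \<one>"
    by (intro mult_mono) simp_all
  then show "ca \<otimes> cc \<preceq> ca"
    using ca_idem by (simp add: m_assoc[symmetric])
  have "ca \<otimes> \<one> \<preceq> ca \<otimes> cc"
    using one_le_cc by (intro mult_mono) simp_all
  then show "ca \<preceq> ca \<otimes> cc"
    by simp
qed simp_all

lemma ca_mult: "\<lbrakk>ca \<preceq> x; x \<preceq> cc; x \<in> carrier A\<rbrakk> \<Longrightarrow> ca \<otimes> x = ca"
  using mult_mono[of ca ca ca x] mult_mono[of ca ca x cc] ca_idem ca_cc by (intro le_antisym) simp_all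

lemma cc_idem: "cc \<otimes> cc = cc"
proof (rule le_antisym)
  have "(cc \<otimes> cc) \<otimes> ca = (ca \<otimes> cc) \<otimes> cc"
    by (simp add: m_ac)
  then have "(cc \<otimes> cc) \<otimes> ca = ca"
    using ca_cc by simp
  then have "(cc \<otimes> cc) \<otimes> ca \<preceq> \<one>"
    using ca_le by simp
  then show "cc \<otimes> cc \<preceq> cc"
    using mult_le_iff[of "cc \<otimes> cc" ca \<one>] by (simp add: cc_def)
qed (simp_all add: square_increasing)

lemma neg_cc: "\<^bold>\<not> cc = ca \<otimes> \<f>"
  by (simp add: cc_def neg_imp)

text \<open>The square is \<open>ca \<otimes> t\<close>, and rigorous compactness applies because
  \<open>ca\<close> is not the bottom. As \<open>\<not>cc\<close> is the least element of the class
  of \<open>f\<close>, any two elements of that class multiply to the top.\<close>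

lemma neg_cc_mult: "\<^bold>\<not> cc \<otimes> \<^bold>\<not> cc = \<t>"
proof -
  have "\<^bold>\<not> cc \<otimes> \<^bold>\<not> cc = (ca \<otimes> ca) \<otimes> \<t>"
    unfolding neg_cc by (simp add: m_ac)
  then show ?thesis
    using ca_idem t_mult[OF _ ca_le(3)] by simp
qed

lemma cd_le: "cd \<preceq> cc" "cd \<preceq> \<f>" "ca \<preceq> cd"
  using ca_le_cc ca_le by (simp_all add: cd_def le_wedge_iff)

text \<open>By distributivity the join is
  \<open>cc \<and> (\<one> \<or> f) = cc \<and> \<not>ca\<close>, and
  \<open>cc \<preceq> \<not>ca\<close> because
  \<open>cc \<otimes> ca = ca \<preceq> f\<close>.\<close>

lemma one_vee_cd: "\<one> \<^bold>\<or> cd = cc"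
proof -
  have "\<one> \<^bold>\<or> \<f> = \<^bold>\<not> ca"
    by (simp add: ca_def neg_wedge vee_comm)
  moreover have "cc \<preceq> \<^bold>\<not> ca"
    using ca_cc ca_le mult_le_f_iff[of cc ca] by (simp add: m_comm)
  ultimately show ?thesis
    unfolding cd_def using one_le_cc by (simp add: vee_wedge_distrib2 le_lattice)
qed

lemma cd_le_cd_cd: "cd \<preceq> cd \<otimes> cd"
  by (simp add: square_increasing)

lemma cc_cd: "cc \<otimes> cd = cd \<otimes> cd" "cd \<otimes> cc = cd \<otimes> cd"
proof -
  have "cc \<otimes> cd = (\<one> \<^bold>\<or> cd) \<otimes> cd"
    by (simp add: one_vee_cd)
  also have "\<dots> = cd \<otimes> cd"
    using le_lattice[OF cd_le_cd_cd] by (simp add: vee_mult_distrib)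
  finally show "cc \<otimes> cd = cd \<otimes> cd" .
  then show "cd \<otimes> cc = cd \<otimes> cd"
    by (simp add: m_comm)
qed

text \<open>If the square is above \<open>\<one>\<close>, it is above
  \<open>\<one> \<or> cd = cc\<close>; otherwise it is below \<open>f\<close> and \<open>cc\<close>,
  hence below \<open>cd\<close>. This is the first of the three yes-no questions.\<close>

lemma cd_cd_cases: "cd \<otimes> cd = cd \<or> cd \<otimes> cd = cc"
proof -
  have le: "cd \<otimes> cd \<preceq> cc"
    using mult_mono[OF cd_le(1) cd_le(1)] cc_idem by simp
  show ?thesis
  proof (cases "\<one> \<preceq> cd \<otimes> cd")
    case True
    then have "\<one> \<^bold>\<or> cd \<preceq> cd \<otimes> cd"
      using cd_le_cd_cd by (simp add: vee_le_iff)
    then show ?thesis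
      using le le_antisym by (simp add: one_vee_cd)
  next
    case False
    then have "cd \<otimes> cd \<preceq> cd"
      using le by (subst cd_def) (simp add: le_wedge_iff le_f_iff')
    then show ?thesis
      using cd_le_cd_cd le_antisym by simp
  qed
qed

lemma neg_cc_le_f: "\<^bold>\<not> cc \<preceq> \<f>"
  using one_le_cc by (simp add: le_f_iff)

lemma cg_le: "cg \<preceq> cc" "cg \<preceq> \<^bold>\<not> cc" "cg \<preceq> cd" "ca \<preceq> cg" "cg \<preceq> \<f>"
proof -
  show 1: "cg \<preceq> cc" "cg \<preceq> \<^bold>\<not> cc"
    by (simp_all add: cg_def)
  then show 2: "cg \<preceq> \<f>"
    using le_trans[OF _ neg_cc_le_f, of cg] by simp
  show "cg \<preceq> cd"
    using 1 2 by (simp add: cd_def le_wedge_iff)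
  show "ca \<preceq> cg"
    using ca_le_cc ca_cc ca_le mult_le_f_iff[of ca cc] by (simp add: cg_def le_wedge_iff)
qed

lemma cg_cc: "cg \<otimes> cc = cg"
proof (rule le_antisym)
  have le: "cg \<otimes> cc \<preceq> cc"
    using mult_mono[OF cg_le(1), of cc cc] cc_idem by simp
  have "(cg \<otimes> cc) \<otimes> cc = cg \<otimes> cc"
    using cc_idem by (simp add: m_assoc)
  then have "(cg \<otimes> cc) \<otimes> cc \<preceq> \<f>"
    using cg_le(2) mult_le_f_iff[of cg cc] by simp
  then show "cg \<otimes> cc \<preceq> cg"
    using le mult_le_f_iff[of "cg \<otimes> cc" cc] by (subst (2) cg_def) (simp add: le_wedge_iff)
  have "cg \<otimes> \<one> \<preceq> cg \<otimes> cc"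
    using one_le_cc by (intro mult_mono) simp_all
  then show "cg \<preceq> cg \<otimes> cc"
    by simp
qed simp_all

lemma cg_mult: "\<lbrakk>cg \<preceq> x; x \<preceq> cc; x \<in> carrier A\<rbrakk> \<Longrightarrow> cg \<otimes> x = cg"
  using mult_mono[of cg cg x cc] mult_mono[of cg cg cg x] cg_cc square_increasing[of cg]
    le_trans[of cg "cg \<otimes> cg" "cg \<otimes> x"] by (intro le_antisym) simp_all

lemma ck_le: "\<one> \<preceq> ck" "cg \<preceq> ck" "ck \<preceq> cc" "ca \<preceq> ck"
  using one_le_cc cg_le le_trans[of ca \<one> ck] ca_le by (simp_all add: ck_def vee_le_iff)

lemma ck_mult:
  assumes "cg \<preceq> x" "x \<preceq> cc" "x \<in> carrier A"
  shows "ck \<otimes> x = x"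
  using assms cg_mult[OF assms] le_lattice[OF assms(1)] by (simp add: ck_def vee_mult_distrib)

lemma one_wedge_cd: "\<one> \<^bold>\<and> cd = ca" "\<one> \<^bold>\<and> cg = ca"
proof -
  show "\<one> \<^bold>\<and> cd = ca"
  proof (rule le_antisym)
    show "\<one> \<^bold>\<and> cd \<preceq> ca"
      using le_trans[of "\<one> \<^bold>\<and> cd" cd \<f>] cd_le by (intro le_ca) simp_all
  qed (use cd_le ca_le in \<open>simp_all add: le_wedge_iff\<close>)
  show "\<one> \<^bold>\<and> cg = ca"
  proof (rule le_antisym)
    show "\<one> \<^bold>\<and> cg \<preceq> ca"
      using le_trans[of "\<one> \<^bold>\<and> cg" cg \<f>] cg_le by (intro le_ca) simp_all
  qed (use cg_le ca_le in \<open>simp_all add: le_wedge_iff\<close>)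
qed

lemma cd_wedge_ck: "cd \<^bold>\<and> ck = cg"
  using one_wedge_cd(1) cg_le by (simp add: ck_def wedge_vee_distrib wedge_comm[of cd \<one>] le_lattice)

text \<open>The meet \<open>l\<close> satisfies
  \<open>l \<preceq> l \<otimes> l \<preceq> l \<otimes> cd\<close>, so multiplying it by
  \<open>cc = \<one> \<or> cd\<close> gives \<open>l \<otimes> cd\<close>, which is below
  \<open>f\<close>. Thus \<open>l \<preceq> \<not>cc\<close>.\<close>

lemma cd_wedge_neg_cd: "cd \<^bold>\<and> \<^bold>\<not> cd = cg"
proof (rule le_antisym)
  let ?l = "cd \<^bold>\<and> \<^bold>\<not> cd"
  have "?l \<preceq> ?l \<otimes> ?l" "?l \<otimes> ?l \<preceq> ?l \<otimes> cd"
    by (simp_all add: square_increasing mult_mono)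
  then have l: "?l \<preceq> ?l \<otimes> cd"
    using le_trans by (meson c_closed m_closed neg_closed wedge_closed)
  have "?l \<otimes> cc = ?l \<otimes> (\<one> \<^bold>\<or> cd)"
    by (simp add: one_vee_cd)
  also have "\<dots> = ?l \<otimes> cd"
    using le_lattice[OF l] by (simp add: mult_vee_distrib)
  finally have "?l \<otimes> cc \<preceq> \<f>"
    using mult_le_f_iff[of ?l cd] by simp
  then have "?l \<preceq> \<^bold>\<not> cc"
    by (simp add: mult_le_f_iff)
  moreover have "?l \<preceq> cc"
    using le_trans[of ?l cd cc] cd_le by simp
  ultimately show "?l \<preceq> cg"
    by (simp add: cg_def le_wedge_iff)
  have "cg \<preceq> \<^bold>\<not> cd"
    using cg_mult[of cd] cg_le cd_le mult_le_f_iff[of cg cd] by simp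
  then show "cg \<preceq> ?l"
    using cg_le by (simp add: le_wedge_iff)
qed simp_all

text \<open>In the third equation \<open>cc = \<one> \<or> cd\<close> splits the meet into
  \<open>\<one>\<close> and \<open>cd \<and> \<not>cd = cg\<close>, with join
  \<open>ck\<close>.\<close>

lemma cc_wedge_neg: "cc \<^bold>\<and> \<^bold>\<not> ca = cc" "cc \<^bold>\<and> \<^bold>\<not> cg = cc" "cc \<^bold>\<and> \<^bold>\<not> cd = ck" "cc \<^bold>\<and> \<^bold>\<not> ck = cd"
proof -
  have "cc \<preceq> \<^bold>\<not> ca" "cc \<preceq> \<^bold>\<not> cg"
    using ca_cc ca_le cg_cc cg_le mult_le_f_iff[of cc ca] mult_le_f_iff[of cc cg] by (simp_all add: m_comm)
  then show ag: "cc \<^bold>\<and> \<^bold>\<not> ca = cc" "cc \<^bold>\<and> \<^bold>\<not> cg = cc"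
    by (simp_all add: le_lattice)
  have "\<one> \<preceq> \<^bold>\<not> cd"
    using cd_le by (simp add: le_f_iff)
  then have 1: "\<one> \<^bold>\<and> (cc \<^bold>\<and> \<^bold>\<not> cd) = \<one>"
    using one_le_cc irl_le_def[of A \<one> "cc \<^bold>\<and> \<^bold>\<not> cd"] by (simp add: le_wedge_iff)
  have 2: "cd \<^bold>\<and> (cc \<^bold>\<and> \<^bold>\<not> cd) = cg"
    using cd_wedge_neg_cd le_lattice[OF cd_le(1)] by (simp add: wedge_assoc[symmetric])
  have "cc \<^bold>\<and> \<^bold>\<not> cd = cc \<^bold>\<and> (cc \<^bold>\<and> \<^bold>\<not> cd)"
    by (simp add: wedge_assoc[symmetric])
  also have "\<dots> = (\<one> \<^bold>\<or> cd) \<^bold>\<and> (cc \<^bold>\<and> \<^bold>\<not> cd)"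
    by (simp add: one_vee_cd)
  also have "\<dots> = ck"
    using 1 2 by (simp add: vee_wedge_distrib ck_def)
  finally show "cc \<^bold>\<and> \<^bold>\<not> cd = ck" .
  have "cc \<^bold>\<and> \<^bold>\<not> ck = (cc \<^bold>\<and> \<^bold>\<not> cg) \<^bold>\<and> \<f>"
    by (simp add: ck_def neg_vee wedge_comm[of \<f>] wedge_assoc)
  then show "cc \<^bold>\<and> \<^bold>\<not> ck = cd"
    using ag by (simp add: cd_def)
qed

lemma imp_cc: "\<lbrakk>ca \<preceq> x; x \<preceq> cc; x \<in> carrier A\<rbrakk> \<Longrightarrow> x \<^bold>\<rightarrow> cc = cc"
  using ca_mult[of x] imp_imp[of x ca \<one>] by (simp add: m_comm flip: cc_def)

text \<open>Reduces residuals to products: among the six elements all but \<open>ca\<close> and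
  \<open>\<one>\<close> have the form \<open>cc \<and> \<not>y\<close>.\<close>

lemma imp_cc_wedge:
  assumes "ca \<preceq> x" "x \<preceq> cc" "x \<in> carrier A" "y \<in> carrier A"
  shows "x \<^bold>\<rightarrow> (cc \<^bold>\<and> \<^bold>\<not> y) = cc \<^bold>\<and> \<^bold>\<not> (x \<otimes> y)"
proof -
  have "x \<^bold>\<rightarrow> (cc \<^bold>\<and> \<^bold>\<not> y) = (x \<^bold>\<rightarrow> cc) \<^bold>\<and> (x \<^bold>\<rightarrow> \<^bold>\<not> y)"
    using assms by (simp add: irl_imp_def neg_wedge mult_vee_distrib neg_vee)
  then show ?thesis
    using assms by (simp add: imp_cc neg_mult)
qed

lemma ca_le_imp: "\<lbrakk>ca \<preceq> x; x \<preceq> cc; x \<in> carrier A\<rbrakk> \<Longrightarrow> ca \<preceq> x \<^bold>\<rightarrow> ca \<and> ca \<preceq> x \<^bold>\<rightarrow> \<one>"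
  using ca_mult[of x] ca_le by (simp flip: mult_le_iff)

lemma ca_imp: 
  assumes "ca \<preceq> y" "y \<preceq> cc" "y \<in> carrier A"
  shows "ca \<^bold>\<rightarrow> y = cc"
proof (rule le_antisym)
  have "cc \<otimes> ca \<preceq> y"
    using ca_cc assms by (simp add: m_comm)
  then show "cc \<preceq> ca \<^bold>\<rightarrow> y"
    using assms by (simp add: mult_le_iff)
  have "ca \<otimes> (ca \<^bold>\<rightarrow> y) \<preceq> cc"
    using mult_imp_le[of ca y] assms le_trans[of "ca \<otimes> (ca \<^bold>\<rightarrow> y)" y cc] by simp
  then have "(ca \<^bold>\<rightarrow> y) \<preceq> ca \<^bold>\<rightarrow> cc"
    using assms mult_le_iff[of "ca \<^bold>\<rightarrow> y" ca cc] by (simp add: m_comm)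
  then show "(ca \<^bold>\<rightarrow> y) \<preceq> cc"
    using imp_cc[of ca] ca_le_cc by simp
qed (use assms in simp_all)

text \<open>Both \<open>cd\<close> and \<open>cg\<close> qualify as \<open>x\<close> here.\<close>

lemma lower_imp:
  assumes x: "ca \<preceq> x" "x \<preceq> cc" "x \<preceq> \<f>" "x \<noteq> ca" "x \<in> carrier A"
    and absorb: "\<And>y. \<lbrakk>y \<in> carrier A; y \<preceq> cc; y \<preceq> \<f>; y \<otimes> x \<preceq> \<one>\<rbrakk> \<Longrightarrow> y \<preceq> x"
  shows "x \<^bold>\<rightarrow> \<one> = ca" "x \<^bold>\<rightarrow> ca = ca"
proof -
  let ?y = "x \<^bold>\<rightarrow> \<one>"
  have yx: "?y \<otimes> x \<preceq> \<one>"
    using mult_imp_le[of x \<one>] x by (simp add: m_comm)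
  \<comment> \<open>Being below \<open>f\<close>, an \<open>x\<close> below \<open>\<one>\<close>
    would be at most \<open>ca\<close>.\<close>
  have "\<not> x \<preceq> \<one>"
    using le_ca[of x] le_antisym[of x ca] x by auto
  then have y: "?y \<preceq> \<f>"
    using x by (simp add: le_f_iff' one_le_imp_iff)
  have "?y \<otimes> x \<preceq> cc"
    using yx one_le_cc x le_trans[of "?y \<otimes> x" \<one> cc] by simp
  then have "?y \<preceq> x \<^bold>\<rightarrow> cc"
    using x by (simp add: mult_le_iff)
  then have "?y \<preceq> cc"
    using imp_cc x by simp
  then have yx': "?y \<preceq> x"
    using absorb y yx x by simp
  \<comment> \<open>Otherwise \<open>x\<close> would be invertible, hence above
    \<open>\<one>\<close>, although it is below \<open>f\<close>.\<close>
  have "?y \<otimes> x \<noteq> \<one>"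
    using invertible_one_le[of x ?y] x le_f_iff' by (auto simp: m_comm)
  then have "\<not> \<one> \<preceq> ?y \<otimes> x"
    using yx le_antisym[of "?y \<otimes> x" \<one>] x by auto
  then have "?y \<otimes> x \<preceq> ca"
    using yx x by (intro le_ca) (simp_all add: le_f_iff')
  moreover have "?y \<preceq> ?y \<otimes> x"
    using le_trans[of ?y "?y \<otimes> ?y" "?y \<otimes> x"] square_increasing[of ?y] mult_mono[of ?y ?y ?y x] yx' x
    by simp
  ultimately have "?y \<preceq> ca"
    using le_trans[of ?y "?y \<otimes> x" ca] x by simp
  then show e: "?y = ca"
    using ca_le_imp[of x] x by (intro le_antisym) simp_all
  have "x \<otimes> (x \<^bold>\<rightarrow> ca) \<preceq> \<one>"
    using mult_imp_le[of x ca] ca_le x le_trans[of "x \<otimes> (x \<^bold>\<rightarrow> ca)" ca \<one>] by simp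
  then have "(x \<^bold>\<rightarrow> ca) \<preceq> ca"
    using e x mult_le_iff[of "x \<^bold>\<rightarrow> ca" x \<one>] by (simp add: m_comm)
  then show "x \<^bold>\<rightarrow> ca = ca"
    using ca_le_imp[of x] x by (intro le_antisym) simp_all
qed

lemma cd_imp: "cd \<noteq> ca \<Longrightarrow> cd \<^bold>\<rightarrow> \<one> = ca \<and> cd \<^bold>\<rightarrow> ca = ca"
  using lower_imp[of cd] cd_le by (simp add: cd_def le_wedge_iff)

lemma cg_imp: "cg \<noteq> ca \<Longrightarrow> cg \<^bold>\<rightarrow> \<one> = ca \<and> cg \<^bold>\<rightarrow> ca = ca"
proof -
  assume ne: "cg \<noteq> ca"
  have "y \<preceq> cg" if y: "y \<in> carrier A" "y \<preceq> cc" "y \<preceq> \<f>" "y \<otimes> cg \<preceq> \<one>" for y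
  proof -
    have ne1: "cg \<noteq> \<one>" "\<not> cg \<preceq> \<one>"
      using cg_le ne le_ca[of cg] le_antisym[of cg ca] not_one_le_f by auto
    \<comment> \<open>\<open>cg\<close> absorbs \<open>cc\<close>, so the bound on
      \<open>y \<otimes> cg\<close> also holds with \<open>y \<otimes> cc\<close> in place of
      \<open>y\<close>; this yields \<open>y \<otimes> cc \<preceq> f\<close>, that is,
      \<open>y \<preceq> \<not>cc\<close>.\<close>
    have "(y \<otimes> cc) \<otimes> cg = y \<otimes> cg"
      using y cg_cc by (simp add: m_assoc m_comm[of cc cg])
    then have "y \<otimes> cc \<preceq> cg \<^bold>\<rightarrow> \<one>"
      using y mult_le_iff[of "y \<otimes> cc" cg \<one>] by simp
    moreover have "(cg \<^bold>\<rightarrow> \<one>) \<preceq> \<f>"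
      using ne1 by (simp add: le_f_iff' one_le_imp_iff)
    ultimately have "y \<otimes> cc \<preceq> \<f>"
      using y le_trans[of "y \<otimes> cc" "cg \<^bold>\<rightarrow> \<one>" \<f>] by simp
    then show ?thesis
      using y by (simp add: cg_def le_wedge_iff mult_le_f_iff)
  qed
  then show ?thesis
    using lower_imp[of cg] cg_le ne by simp
qed

lemma upper_imp:
  assumes x: "\<one> \<preceq> x" "x \<preceq> cc" "x \<in> carrier A"
  shows "x \<^bold>\<rightarrow> ca = ca" "x \<noteq> \<one> \<Longrightarrow> x \<^bold>\<rightarrow> \<one> = ca"
proof -
  have cx: "ca \<preceq> x"
    using le_trans[OF ca_le(1) x(1)] x by simp
  have le: "(x \<^bold>\<rightarrow> y) \<preceq> y" if "y \<in> carrier A" for y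
    using mult_mono[of \<one> x "x \<^bold>\<rightarrow> y" "x \<^bold>\<rightarrow> y"] mult_imp_le[of x y] x that
      le_trans[of "x \<^bold>\<rightarrow> y" "x \<otimes> (x \<^bold>\<rightarrow> y)" y] by simp
  show "x \<^bold>\<rightarrow> ca = ca"
    using le[of ca] ca_le_imp[OF cx] x by (intro le_antisym) simp_all
  assume "x \<noteq> \<one>"
  then have "\<not> x \<preceq> \<one>"
    using le_antisym[of x \<one>] x by auto
  then have "(x \<^bold>\<rightarrow> \<one>) \<preceq> ca"
    using le[of \<one>] x by (intro le_ca) (simp_all add: le_f_iff' one_le_imp_iff)
  then show "x \<^bold>\<rightarrow> \<one> = ca"
    using ca_le_imp[OF cx] x by (intro le_antisym) simp_all
qed

text \<open>Joining with \<open>\<one>\<close> maps \<open>ca\<close>, \<open>cg\<close>,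
  \<open>cd\<close> to \<open>\<one>\<close>, \<open>ck\<close>, \<open>cc\<close>, and meeting with
  \<open>cd\<close> maps back; so the two chains collapse in the same places.\<close>

lemma ck_eq_one_iff: "ck = \<one> \<longleftrightarrow> cg = ca"
  and cc_eq_one_iff: "cc = \<one> \<longleftrightarrow> cd = ca"
  and cg_eq_cd_iff: "cg = cd \<longleftrightarrow> cd \<otimes> cd = cd"
  and ck_eq_cc_iff: "ck = cc \<longleftrightarrow> cg = cd"
proof -
  have "cg = ca" if "ck = \<one>"
    using one_wedge_cd(2) le_lattice[OF ck_le(2)] that by (simp add: wedge_comm)
  moreover have "ck = \<one>" if "cg = ca"
    using that le_lattice[OF ca_le(1)] by (simp add: ck_def)
  ultimately show "ck = \<one> \<longleftrightarrow> cg = ca"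
    by blast
  have "cd = ca" if "cc = \<one>"
    using that by (simp add: cd_def ca_def)
  moreover have "cc = \<one>" if "cd = ca"
    using that one_vee_cd le_lattice[OF ca_le(1)] by simp
  ultimately show "cc = \<one> \<longleftrightarrow> cd = ca"
    by blast
  have "cg = cd" if "cd \<otimes> cd = cd"
  proof (rule le_antisym)
    have "cd \<preceq> \<^bold>\<not> cc"
      using that cc_cd cd_le mult_le_f_iff[of cd cc] by simp
    then show "cd \<preceq> cg"
      using cd_le by (simp add: cg_def le_wedge_iff)
  qed (simp_all add: cg_le)
  moreover have "cd \<otimes> cd = cd" if "cg = cd"
    using cg_mult[of cd] cg_le cd_le that by simp
  ultimately show "cg = cd \<longleftrightarrow> cd \<otimes> cd = cd"
    by blast
  have "cg = cd" if "ck = cc"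
    using cd_wedge_ck le_lattice[OF cd_le(1)] that by simp
  moreover have "ck = cc" if "cg = cd"
    using that one_vee_cd by (simp add: ck_def)
  ultimately show "ck = cc \<longleftrightarrow> cg = cd"
    by blast
qed

lemma cc_neq_t: "\<not> \<t> \<preceq> cc"
proof
  assume "\<t> \<preceq> cc"
  then have "\<t> \<otimes> ca \<preceq> \<one>"
    by (simp add: mult_le_iff cc_def)
  then show False
    using t_mult[OF _ ca_le(3)] not_f_le_one le_trans[OF f_le_tt] by simp
qed

end

section \<open>Tables for the 0-generated crystalline algebras\<close>

datatype six = PA | PG | PD | PE | PK | PC

text \<open>\<open>TP p\<close> stands for the element \<open>p\<close> of the class of \<open>e\<close> and \<open>TN p\<close> for its negation;
  \<open>T0\<close> and \<open>T1\<close> are the bounds. The tables depend on the truth values \<open>s\<close>, \<open>ga\<close>, \<open>ce\<close> of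
  \<open>cd \<cdot> cd \<noteq> cd\<close>, \<open>cg = ca\<close> and \<open>cc = e\<close>.\<close>

datatype tab = T0 | T1 | TP six | TN six

text \<open>\<open>lev6\<close> and \<open>up6\<close> are the coordinates in the product of a
  three-element and a two-element chain, which makes meet and join coordinatewise.\<close>

primrec lev6 :: "six \<Rightarrow> nat"
  where "lev6 PA = 0" | "lev6 PG = 1" | "lev6 PD = 2" | "lev6 PE = 0" | "lev6 PK = 1" | "lev6 PC = 2"

primrec up6 :: "six \<Rightarrow> bool"
  where "up6 PA = False" | "up6 PG = False" | "up6 PD = False" | "up6 PE = True" | "up6 PK = True" | "up6 PC = True"

definition mk6 :: "nat \<Rightarrow> bool \<Rightarrow> six"
  where "mk6 n u = (if u then (if n = 0 then PE else if n = 1 then PK else PC)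
    else (if n = 0 then PA else if n = 1 then PG else PD))"

definition meet6 :: "six \<Rightarrow> six \<Rightarrow> six"
  where "meet6 p q = mk6 (min (lev6 p) (lev6 q)) (up6 p \<and> up6 q)"

definition join6 :: "six \<Rightarrow> six \<Rightarrow> six"
  where "join6 p q = mk6 (max (lev6 p) (lev6 q)) (up6 p \<or> up6 q)"

definition mul6 :: "bool \<Rightarrow> six \<Rightarrow> six \<Rightarrow> six"
  where "mul6 s p q =
    (if p = PA \<or> q = PA then PA else if p = PG \<or> q = PG then PG
     else if p = PE then q else if q = PE then p else if p = PK then q else if q = PK then p
     else if p = PC \<and> q = PC \<or> s then PC else PD)"

text \<open>\<open>cneg6 p\<close> stands for \<open>cc \<and> \<not>p\<close>.\<close>

primrec cneg6 :: "six \<Rightarrow> six"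
  where "cneg6 PA = PC" | "cneg6 PG = PC" | "cneg6 PD = PK" | "cneg6 PE = PD" | "cneg6 PK = PD" | "cneg6 PC = PG"

text \<open>\<open>PC\<close>, \<open>PD\<close>, \<open>PK\<close>, \<open>PG\<close> are the
  \<open>cneg6\<close> of \<open>PA\<close>, \<open>PE\<close>, \<open>PD\<close>,
  \<open>PC\<close>, so residuals into them are \<open>cneg6\<close> of products. \<open>PE\<close>
  and \<open>PA\<close> are not of this form; residuals into them depend on which elements
  coincide.\<close>

definition imp6 :: "bool \<Rightarrow> bool \<Rightarrow> bool \<Rightarrow> six \<Rightarrow> six \<Rightarrow> six"
  where "imp6 s ga ce p q = (case q of
      PC \<Rightarrow> PC | PD \<Rightarrow> cneg6 p | PG \<Rightarrow> cneg6 (mul6 s p PC) | PK \<Rightarrow> cneg6 (mul6 s p PD)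
    | PE \<Rightarrow> (case p of PA \<Rightarrow> PC | PE \<Rightarrow> PE | PG \<Rightarrow> if ga then PC else PA | PD \<Rightarrow> if ce then PC else PA
        | PK \<Rightarrow> if ga then PE else PA | PC \<Rightarrow> if ce then PE else PA)
    | PA \<Rightarrow> (case p of PA \<Rightarrow> PC | PG \<Rightarrow> if ga then PC else PA | PD \<Rightarrow> if ce then PC else PA | _ \<Rightarrow> PA))"

fun mult_tab :: "bool \<Rightarrow> bool \<Rightarrow> bool \<Rightarrow> tab \<Rightarrow> tab \<Rightarrow> tab"
  where
    "mult_tab s ga ce T0 y = T0"
  | "mult_tab s ga ce x T0 = T0"
  | "mult_tab s ga ce T1 y = T1"
  | "mult_tab s ga ce x T1 = T1"
  | "mult_tab s ga ce (TP p) (TP q) = TP (mul6 s p q)"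
  | "mult_tab s ga ce (TP p) (TN q) = TN (imp6 s ga ce p q)"
  | "mult_tab s ga ce (TN p) (TP q) = TN (imp6 s ga ce q p)"
  | "mult_tab s ga ce (TN p) (TN q) = T1"

primrec neg_tab :: "tab \<Rightarrow> tab"
  where "neg_tab T0 = T1" | "neg_tab T1 = T0" | "neg_tab (TP p) = TN p" | "neg_tab (TN p) = TP p"

fun wedge_tab :: "tab \<Rightarrow> tab \<Rightarrow> tab"
  where
    "wedge_tab T0 y = T0"
  | "wedge_tab x T0 = T0"
  | "wedge_tab T1 y = y"
  | "wedge_tab x T1 = x"
  | "wedge_tab (TP p) (TP q) = TP (meet6 p q)"
  | "wedge_tab (TP p) (TN q) = TP (meet6 p (cneg6 q))"
  | "wedge_tab (TN p) (TP q) = TP (meet6 q (cneg6 p))"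
  | "wedge_tab (TN p) (TN q) = TN (join6 p q)"

text \<open>Only a source of homomorphisms: its names may denote equal elements, and only closure
  under the operations is recorded for it.\<close>

definition tab_alg :: "bool \<Rightarrow> bool \<Rightarrow> bool \<Rightarrow> tab irl_alg"
  where "tab_alg s ga ce = \<lparr>carrier = UNIV, mult = mult_tab s ga ce, one = TP PE, wedge = wedge_tab,
    vee = (\<lambda>x y. neg_tab (wedge_tab (neg_tab x) (neg_tab y))), neg = neg_tab\<rparr>"

lemma sig_algebra_tab_alg: "sig_algebra (tab_alg s ga ce)"
  by (simp add: sig_algebra_def subuniverse_def tab_alg_def)

text \<open>Reduces an isomorphism to a comparison of coincidences among names in one common
  table.\<close>

lemma irl_isomorphic_common_source:
  assumes T: "sig_algebra T" and g: "g \<in> irl_hom T A" "g ` carrier T = carrier A"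
    and h: "h \<in> irl_hom T B" "h ` carrier T = carrier B"
    and ker: "\<And>i j. \<lbrakk>i \<in> carrier T; j \<in> carrier T\<rbrakk> \<Longrightarrow> g i = g j \<longleftrightarrow> h i = h j"
  shows "irl_isomorphic A B"
proof -
  let ?k = "\<lambda>x. h (inv_into (carrier T) g x)"
  have k: "?k (g i) = h i" if i: "i \<in> carrier T" for i
  proof -
    have "inv_into (carrier T) g (g i) \<in> carrier T" "g (inv_into (carrier T) g (g i)) = g i"
      using i by (auto intro: inv_into_into f_inv_into_f)
    then show ?thesis
      using ker i by blast
  qed
  have ball: "(\<forall>y \<in> carrier A. P y) \<longleftrightarrow> (\<forall>i \<in> carrier T. P (g i))" for P
    unfolding g(2)[symmetric] by simp
  have "?k \<in> irl_hom A B"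
    unfolding irl_hom_def Pi_def mem_Collect_eq Ball_def[symmetric] ball
    using irl_homD(2)[OF h(1)]
    by (simp add: k irl_homD(1,3-6)[OF g(1), symmetric] irl_homD(1,3-6)[OF h(1), symmetric] sig_algebraD[OF T])
  moreover have "bij_betw ?k (carrier A) (carrier B)"
    unfolding bij_betw_def
  proof
    show "inj_on ?k (carrier A)"
      unfolding inj_on_def ball using k ker by simp
    have "?k ` carrier A = (\<lambda>i. ?k (g i)) ` carrier T"
      unfolding g(2)[symmetric] by (simp add: image_image)
    also have "\<dots> = h ` carrier T"
      using k by (rule image_cong[OF refl])
    finally show "?k ` carrier A = carrier B"
      using h(2) by simp
  qed
  ultimately show ?thesis
    unfolding irl_isomorphic_iff by blast
qed

context crystalline_dmm
begin

abbreviation "inv_s \<equiv> cd \<otimes> cd \<noteq> cd"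
abbreviation "inv_g \<equiv> cg = ca"
abbreviation "inv_e \<equiv> cc = \<one>"

primrec hom6 :: "six \<Rightarrow> 'a"
  where "hom6 PA = ca" | "hom6 PG = cg" | "hom6 PD = cd" | "hom6 PE = \<one>" | "hom6 PK = ck" | "hom6 PC = cc"

primrec hom_tab :: "tab \<Rightarrow> 'a"
  where "hom_tab T0 = \<z>" | "hom_tab T1 = \<t>" | "hom_tab (TP p) = hom6 p" | "hom_tab (TN p) = \<^bold>\<not> (hom6 p)"

lemma hom6_closed [simp]: "hom6 p \<in> carrier A"
  by (cases p) simp_all

lemma hom_tab_closed [simp]: "hom_tab x \<in> carrier A"
  by (cases x) simp_all

lemma hom6_bounds: "ca \<preceq> hom6 p" "hom6 p \<preceq> cc"
  using ca_le cg_le cd_le ck_le ca_le_cc one_le_cc by (cases p; simp)+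

lemma hom6_wedge: "hom6 p \<^bold>\<and> hom6 q = hom6 (meet6 p q)"
proof -
  have sym: "hom6 q \<^bold>\<and> hom6 p = hom6 p \<^bold>\<and> hom6 q" for p q
    by (simp add: wedge_comm)
  note l = le_lattice(1,2)[OF ca_le(1)] le_lattice(1,2)[OF ck_le(1)] le_lattice(1,2)[OF ck_le(2)]
    le_lattice(1,2)[OF ck_le(3)] le_lattice(1,2)[OF ck_le(4)] le_lattice(1,2)[OF cg_le(1)]
    le_lattice(1,2)[OF cg_le(3)] le_lattice(1,2)[OF cg_le(4)] le_lattice(1,2)[OF cd_le(1)]
    le_lattice(1,2)[OF cd_le(3)] le_lattice(1,2)[OF one_le_cc] le_lattice(1,2)[OF ca_le_cc]
    one_wedge_cd one_wedge_cd[unfolded wedge_comm[OF one_closed c_closed(3)] wedge_comm[OF one_closed c_closed(4)]]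
    cd_wedge_ck wedge_comm[of ck cd]
  show ?thesis
    by (cases p; cases q) (simp_all add: meet6_def mk6_def l)
qed

lemma hom6_vee: "hom6 p \<^bold>\<or> hom6 q = hom6 (join6 p q)"
proof -
  have kd: "cd \<^bold>\<or> ck = cc"
  proof (rule le_antisym)
    have "\<one> \<preceq> cd \<^bold>\<or> ck"
      using le_trans[OF ck_le(1), of "cd \<^bold>\<or> ck"] by simp
    then show "cc \<preceq> cd \<^bold>\<or> ck"
      by (subst one_vee_cd[symmetric]) (simp add: vee_le_iff)
  qed (use cd_le ck_le in \<open>simp_all add: vee_le_iff\<close>)
  note l = le_lattice(3,4)[OF ca_le(1)] le_lattice(3,4)[OF ck_le(1)] le_lattice(3,4)[OF ck_le(2)]
    le_lattice(3,4)[OF ck_le(3)] le_lattice(3,4)[OF ck_le(4)] le_lattice(3,4)[OF cg_le(1)]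
    le_lattice(3,4)[OF cg_le(3)] le_lattice(3,4)[OF cg_le(4)] le_lattice(3,4)[OF cd_le(1)]
    le_lattice(3,4)[OF cd_le(3)] le_lattice(3,4)[OF one_le_cc] le_lattice(3,4)[OF ca_le_cc]
    one_vee_cd one_vee_cd[unfolded vee_comm[OF one_closed c_closed(3)]] ck_def[symmetric]
    ck_def[unfolded vee_comm[OF one_closed c_closed(4)], symmetric] kd vee_comm[of ck cd]
  show ?thesis
    by (cases p; cases q) (simp_all add: join6_def mk6_def l)
qed

lemma hom6_mult: "hom6 p \<otimes> hom6 q = hom6 (mul6 inv_s p q)"
proof -
  note b = hom6_bounds
  have A: "ca \<otimes> hom6 q = ca" "hom6 q \<otimes> ca = ca" for q
    using ca_mult[OF b(1) b(2), of q] by (simp_all add: m_comm)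
  have G: "cg \<otimes> hom6 q = cg" "hom6 q \<otimes> cg = cg" if "q \<in> {PG, PD, PK, PC}" for q
    using cg_mult[of "hom6 q"] b(2)[of q] cg_le ck_le that by (auto simp: m_comm)
  have K: "ck \<otimes> hom6 q = hom6 q" "hom6 q \<otimes> ck = hom6 q" if "q \<in> {PG, PD, PK, PC}" for q
    using ck_mult[of "hom6 q"] b(2)[of q] cg_le ck_le that by (auto simp: m_comm)
  note l = A[of PA, simplified] A[of PG, simplified] A[of PD, simplified] A[of PK, simplified] A[of PC, simplified]
    G[of PG, simplified] G[of PD, simplified] G[of PK, simplified] G[of PC, simplified]
    K[of PD, simplified] K[of PK, simplified] K[of PC, simplified] cc_idem cc_cd
  have dd: "cd \<otimes> cd = (if inv_s then cc else cd)"
    using cd_cd_cases by auto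
  show ?thesis
    by (cases p; cases q) (use dd in \<open>auto simp add: mul6_def l split: if_splits\<close>)
qed

lemma hom6_cneg: "cc \<^bold>\<and> \<^bold>\<not> (hom6 p) = hom6 (cneg6 p)"
  by (cases p) (simp_all add: cc_wedge_neg flip: cd_def cg_def)

lemma hom6_imp: "hom6 p \<^bold>\<rightarrow> hom6 q = hom6 (imp6 inv_s inv_g inv_e p q)"
proof -
  note b = hom6_bounds
  have m: "hom6 p \<^bold>\<rightarrow> hom6 (cneg6 r) = hom6 (cneg6 (mul6 inv_s p r))" for r
    using imp_cc_wedge[OF b(1)[of p] b(2)[of p], of "hom6 r"] by (simp add: hom6_cneg hom6_mult)
  show ?thesis
  proof (cases q)
    case PA
    then show ?thesis
      using ca_imp[of ca] ca_le_cc cg_imp cd_imp cc_eq_one_iff upper_imp(1)[of ck] upper_imp(1)[of cc] ck_le one_le_cc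
      by (cases p) (auto simp: imp6_def)
  next
    case PG
    then show ?thesis
      using m[of PC] by (simp add: imp6_def)
  next
    case PD
    then show ?thesis
      using m[of PE] by (cases p) (simp_all add: imp6_def mul6_def)
  next
    case PE
    then show ?thesis
      using ca_imp[of \<one>] ca_le one_le_cc cg_imp cd_imp cc_eq_one_iff ck_eq_one_iff
        upper_imp(2)[of ck] upper_imp(2)[of cc] ck_le
      by (cases p) (auto simp: imp6_def)
  next
    case PK
    then show ?thesis
      using m[of PD] by (simp add: imp6_def)
  next
    case PC
    then show ?thesis
      using imp_cc[OF b(1) b(2)] by (simp add: imp6_def)
  qed
qed

lemma hom6_mix: "hom6 p \<^bold>\<and> \<^bold>\<not> (hom6 q) = hom6 (meet6 p (cneg6 q))"
proof -
  have "hom6 p \<^bold>\<and> \<^bold>\<not> (hom6 q) = (hom6 p \<^bold>\<and> cc) \<^bold>\<and> \<^bold>\<not> (hom6 q)"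
    using le_lattice[OF hom6_bounds(2)] by simp
  also have "\<dots> = hom6 p \<^bold>\<and> hom6 (cneg6 q)"
    by (simp add: wedge_assoc hom6_cneg)
  finally show ?thesis
    by (simp add: hom6_wedge)
qed

lemma neg_hom6_mult: "\<^bold>\<not> (hom6 p) \<otimes> \<^bold>\<not> (hom6 q) = \<t>"
proof -
  have "\<^bold>\<not> cc \<preceq> \<^bold>\<not> (hom6 p)" for p
    using hom6_bounds(2)[of p] by (simp add: neg_le_neg_iff)
  then show ?thesis
    using mult_mono[of "\<^bold>\<not> cc" "\<^bold>\<not> (hom6 p)" "\<^bold>\<not> cc" "\<^bold>\<not> (hom6 q)"] neg_cc_mult t_le_iff by simp
qed

text \<open>For the third claim: the square of \<open>\<not>(hom6 q)\<close> is the top, whereas the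
  square of \<open>hom6 p\<close> stays in the class of \<open>\<one>\<close>, which does not
  contain the top.\<close>

lemma hom6_neq: "hom6 p \<noteq> \<z>" "hom6 p \<noteq> \<t>" "hom6 p \<noteq> \<^bold>\<not> (hom6 q)"
proof -
  show "hom6 p \<noteq> \<z>"
    using hom6_bounds(1)[of p] ca_le(3) le_z_iff[of ca] by auto
  show t: "hom6 p \<noteq> \<t>" for p
    using hom6_bounds(2)[of p] cc_neq_t by auto
  show "hom6 p \<noteq> \<^bold>\<not> (hom6 q)"
    using neg_hom6_mult[of q q] t[of "mul6 inv_s p p"] hom6_mult[of p p] by auto
qed

lemma hom_tab_neg: "hom_tab (neg_tab x) = \<^bold>\<not> (hom_tab x)"
  by (cases x) simp_all

lemma hom_tab_wedge: "hom_tab (wedge_tab x y) = hom_tab x \<^bold>\<and> hom_tab y"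
  by (cases x; cases y)
    (simp_all add: t_lattice hom6_wedge hom6_mix wedge_comm[of "\<^bold>\<not> (hom6 p)" "hom6 q" for p q]
      neg_vee[symmetric] hom6_vee)

lemma hom_tab_mult: "hom_tab (mult_tab inv_s inv_g inv_e x y) = hom_tab x \<otimes> hom_tab y"
proof -
  have 1: "hom6 p \<otimes> \<^bold>\<not> (hom6 q) = \<^bold>\<not> (hom6 (imp6 inv_s inv_g inv_e p q))" for p q
    using neg_imp[of "hom6 p" "hom6 q"] by (simp add: hom6_imp)
  have 2: "\<^bold>\<not> (hom6 q) \<otimes> hom6 p = \<^bold>\<not> (hom6 (imp6 inv_s inv_g inv_e p q))" for p q
    using 1[of p q] by (simp add: m_comm)
  have 3: "\<^bold>\<not> (hom6 q) \<noteq> \<z>" for q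
    using hom6_neq(2)[of q] neg_eq_z_iff by simp
  show ?thesis
    using constants_distinct
    by (cases x; cases y) (simp_all add: hom6_mult 1 2 3 t_mult hom6_neq neg_hom6_mult)
qed

lemma hom_tab_hom: "hom_tab \<in> irl_hom (tab_alg inv_s inv_g inv_e) A"
proof -
  have "hom_tab (neg_tab (wedge_tab (neg_tab x) (neg_tab y))) = hom_tab x \<^bold>\<or> hom_tab y" for x y
    by (simp add: hom_tab_neg hom_tab_wedge neg_wedge)
  then show ?thesis
    unfolding irl_hom_def by (simp add: tab_alg_def hom_tab_mult hom_tab_wedge hom_tab_neg)
qed

lemma hom_tab_surj: "n_generated 0 A \<Longrightarrow> range hom_tab = carrier A"
  using subuniverse_hom_image[OF hom_tab_hom sig_algebra_tab_alg]
  by (auto simp: n_generated_def tab_alg_def)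

definition ker6 :: "bool \<Rightarrow> bool \<Rightarrow> bool \<Rightarrow> six \<Rightarrow> six \<Rightarrow> bool"
  where "ker6 s ga ce p q \<longleftrightarrow> up6 p = up6 q \<and>
    (let i = min (lev6 p) (lev6 q); j = max (lev6 p) (lev6 q)
     in i = j \<or> (i = 0 \<and> j = 1 \<and> ga) \<or> (i = 1 \<and> j = 2 \<and> \<not> s) \<or> (i = 0 \<and> j = 2 \<and> ce))"

lemma hom6_eq_iff: "hom6 p = hom6 q \<longleftrightarrow> ker6 inv_s inv_g inv_e p q"
proof -
  define S G E where SGE: "S = inv_s" "G = inv_g" "E = inv_e"
  have eq: "ck = cc \<longleftrightarrow> \<not> S" "cg = cd \<longleftrightarrow> \<not> S" "ck = \<one> \<longleftrightarrow> G" "cg = ca \<longleftrightarrow> G" "cc = \<one> \<longleftrightarrow> E" "cd = ca \<longleftrightarrow> E"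
    by (simp_all only: SGE ck_eq_one_iff cc_eq_one_iff cg_eq_cd_iff ck_eq_cc_iff not_not)
  note eqs = eq trans[OF eq_commute eq(1)] trans[OF eq_commute eq(2)] trans[OF eq_commute eq(3)] trans[OF eq_commute eq(4)] trans[OF eq_commute eq(5)] trans[OF eq_commute eq(6)]
  have "\<not> hom6 p \<preceq> \<f>" if "up6 p" for p
    using that ck_le one_le_cc not_one_le_f by (cases p) (simp_all add: le_f_iff')
  moreover have "hom6 p \<preceq> \<f>" if "\<not> up6 p" for p
    using that ca_le cg_le cd_le by (cases p) simp_all
  ultimately have up: "up6 p = up6 q" if "hom6 p = hom6 q"
    using that by metis
  show ?thesis
    unfolding SGE[symmetric]
  proof (cases "up6 p = up6 q")
    case True
    then show "hom6 p = hom6 q \<longleftrightarrow> ker6 S G E p q"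
      by (cases p; cases q) (simp_all add: eqs ker6_def)
  next
    case False
    then show "hom6 p = hom6 q \<longleftrightarrow> ker6 S G E p q"
      using up by (auto simp: ker6_def)
  qed
qed

lemma hom_tab_eq_iff: "hom_tab x = hom_tab y \<longleftrightarrow> (case (x, y) of
    (T0, T0) \<Rightarrow> True | (T1, T1) \<Rightarrow> True
  | (TP p, TP q) \<Rightarrow> ker6 inv_s inv_g inv_e p q | (TN p, TN q) \<Rightarrow> ker6 inv_s inv_g inv_e p q | _ \<Rightarrow> False)"
proof -
  have n: "\<^bold>\<not> (hom6 q) \<noteq> \<z>" "\<^bold>\<not> (hom6 q) \<noteq> \<t>" for q
    using hom6_neq[of q] neg_eq_z_iff neg_eq_t_iff by simp_all
  show ?thesis
    using constants_distinct hom6_neq n hom6_neq[THEN not_sym] n[THEN not_sym]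
    by (cases x; cases y) (simp_all add: hom6_eq_iff neg_inject)
qed

text \<open>If \<open>cd\<close> is idempotent, then \<open>cg = cd\<close>, so the other two
  answers agree. If not, then \<open>cd\<close> differs from the idempotent \<open>ca\<close>, so
  \<open>cc\<close> is not \<open>\<one>\<close>. In the listed order the 0-generated algebras have
  6, 10, 10 and 14 elements.\<close>

lemma inv_cases: "(inv_s, inv_g, inv_e) \<in> {(False, True, True), (False, False, False), (True, True, False), (True, False, False)}"
  using cc_eq_one_iff cg_eq_cd_iff ca_idem by auto

end

definition crystalline_type :: "('a, 'm) irl_alg_scheme \<Rightarrow> bool \<times> bool \<times> bool"
  where "crystalline_type A =
    (crystalline_dmm.cd A \<otimes>\<^bsub>A\<^esub> crystalline_dmm.cd A \<noteq> crystalline_dmm.cd A,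
     crystalline_dmm.cg A = crystalline_dmm.ca A, crystalline_dmm.cc A = \<one>\<^bsub>A\<^esub>)"

lemma crystalline_isomorphic:
  assumes A: "crystalline_dmm A" "n_generated 0 A" and B: "crystalline_dmm B" "n_generated 0 B"
    and type: "crystalline_type A = crystalline_type B"
  shows "irl_isomorphic A B"
proof -
  interpret A: crystalline_dmm A by fact
  interpret B: crystalline_dmm B by fact
  have s: "A.inv_s = B.inv_s" and g: "A.inv_g = B.inv_g" and e: "A.inv_e = B.inv_e"
    using type unfolding crystalline_type_def prod.inject by blast+
  show ?thesis
  proof (rule irl_isomorphic_common_source[OF sig_algebra_tab_alg A.hom_tab_hom])
    show "A.hom_tab ` carrier (tab_alg A.inv_s A.inv_g A.inv_e) = carrier A"
      using A.hom_tab_surj[OF A(2)] by (simp add: tab_alg_def)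
    show "B.hom_tab \<in> irl_hom (tab_alg A.inv_s A.inv_g A.inv_e) B"
      unfolding s g e by (rule B.hom_tab_hom)
    show "B.hom_tab ` carrier (tab_alg A.inv_s A.inv_g A.inv_e) = carrier B"
      using B.hom_tab_surj[OF B(2)] by (simp add: tab_alg_def)
    show "A.hom_tab i = A.hom_tab j \<longleftrightarrow> B.hom_tab i = B.hom_tab j" for i j
      unfolding A.hom_tab_eq_iff B.hom_tab_eq_iff s g e ..
  qed
qed

lemma crystalline_type_cases:
  "crystalline_dmm A \<Longrightarrow> crystalline_type A
    \<in> {(False, True, True), (False, False, False), (True, True, False), (True, False, False)}"
  unfolding crystalline_type_def by (rule crystalline_dmm.inv_cases)

text \<open>By counting: pairwise non-isomorphic algebras have different types, so the four
  \<open>C n\<close> use up the four possible types, that of \<open>D\<close> included.\<close>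

lemma crystalline_isomorphic_one_of_four:
  fixes C :: "nat \<Rightarrow> 'u irl_alg" and D :: "('a, 'm) irl_alg_scheme"
  assumes C: "\<And>n. n \<in> {5, 6, 7, 8} \<Longrightarrow> crystalline_dmm (C n) \<and> n_generated 0 (C n)"
    and noniso: "\<And>m n. \<lbrakk>m \<in> {5, 6, 7, 8}; n \<in> {5, 6, 7, 8}; m \<noteq> n\<rbrakk> \<Longrightarrow> \<not> irl_isomorphic (C m) (C n)"
    and D: "crystalline_dmm D" "n_generated 0 D"
  shows "\<exists>n \<in> {5, 6, 7, 8}. irl_isomorphic D (C n)"
proof -
  let ?S = "{5, 6, 7, 8 :: nat}"
  let ?T = "{(False, True, True), (False, False, False), (True, True, False), (True, False, False)}"
  let ?t = "\<lambda>n. crystalline_type (C n)"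
  have inj: "inj_on ?t ?S"
  proof (rule inj_onI, rule ccontr)
    fix m n assume mn: "m \<in> ?S" "n \<in> ?S" "?t m = ?t n" "m \<noteq> n"
    then show False
      using crystalline_isomorphic[of "C m" "C n"] C[OF mn(1)] C[OF mn(2)] noniso[OF mn(1,2,4)] by blast
  qed
  have "?t ` ?S \<subseteq> ?T"
    using C crystalline_type_cases by blast
  moreover have "card (?t ` ?S) = card ?T"
    using card_image[OF inj] by simp
  ultimately have "?t ` ?S = ?T"
    by (intro card_subset_eq) simp_all
  then have "crystalline_type D \<in> ?t ` ?S"
    using crystalline_type_cases[OF D(1)] by simp
  then obtain n where n: "n \<in> ?S" "crystalline_type D = ?t n"
    by (rule imageE)
  then have "irl_isomorphic D (C n)"
    using C[OF n(1)] D by (intro crystalline_isomorphic) blast+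
  then show ?thesis
    using n(1) by blast
qed

section \<open>Equations separating the small algebras\<close>

lemma le_update_carrier [simp]:
  "x \<preceq>\<^bsub>A\<lparr>carrier := S\<rparr>\<^esub> y \<longleftrightarrow> x \<preceq>\<^bsub>A\<^esub> y" "irl_f (A\<lparr>carrier := S\<rparr>) = irl_f A"
  "irl_zero (A\<lparr>carrier := S\<rparr>) = irl_zero A" "x \<^bold>\<rightarrow>\<^bsub>A\<lparr>carrier := S\<rparr>\<^esub> y = x \<^bold>\<rightarrow>\<^bsub>A\<^esub> y"
  by (simp_all add: irl_le_def irl_f_def irl_zero_def irl_imp_def)

lemma (in prime_dmm) prime_dmm_subuniverse:
  assumes S: "subuniverse A S"
  shows "prime_dmm (A\<lparr>carrier := S\<rparr>)"
proof (intro prime_dmm.intro prime_dmm_axioms.intro)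
  show "de_morgan_monoid (A\<lparr>carrier := S\<rparr>)"
    using de_morgan_monoid_th_le[OF de_morgan_monoid_axioms sig_algebra_subuniverse[OF S]
        th_le_subuniverse[OF S]] .
  have "S \<subseteq> carrier A"
    using S by (simp add: subuniverse_def)
  then show "\<one>\<^bsub>A\<lparr>carrier := S\<rparr>\<^esub> \<preceq>\<^bsub>A\<lparr>carrier := S\<rparr>\<^esub> x \<or> \<one>\<^bsub>A\<lparr>carrier := S\<rparr>\<^esub> \<preceq>\<^bsub>A\<lparr>carrier := S\<rparr>\<^esub> y"
    if "x \<in> carrier (A\<lparr>carrier := S\<rparr>)" "y \<in> carrier (A\<lparr>carrier := S\<rparr>)"
      "\<one>\<^bsub>A\<lparr>carrier := S\<rparr>\<^esub> \<preceq>\<^bsub>A\<lparr>carrier := S\<rparr>\<^esub> x \<^bold>\<or>\<^bsub>A\<lparr>carrier := S\<rparr>\<^esub> y" for x y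
    using that one_prime[of x y] by auto
qed

lemma (in bounded_prime_dmm) bounded_prime_dmm_subuniverse:
  assumes S: "subuniverse A S"
  shows "bounded_prime_dmm (A\<lparr>carrier := S\<rparr>)"
proof (intro bounded_prime_dmm.intro bounded_prime_dmm_axioms.intro)
  show "prime_dmm (A\<lparr>carrier := S\<rparr>)"
    using S by (rule prime_dmm_subuniverse)
qed (use S le_t not_f_le_one in \<open>auto simp: subuniverse_def\<close>)

lemma (in crystalline_dmm) crystalline_dmm_subuniverse:
  assumes S: "subuniverse A S"
  shows "crystalline_dmm (A\<lparr>carrier := S\<rparr>)"
  by (intro crystalline_dmm.intro crystalline_dmm_axioms.intro bounded_prime_dmm_subuniverse[OF S])
    (use not_one_le_f one_wedge_f in simp_all)

lemma (in prime_dmm) bounded_interval: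
  assumes f: "\<not> \<f> \<preceq> \<one>"
  shows "\<exists>S. subuniverse A S \<and> bounded_prime_dmm (A\<lparr>carrier := S\<rparr>)"
proof (intro exI conjI)
  let ?S = "{x \<in> carrier A. \<z> \<preceq> x \<and> x \<preceq> \<t>}"
  show S: "subuniverse A ?S"
    using one_le_t[OF f] by (rule subuniverse_interval)
  show "bounded_prime_dmm (A\<lparr>carrier := ?S\<rparr>)"
    by (intro bounded_prime_dmm.intro bounded_prime_dmm_axioms.intro prime_dmm_subuniverse[OF S])
      (use f in auto)
qed

lemma satisfies_eq_trivial:
  assumes "sig_algebra B" "\<not> nontrivial B"
  shows "satisfies_eq B \<epsilon>"
  unfolding satisfies_eq_def
  using eval_term_closed[OF assms(1)] assms(2) unfolding nontrivial_def by blast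

text \<open>If \<open>\<one> \<preceq> x \<or> y\<close>, then \<open>\<one>\<close> is the join of
  \<open>\<one> \<and> x\<close> and \<open>\<one> \<and> y\<close>, so the congruences of their
  principal filters intersect in the identity. One of them is then the identity, which puts
  \<open>x\<close> or \<open>y\<close> above \<open>\<one>\<close>.\<close>

lemma (in de_morgan_monoid) fsi_prime:
  assumes fsi: "fsi A"
  shows "prime_dmm A"
proof (intro prime_dmm.intro prime_dmm_axioms.intro de_morgan_monoid_axioms)
  fix x y assume xy: "x \<in> carrier A" "y \<in> carrier A" "\<one> \<preceq> x \<^bold>\<or> y"
  let ?F = "\<lambda>x. {u \<in> carrier A. \<one> \<^bold>\<and> x \<preceq> u}"
  let ?T = "\<lambda>x. filter_congruence A (?F x)"
  have F: "deductive_filter A (?F u)" if "u \<in> carrier A" for u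
    using that by (intro deductive_filter_principal) simp_all
  have cov: "(\<one> \<^bold>\<and> x) \<^bold>\<or> (\<one> \<^bold>\<and> y) = \<one>"
    using xy by (simp add: wedge_vee_distrib[symmetric] le_lattice)
  have "u = v" if uv: "(u, v) \<in> ?T x \<inter> ?T y" for u v
  proof -
    obtain g h where g: "g \<in> carrier A" "\<one> \<^bold>\<and> x \<preceq> g" "g \<otimes> u \<preceq> v" "g \<otimes> v \<preceq> u"
      and h: "h \<in> carrier A" "\<one> \<^bold>\<and> y \<preceq> h" "h \<otimes> u \<preceq> v" "h \<otimes> v \<preceq> u"
      and c: "u \<in> carrier A" "v \<in> carrier A"
      using uv by (auto simp: filter_congruence_def)
    have le: "b \<preceq> b'" if b: "b \<in> carrier A" "b' \<in> carrier A" "g \<otimes> b \<preceq> b'" "h \<otimes> b \<preceq> b'" for b b'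
    proof -
      have "(\<one> \<^bold>\<and> x) \<otimes> b \<preceq> b'" "(\<one> \<^bold>\<and> y) \<otimes> b \<preceq> b'"
        using le_trans[OF mult_mono_left[OF g(2), of b] b(3)] le_trans[OF mult_mono_left[OF h(2), of b] b(4)]
          b g h xy by simp_all
      then have "((\<one> \<^bold>\<and> x) \<^bold>\<or> (\<one> \<^bold>\<and> y)) \<otimes> b \<preceq> b'"
        using b xy by (simp add: vee_mult_distrib vee_le_iff)
      then show ?thesis
        using cov b by simp
    qed
    show ?thesis
      using le[of u v] le[of v u] g h c by (intro le_antisym) simp_all
  qed
  moreover have "Id_on (carrier A) \<subseteq> ?T x \<inter> ?T y"
    using congruence_filter_congruence[OF F] xy by (auto simp: congruence_def equiv_def refl_on_def)
  ultimately have "?T x \<inter> ?T y = Id_on (carrier A)"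
    by (auto simp: filter_congruence_def)
  then have "?T x = Id_on (carrier A) \<or> ?T y = Id_on (carrier A)"
    using fsi congruence_filter_congruence[OF F] xy unfolding fsi_def by blast
  moreover have "\<one> \<preceq> u" if "?T u = Id_on (carrier A)" "u \<in> carrier A" for u
  proof -
    have "(\<one> \<^bold>\<and> u, \<one>) \<in> Id_on (carrier A)"
      using filter_congruence_one_iff[OF F[OF that(2)] that(2)] that by simp
    then show ?thesis
      by (auto simp: irl_le_def)
  qed
  ultimately show "\<one> \<preceq> x \<or> \<one> \<preceq> y"
    using xy by blast
qed

lemma zero_generated_embeds:
  assumes "n_generated 0 A" "embeds B A" "sig_algebra B"
  shows "irl_isomorphic A B"
proof -
  obtain h where h: "h \<in> irl_hom B A" "inj_on h (carrier B)"
    using assms(2) by (auto simp: embeds_def)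
  have "h ` carrier B = carrier A"
    using assms(1) subuniverse_hom_image[OF h(1) assms(3)] by (auto simp: n_generated_def)
  then have "irl_isomorphic B A"
    using h unfolding irl_isomorphic_iff bij_betw_def by blast
  then show ?thesis
    using assms(3) by (rule irl_isomorphic_sym[rotated])
qed

lemma sig_algebra_concrete:
  "sig_algebra alg_2" "sig_algebra alg_S3" "sig_algebra alg_S5" "sig_algebra alg_C4" "sig_algebra alg_D4"
  unfolding sig_algebra_def subuniverse_def carrier_S3 carrier_S5
  by (simp_all add: sugihara_def alg_2_def alg_C4_def alg_D4_def)

lemma finite_concrete:
  "finite (carrier alg_2)" "finite (carrier alg_S3)" "finite (carrier alg_S5)"
  "finite (carrier alg_C4)" "finite (carrier alg_D4)"
  unfolding carrier_S3 carrier_S5 by (simp_all add: alg_2_def alg_C4_def alg_D4_def UNIV_four)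

text \<open>There are no proper subalgebras, so a copy of \<open>2\<close>, \<open>C4\<close> or
  \<open>D4\<close> inside \<open>A\<close> would be all of \<open>A\<close>,
  \<open>f = \<one>\<close> would make \<open>A\<close> trivial, and the interval between
  \<open>z\<close> and \<open>t\<close> is all of \<open>A\<close>.\<close>

lemma (in de_morgan_monoid) zero_generated_fsi_crystalline:
  assumes "fsi A" "nontrivial A" and gen: "n_generated 0 A"
    and niso: "\<not> irl_isomorphic A alg_2" "\<not> irl_isomorphic A alg_D4" "\<not> irl_isomorphic A alg_C4"
  shows "crystalline_dmm A"
proof -
  interpret prime_dmm A
    using assms(1) by (rule fsi_prime)
  have least: "S = carrier A" if "subuniverse A S" for S
    using gen that by (auto simp: n_generated_def)
  have "\<f> \<noteq> \<one>"
  proof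
    assume f: "\<f> = \<one>"
    have "\<^bold>\<not> \<one> = \<one>"
      using f by simp
    then have "subuniverse A {\<one>}"
      by (simp add: subuniverse_def)
    then have "carrier A = {\<one>}"
      using least by blast
    then show False
      using assms(2) by (simp add: nontrivial_def)
  qed
  then have nid: "\<not> \<f> \<preceq> \<one>"
    using embeds_2 zero_generated_embeds[OF gen _ sig_algebra_concrete(1)] niso by blast
  interpret bounded_prime_dmm A
    by unfold_locales (use nid least[OF subuniverse_interval[OF one_le_t[OF nid]]] in auto)
  show ?thesis
    by unfold_locales
      (use embeds_C4 embeds_D4 zero_generated_embeds[OF gen] sig_algebra_concrete niso in blast)+
qed

section \<open>The separating equations\<close>

definition "term_f = Neg One"
definition "term_imp s t = Neg (Mult s (Neg t))"
definition "eq_le_e = (Wedge (Var 0) One, Var 0)"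
definition "eq_odd = (term_f, One)"
definition "eq_e_le_f = (Wedge One term_f, One)"
definition "eq_top = (Wedge (Var 0) (Mult term_f term_f), Var 0)"
definition "eq_e_meet_f = (Wedge One term_f, Neg (Mult term_f term_f))"
definition "eq_M = (let z = Neg (Mult term_f term_f) in
  (term_imp (Vee (term_imp term_f (Var 0)) (term_imp (Var 0) One)) z, z))"

lemma eval_term_f [simp]: "eval_term A v term_f = irl_f A"
  by (simp add: term_f_def irl_f_def)

lemma eval_term_imp [simp]: "eval_term A v (term_imp s t) = eval_term A v s \<^bold>\<rightarrow>\<^bsub>A\<^esub> eval_term A v t"
  by (simp add: term_imp_def irl_imp_def)

lemma all_valuation_0: "(\<forall>v :: nat \<Rightarrow> 'a. range v \<subseteq> S \<longrightarrow> P (v 0)) \<longleftrightarrow> (\<forall>x \<in> S. P x)"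
proof
  assume v: "\<forall>v :: nat \<Rightarrow> 'a. range v \<subseteq> S \<longrightarrow> P (v 0)"
  show "\<forall>x \<in> S. P x"
  proof
    fix x assume "x \<in> S"
    then show "P x"
      using v[rule_format, of "\<lambda>_. x"] by auto
  qed
qed auto

lemma all_valuation: "x \<in> S \<Longrightarrow> (\<forall>v :: nat \<Rightarrow> 'a. range v \<subseteq> S \<longrightarrow> P) \<longleftrightarrow> P"
  using all_valuation_0[of S "\<lambda>_. P"] by auto

lemma satisfies_eqs:
  assumes "sig_algebra A"
  shows "satisfies_eq A eq_le_e \<longleftrightarrow> (\<forall>x \<in> carrier A. x \<preceq>\<^bsub>A\<^esub> \<one>\<^bsub>A\<^esub>)"
    and "satisfies_eq A eq_odd \<longleftrightarrow> irl_f A = \<one>\<^bsub>A\<^esub>"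
    and "satisfies_eq A eq_e_le_f \<longleftrightarrow> \<one>\<^bsub>A\<^esub> \<preceq>\<^bsub>A\<^esub> irl_f A"
    and "satisfies_eq A eq_top \<longleftrightarrow> (\<forall>x \<in> carrier A. x \<preceq>\<^bsub>A\<^esub> irl_f A \<otimes>\<^bsub>A\<^esub> irl_f A)"
    and "satisfies_eq A eq_e_meet_f \<longleftrightarrow> \<one>\<^bsub>A\<^esub> \<^bold>\<and>\<^bsub>A\<^esub> irl_f A = irl_zero A"
    and "satisfies_eq A eq_M \<longleftrightarrow> (\<forall>x \<in> carrier A.
      ((irl_f A \<^bold>\<rightarrow>\<^bsub>A\<^esub> x) \<^bold>\<or>\<^bsub>A\<^esub> (x \<^bold>\<rightarrow>\<^bsub>A\<^esub> \<one>\<^bsub>A\<^esub>)) \<^bold>\<rightarrow>\<^bsub>A\<^esub> irl_zero A = irl_zero A)"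
proof -
  note unf = satisfies_eq_def eq_le_e_def eq_odd_def eq_e_le_f_def eq_top_def eq_e_meet_f_def eq_M_def
    Let_def fst_conv snd_conv eval_term.simps eval_term_f eval_term_imp irl_le_def irl_zero_def[symmetric]
    all_valuation[OF sig_algebraD(1)[OF assms]]
  show "satisfies_eq A eq_odd \<longleftrightarrow> irl_f A = \<one>\<^bsub>A\<^esub>"
    "satisfies_eq A eq_e_le_f \<longleftrightarrow> \<one>\<^bsub>A\<^esub> \<preceq>\<^bsub>A\<^esub> irl_f A"
    "satisfies_eq A eq_e_meet_f \<longleftrightarrow> \<one>\<^bsub>A\<^esub> \<^bold>\<and>\<^bsub>A\<^esub> irl_f A = irl_zero A"
    unfolding unf by (rule refl)+
  show "satisfies_eq A eq_le_e \<longleftrightarrow> (\<forall>x \<in> carrier A. x \<preceq>\<^bsub>A\<^esub> \<one>\<^bsub>A\<^esub>)"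
    unfolding unf by (rule all_valuation_0[of _ "\<lambda>x. x \<^bold>\<and>\<^bsub>A\<^esub> \<one>\<^bsub>A\<^esub> = x"])
  show "satisfies_eq A eq_top \<longleftrightarrow> (\<forall>x \<in> carrier A. x \<preceq>\<^bsub>A\<^esub> irl_f A \<otimes>\<^bsub>A\<^esub> irl_f A)"
    unfolding unf by (rule all_valuation_0[of _ "\<lambda>x. x \<^bold>\<and>\<^bsub>A\<^esub> irl_f A \<otimes>\<^bsub>A\<^esub> irl_f A = x"])
  show "satisfies_eq A eq_M \<longleftrightarrow> (\<forall>x \<in> carrier A.
      ((irl_f A \<^bold>\<rightarrow>\<^bsub>A\<^esub> x) \<^bold>\<or>\<^bsub>A\<^esub> (x \<^bold>\<rightarrow>\<^bsub>A\<^esub> \<one>\<^bsub>A\<^esub>)) \<^bold>\<rightarrow>\<^bsub>A\<^esub> irl_zero A = irl_zero A)"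
    unfolding unf by (rule all_valuation_0[of _ "\<lambda>x.
      ((irl_f A \<^bold>\<rightarrow>\<^bsub>A\<^esub> x) \<^bold>\<or>\<^bsub>A\<^esub> (x \<^bold>\<rightarrow>\<^bsub>A\<^esub> \<one>\<^bsub>A\<^esub>)) \<^bold>\<rightarrow>\<^bsub>A\<^esub> irl_zero A = irl_zero A"])
qed

lemma concrete_constants:
  "irl_f alg_2 = False" "\<one>\<^bsub>alg_2\<^esub> = True" "irl_f alg_S3 = 0" "\<one>\<^bsub>alg_S3\<^esub> = 0" "irl_f alg_S5 = 0" "\<one>\<^bsub>alg_S5\<^esub> = 0"
  "irl_f alg_C4 = F4" "\<one>\<^bsub>alg_C4\<^esub> = E4" "irl_zero alg_C4 = Zero4" "irl_f alg_D4 = F4" "\<one>\<^bsub>alg_D4\<^esub> = E4" "irl_zero alg_D4 = Zero4"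
  by (simp_all add: irl_f_def irl_zero_def alg_2_def sugihara_def alg_C4_def alg_D4_def mult4_def)

lemma satisfied_concrete:
  "satisfies_eq alg_2 eq_le_e" "satisfies_eq alg_S3 eq_odd" "satisfies_eq alg_S5 eq_odd"
  "satisfies_eq alg_C4 eq_e_le_f" "satisfies_eq alg_C4 eq_top" "satisfies_eq alg_D4 eq_top"
  "satisfies_eq alg_D4 eq_e_meet_f" "satisfies_eq alg_C4 eq_M" "satisfies_eq alg_D4 eq_M"
  unfolding satisfies_eqs[OF sig_algebra_concrete(1)] satisfies_eqs[OF sig_algebra_concrete(2)]
    satisfies_eqs[OF sig_algebra_concrete(3)] satisfies_eqs[OF sig_algebra_concrete(4)]
    satisfies_eqs[OF sig_algebra_concrete(5)] concrete_constants
  by (simp_all add: irl_le_def alg_2_def alg_C4_def alg_D4_def ball_four mult4_def irl_imp_def)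

lemma not_satisfied_concrete:
  "\<not> satisfies_eq alg_S3 eq_le_e" "\<not> satisfies_eq alg_C4 eq_le_e" "\<not> satisfies_eq alg_D4 eq_le_e"
  "\<not> satisfies_eq alg_2 eq_odd" "\<not> satisfies_eq alg_C4 eq_odd" "\<not> satisfies_eq alg_D4 eq_odd"
  "\<not> satisfies_eq alg_D4 eq_e_le_f"
  "\<not> satisfies_eq alg_2 eq_top" "\<not> satisfies_eq alg_S3 eq_top" "\<not> satisfies_eq alg_C4 eq_e_meet_f"
  unfolding satisfies_eqs[OF sig_algebra_concrete(1)] satisfies_eqs[OF sig_algebra_concrete(2)]
    satisfies_eqs[OF sig_algebra_concrete(4)] satisfies_eqs[OF sig_algebra_concrete(5)] concrete_constants
    carrier_S3
  by (simp_all add: irl_le_def alg_2_def sugihara_def alg_C4_def alg_D4_def ball_four ball_bool mult4_def)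

lemma not_th_le_concrete:
  "\<not> th_le alg_2 alg_S3" "\<not> th_le alg_2 alg_C4" "\<not> th_le alg_2 alg_D4"
  "\<not> th_le alg_S3 alg_2" "\<not> th_le alg_S3 alg_C4" "\<not> th_le alg_S3 alg_D4"
  "\<not> th_le alg_C4 alg_2" "\<not> th_le alg_C4 alg_S3" "\<not> th_le alg_C4 alg_D4"
  "\<not> th_le alg_D4 alg_2" "\<not> th_le alg_D4 alg_S3" "\<not> th_le alg_D4 alg_C4"
  using satisfied_concrete not_satisfied_concrete unfolding th_le_def by blast+

text \<open>The identity \<open>e \<le> (x \<and> \<not>x) \<or> ((x \<and> \<not>x) \<rightarrow> (y \<and> \<not>y))\<close> holds in \<open>S\<^sub>3\<close> but fails in \<open>S\<^sub>5\<close>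
  for \<open>x = 1\<close>, \<open>y = 2\<close>.\<close>

lemma not_th_le_S3_S5: "\<not> th_le alg_S3 alg_S5"
proof
  assume th: "th_le alg_S3 alg_S5"
  let ?a = "Wedge (Var 0) (Neg (Var 0))" let ?b = "Wedge (Var 1) (Neg (Var 1))"
  let ?t = "Vee ?a (Neg (Mult ?a (Neg ?b)))"
  have "satisfies_eq alg_S3 (Wedge One ?t, One)"
  proof (rule satisfies_eqI)
    fix v :: "nat \<Rightarrow> int" assume v: "\<And>n. v n \<in> carrier alg_S3"
    have "v 0 = -1 \<or> v 0 = 0 \<or> v 0 = 1" "v 1 = -1 \<or> v 1 = 0 \<or> v 1 = 1"
      using v[of 0] v[of 1] unfolding carrier_S3 by blast+
    then show "eval_term alg_S3 v (Wedge One ?t) = eval_term alg_S3 v One"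
      by (elim disjE) (simp_all add: sugihara_def)
  qed
  then have "satisfies_eq alg_S5 (Wedge One ?t, One)"
    using th by (simp add: th_le_def)
  then have "eval_term alg_S5 (val3 1 2 2) (Wedge One ?t) = eval_term alg_S5 (val3 1 2 2) One"
    by (rule satisfies_eq_val3) (simp_all add: carrier_S5)
  then show False
    by (simp add: sugihara_def)
qed

definition sugihara_mult :: "int \<Rightarrow> int \<Rightarrow> int"
  where "sugihara_mult a b = (if \<bar>a\<bar> < \<bar>b\<bar> then b else if \<bar>b\<bar> < \<bar>a\<bar> then a else min a b)"

lemma sugihara_mult:
  "sugihara_mult (sugihara_mult x y) z = sugihara_mult x (sugihara_mult y z)"
  "sugihara_mult x y = sugihara_mult y x" "sugihara_mult 0 x = x"
  "min x (sugihara_mult x x) = x"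
  "sugihara_mult x (max y z) = max (sugihara_mult x y) (sugihara_mult x z)"
  "min (sugihara_mult x (- sugihara_mult x y)) (- y) = sugihara_mult x (- sugihara_mult x y)"
  unfolding sugihara_mult_def by (smt (verit))+

lemma sig_algebra_sugihara: "sig_algebra (sugihara n)"
  by (auto simp: sig_algebra_def subuniverse_def sugihara_def)

text \<open>Places \<open>\<V> alg_S5\<close> among the subvarieties of \<open>DMM\<close>.\<close>

lemma de_morgan_monoid_sugihara: "de_morgan_monoid (sugihara n)"
proof (rule de_morgan_monoid_if_identities[OF sig_algebra_sugihara])
  fix \<epsilon> assume \<epsilon>: "\<epsilon> \<in> dmm_identities"
  have ops: "mult (sugihara n) = sugihara_mult" "one (sugihara n) = 0" "wedge (sugihara n) = min"
    "vee (sugihara n) = max" "neg (sugihara n) = uminus"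
    by (simp_all add: sugihara_def sugihara_mult_def fun_eq_iff)
  show "satisfies_eq (sugihara n) \<epsilon>"
    using \<epsilon> unfolding dmm_identities_def Let_def
    by (elim insertE emptyE; simp only: prod.inject; intro satisfies_eqI; unfold eval_term.simps ops)
      (rule sugihara_mult min.assoc max.assoc min.commute max.commute min_max_distrib2 minus_min_eq_max
        max_absorb1 min_absorb1 minus_minus | simp add: max_absorb1)+
qed

section \<open>Join-irreducible covers\<close>

context bounded_prime_dmm
begin

lemma embeds_four_if_negative_cone:
  assumes cone: "\<And>y. \<lbrakk>y \<in> carrier A; y \<preceq> \<one>\<rbrakk> \<Longrightarrow> y = \<one> \<or> y = \<z>"
    and X: "four_hom \<in> irl_hom X A" "carrier X = UNIV" "sig_algebra X"
    and x: "x \<in> carrier A" "x \<notin> {\<z>, \<one>, \<f>, \<t>}"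
  obtains S where "subuniverse A S" "de_morgan_monoid (A\<lparr>carrier := S\<rparr>)" "simple_alg (A\<lparr>carrier := S\<rparr>)"
    "n_generated 1 (A\<lparr>carrier := S\<rparr>)" "proper_subalgebra_of X (A\<lparr>carrier := S\<rparr>)"
    "\<not> satisfies_eq (A\<lparr>carrier := S\<rparr>) eq_M"
proof -
  let ?S = "generated_subuniverse A {x}"
  let ?A = "A\<lparr>carrier := ?S\<rparr>"
  have S: "subuniverse A ?S" and xS: "x \<in> ?S"
    using generated_subuniverse[OF sig_algebra, of "{x}"] x by auto
  then have sub: "?S \<subseteq> carrier A"
    by (simp add: subuniverse_def)
  interpret S: bounded_prime_dmm ?A
    using S by (rule bounded_prime_dmm_subuniverse)
  have "simple_alg ?A"
    by (rule S.simple_if_negative_cone) (use cone sub in auto)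
  moreover have "n_generated 1 ?A"
    using x by (intro n_generated_generated_subuniverse[OF sig_algebra]) simp_all
  moreover have "proper_subalgebra_of X ?A"
  proof -
    let ?T = "four_hom ` carrier X"
    have T: "?T = {\<z>, \<one>, \<f>, \<t>}"
      unfolding X(2) by (rule four_hom_range)
    have iso: "irl_isomorphic X (A\<lparr>carrier := ?T\<rparr>)" and sT: "subuniverse A ?T"
      using irl_isomorphic_image[OF X(1) _ X(3)] four_hom_inj X(2) by simp_all
    have "?T \<subseteq> ?S"
      unfolding T using S.zz_closed S.one_closed S.ff_closed S.m_closed[OF S.ff_closed S.ff_closed] by simp
    then have "subuniverse ?A ?T"
      using sT by (simp add: subuniverse_def)
    moreover have "?T \<noteq> carrier ?A"
      unfolding T using x xS by auto
    ultimately show ?thesis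
      unfolding proper_subalgebra_of_def using iso by (intro exI[of _ ?T]) simp
  qed
  moreover have "\<not> satisfies_eq ?A eq_M"
  proof -
    have "((irl_f ?A \<^bold>\<rightarrow>\<^bsub>?A\<^esub> x) \<^bold>\<or>\<^bsub>?A\<^esub> (x \<^bold>\<rightarrow>\<^bsub>?A\<^esub> \<one>\<^bsub>?A\<^esub>)) \<^bold>\<rightarrow>\<^bsub>?A\<^esub> irl_zero ?A \<noteq> irl_zero ?A"
      using S.M_identity_fails_iff[of x] xS f_mult_both_eq_t[OF cone x] by simp
    then show ?thesis
      unfolding satisfies_eqs(6)[OF S.sig_algebra] using xS by auto
  qed
  ultimately show thesis
    using that S S.de_morgan_monoid_axioms by blast
qed

end

text \<open>Separates cases (1) and (3). Simplicity leaves only \<open>z\<close> and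
  \<open>\<one>\<close> below \<open>\<one>\<close>, which makes \<open>\<one>\<close> join-prime;
  so an element outside the four constants violates the identity of \<open>M\<close>.\<close>

lemma (in de_morgan_monoid) simple_C4_extension_not_M:
  assumes A: "simple_alg A" and C4: "proper_subalgebra_of alg_C4 A"
    and top: "satisfies_eq A eq_top" and M: "satisfies_eq A eq_M" and ef: "satisfies_eq A eq_e_le_f"
  shows False
proof -
  note eqs = satisfies_eqs[OF sig_algebra]
  obtain S where S: "subuniverse A S" "S \<noteq> carrier A" and iso: "irl_isomorphic alg_C4 (A\<lparr>carrier := S\<rparr>)"
    using C4 by (auto simp: proper_subalgebra_of_def)
  have th: "th_le A alg_C4"
    using th_le_trans[OF th_le_subuniverse[OF S(1)] th_le_iso(2)[OF sig_algebra_concrete(4) iso]] .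
  have nf: "\<not> \<f> \<preceq> \<one>"
  proof
    assume "\<f> \<preceq> \<one>"
    then have "satisfies_eq A eq_odd"
      using ef le_antisym by (simp add: eqs)
    then show False
      using th not_satisfied_concrete unfolding th_le_def by blast
  qed
  have zle: "\<z> \<preceq> y" if "y \<in> carrier A" for y
    using top that neg_le_neg_iff[of "\<^bold>\<not> y" \<t>] by (simp add: eqs)
  have cone: "y = \<one> \<or> y = \<z>" if "y \<in> carrier A" "y \<preceq> \<one>" for y
    using simple_negative_cone[OF A that(2,1) zz_closed] zle le_antisym that by auto
  have nt: "nontrivial A"
    using A by (simp add: simple_alg_def)
  have z1: "\<z> \<noteq> \<one>"
    using trivial_if_one_least zle nt by metis
  interpret bounded_prime_dmm A
  proof unfold_locales
    show "\<one> \<preceq> x \<or> \<one> \<preceq> y" if xy: "x \<in> carrier A" "y \<in> carrier A" "\<one> \<preceq> x \<^bold>\<or> y" for x y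
    proof (rule ccontr)
      assume "\<not> ?thesis"
      then have "\<one> \<^bold>\<and> x = \<z>" "\<one> \<^bold>\<and> y = \<z>"
        using cone[OF wedge_closed wedge_le1, OF one_closed xy(1) one_closed xy(1)]
          cone[OF wedge_closed wedge_le1, OF one_closed xy(2) one_closed xy(2)]
        by (auto simp: irl_le_def)
      then have "\<one> \<^bold>\<and> (x \<^bold>\<or> y) = \<z>"
        using xy by (simp add: wedge_vee_distrib)
      then show False
        using xy z1 by (simp add: irl_le_def)
    qed
  qed (use nf top in \<open>simp_all add: eqs\<close>)
  have op: "\<one> \<in> S" "\<And>x y. \<lbrakk>x \<in> S; y \<in> S\<rbrakk> \<Longrightarrow> x \<otimes> y \<in> S" "\<And>x. x \<in> S \<Longrightarrow> \<^bold>\<not> x \<in> S"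
    using S(1) by (simp_all add: subuniverse_def)
  have "\<f> \<in> S"
    using op(3)[OF op(1)] by simp
  moreover from op(2)[OF this this] have "\<t> \<in> S" .
  moreover from op(3)[OF this] have "\<z> \<in> S"
    by simp
  ultimately have "{\<z>, \<one>, \<f>, \<t>} \<subseteq> S"
    using op(1) by simp
  moreover have "S \<subseteq> carrier A"
    using S(1) by (simp add: subuniverse_def)
  ultimately obtain x where x: "x \<in> carrier A" "x \<notin> {\<z>, \<one>, \<f>, \<t>}"
    using S(2) by blast
  have "((\<f> \<^bold>\<rightarrow> x) \<^bold>\<or> (x \<^bold>\<rightarrow> \<one>)) \<^bold>\<rightarrow> \<z> \<noteq> \<z>"
    using M_identity_fails_iff f_mult_both_eq_t[OF cone x] x by blast
  then show False
    using M x by (simp add: eqs)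
qed

lemma join_irreducible_coverD:
  fixes K :: "'u irl_alg set"
  assumes inf: "infinite (UNIV :: 'u set)" and X: "sig_algebra X" "finite (carrier X)"
    and K: "join_irreducible_cover K (\<V> X)"
  shows "variety K" "K \<subseteq> DMM" "\<And>B. \<lbrakk>sig_algebra B; th_le X B\<rbrakk> \<Longrightarrow> B \<in> K"
    "\<exists>A\<in>K. \<not> th_le X A"
    "\<And>B. \<lbrakk>B \<in> K; \<not> th_le X B\<rbrakk> \<Longrightarrow> K = \<V> B"
proof -
  note V = generated_variety_finite[OF X inf]
  have cov: "covers (subvariety_lattice :: 'u irl_alg set gorder) K (\<V> X)"
    using K by (simp add: join_irreducible_cover_def)
  then show KV: "variety K" "K \<subseteq> DMM"
    by (simp_all add: covers_def subvariety_lattice_def)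
  have lt: "\<V> X \<subseteq> K" "\<V> X \<noteq> K"
    using cov by (simp_all add: covers_def subvariety_lattice_def lless_def)
  then show "\<And>B. \<lbrakk>sig_algebra B; th_le X B\<rbrakk> \<Longrightarrow> B \<in> K" "\<exists>A\<in>K. \<not> th_le X A"
    using V variety_sig[OF KV(1)] by auto
  show "K = \<V> B" if "B \<in> K" "\<not> th_le X B" for B
    using join_irreducible_cover_eq[OF K that(1)] V that by auto
qed

lemma variety_subuniverse:
  assumes "variety K" "B \<in> K" "subuniverse B S"
  shows "B\<lparr>carrier := S\<rparr> \<in> K"
  using variety_closed[OF assms(1,2) sig_algebra_subuniverse[OF assms(3)] th_le_subuniverse[OF assms(3)]] .

lemma variety_prime:
  fixes K :: "'u irl_alg set"
  assumes K: "variety K" "K \<subseteq> DMM" and A: "A \<in> K" "\<not> satisfies_eq A \<epsilon>"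
  obtains B where "B \<in> K" "prime_dmm B" "nontrivial B" "\<not> satisfies_eq B \<epsilon>"
proof -
  interpret A: de_morgan_monoid A
    using A(1) K(2) by (auto simp: DMM_def)
  obtain B :: "'u irl_alg" where B: "prime_dmm B" "th_le A B" "\<not> satisfies_eq B \<epsilon>"
    by (rule A.prime_quotient_not_satisfies[OF A(2)])
  interpret B: prime_dmm B by (rule B)
  have "nontrivial B"
    using satisfies_eq_trivial[OF B.sig_algebra] B(3) by blast
  then show thesis
    using that variety_closed[OF K(1) A(1) B.sig_algebra B(2)] B by blast
qed

text \<open>Otherwise \<open>K\<close> would be \<open>\<V> Y\<close>.\<close>

lemma join_irreducible_cover_not_embeds:
  fixes K :: "'u irl_alg set"
  assumes inf: "infinite (UNIV :: 'u set)" and X: "sig_algebra X" "finite (carrier X)"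
    and K: "join_irreducible_cover K (\<V> X)"
    and Y: "sig_algebra Y" "\<not> th_le X Y" "\<not> th_le Y X" and B: "B \<in> K"
  shows "\<not> embeds Y B"
proof
  note KD = join_irreducible_coverD[OF inf X K]
  assume "embeds Y B"
  then obtain S where S: "subuniverse B S" "irl_isomorphic Y (B\<lparr>carrier := S\<rparr>)"
    using embedsD(1)[OF _ Y(1)] by blast
  let ?D = "B\<lparr>carrier := S\<rparr>"
  have D: "?D \<in> K"
    using KD(1) B S(1) by (rule variety_subuniverse)
  note YD = th_le_iso[OF Y(1) S(2)]
  have "\<not> th_le X ?D"
    using th_le_trans[OF _ YD(2)] Y(2) by blast
  then have KV: "K = \<V> ?D"
    using KD(5) D by blast
  \<comment> \<open>A copy of \<open>X\<close> over \<open>'u\<close> lies in \<open>K\<close>, so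
    \<open>K = \<V> ?D\<close> would put \<open>X\<close> into the variety of
    \<open>Y\<close>.\<close>
  obtain X' :: "'u irl_alg" where X': "sig_algebra X'" "irl_isomorphic X X'"
    using sig_algebra_finite_copy[OF X inf] by blast
  then have "X' \<in> K"
    using KD(3) th_le_iso(1)[OF X(1)] by blast
  then have "th_le ?D X'"
    unfolding KV generated_variety_self[OF sig_algebra_subuniverse[OF S(1)]] by simp
  then have "th_le Y X"
    using th_le_trans[OF th_le_trans[OF YD(1)] th_le_iso(2)[OF X(1) X'(2)]] by blast
  then show False
    using Y(3) by blast
qed

lemma variety_bounded_member:
  assumes K: "variety K" and B: "B \<in> K" "prime_dmm B" "\<not> irl_f B \<preceq>\<^bsub>B\<^esub> \<one>\<^bsub>B\<^esub>"
  obtains D where "D \<in> K" "bounded_prime_dmm D"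
  using prime_dmm.bounded_interval[OF B(2,3)] variety_subuniverse[OF K B(1)] by blast

lemma variety_C4_or_D4:
  assumes K: "variety K" and B: "B \<in> K" "bounded_prime_dmm B"
  shows "\<exists>D\<in>K. embeds alg_C4 D \<or> embeds alg_D4 D"
proof -
  interpret bounded_prime_dmm B by (rule B)
  show ?thesis
  proof (cases "\<one>\<^bsub>B\<^esub> \<^bold>\<and>\<^bsub>B\<^esub> \<f> = \<z>")
    case True
    then show ?thesis
      using embeds_D4 B by blast
  next
    case False
    then obtain D :: "'a irl_alg" where D: "th_le B D" "bounded_prime_dmm D" "embeds alg_C4 D"
      by (rule C4_quotient)
    interpret D: bounded_prime_dmm D by (rule D)
    show ?thesis
      using variety_closed[OF K B(1) D.sig_algebra D(1)] D(3) by blast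
  qed
qed

lemma variety_bounded_if_omits:
  assumes K: "variety K" and omit: "\<And>B. B \<in> K \<Longrightarrow> \<not> embeds alg_2 B \<and> \<not> embeds alg_S3 B"
    and B: "B \<in> K" "prime_dmm B" "nontrivial B"
  shows "bounded_prime_dmm B"
proof -
  interpret prime_dmm B by (rule B)
  have f: "\<not> \<f> \<preceq>\<^bsub>B\<^esub> \<one>\<^bsub>B\<^esub>"
  proof
    assume f: "\<f> \<preceq>\<^bsub>B\<^esub> \<one>\<^bsub>B\<^esub>"
    then have "\<f> = \<one>\<^bsub>B\<^esub>"
      using embeds_2 omit B by blast
    moreover obtain x where "x \<in> carrier B" "x \<noteq> \<one>\<^bsub>B\<^esub>"
      using B(3) unfolding nontrivial_def by metis
    ultimately show False
      using odd_embeds_S3 omit B by blast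
  qed
  have "x \<preceq>\<^bsub>B\<^esub> \<t>" if x: "x \<in> carrier B" for x
  proof (rule ccontr)
    assume "\<not> x \<preceq>\<^bsub>B\<^esub> \<t>"
    then obtain D :: "'a irl_alg" where D: "th_le B D" "prime_dmm D" "embeds alg_S3 D"
      using not_le_t_quotient_S3[OF one_le_t[OF f] x] by metis
    interpret D: prime_dmm D by (rule D)
    show False
      using variety_closed[OF K B(1) D.sig_algebra D(1)] D(3) omit by blast
  qed
  then show ?thesis
    using f by unfold_locales
qed

lemma anti_idempotent_iff: 
  "square_increasing_irl A \<Longrightarrow> anti_idempotent A \<longleftrightarrow> satisfies_eq A eq_top"
  using irl.sig_algebra square_increasing_irl.axioms(1) satisfies_eqs(4)
  by (metis anti_idempotent_def)

lemma variety_anti_idempotent_if_omits: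
  assumes K: "variety K" "K \<subseteq> DMM" and omit: "\<And>B. B \<in> K \<Longrightarrow> \<not> embeds alg_2 B \<and> \<not> embeds alg_S3 B"
    and A: "A \<in> K"
  shows "anti_idempotent A"
proof (rule ccontr)
  assume na: "\<not> anti_idempotent A"
  interpret A: de_morgan_monoid A
    using A K(2) by (auto simp: DMM_def)
  have "\<not> satisfies_eq A eq_top"
    using na anti_idempotent_iff[OF A.square_increasing_irl_axioms] by blast
  then obtain B where B: "B \<in> K" "prime_dmm B" "nontrivial B" "\<not> satisfies_eq B eq_top"
    using variety_prime[OF K A] by metis
  interpret B: bounded_prime_dmm B
    using variety_bounded_if_omits[OF K(1) omit B(1-3)] .
  show False
    using B(4) B.le_t by (simp add: satisfies_eqs[OF B.sig_algebra])
qed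

text \<open>With \<open>C4\<close>, \<open>D4\<close> and \<open>S3\<close> excluded, a prime member
  has \<open>f \<preceq> \<one>\<close> and all elements below \<open>\<one>\<close>. Applied to
  \<open>x\<close> and its negation, this leaves only \<open>\<one>\<close> and \<open>f\<close>,
  hence an image of \<open>2\<close>.\<close>

lemma no_join_irreducible_cover_2:
  fixes K :: "'u irl_alg set"
  assumes inf: "infinite (UNIV :: 'u set)"
  shows "\<not> join_irreducible_cover K (\<V> alg_2)"
proof
  assume K: "join_irreducible_cover K (\<V> alg_2)"
  note sc = sig_algebra_concrete and fc = finite_concrete
  note KD = join_irreducible_coverD[OF inf sc(1) fc(1) K]
  note omit = join_irreducible_cover_not_embeds[OF inf sc(1) fc(1) K]
  have no: "\<not> embeds alg_S3 B" "\<not> embeds alg_C4 B" "\<not> embeds alg_D4 B" if "B \<in> K" for B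
    using omit[OF sc(2) not_th_le_concrete(1,4) that] omit[OF sc(4) not_th_le_concrete(2,7) that]
      omit[OF sc(5) not_th_le_concrete(3,10) that] by simp_all
  obtain A \<epsilon> where A: "A \<in> K" "\<not> satisfies_eq A \<epsilon>" and \<epsilon>: "satisfies_eq alg_2 \<epsilon>"
    using KD(4) by (auto simp: th_le_def)
  obtain B where B: "B \<in> K" "prime_dmm B" "nontrivial B" "\<not> satisfies_eq B \<epsilon>"
    using variety_prime[OF KD(1,2) A] by metis
  interpret prime_dmm B by (rule B)
  show False
  proof (cases "\<f> \<preceq>\<^bsub>B\<^esub> \<one>\<^bsub>B\<^esub>")
    case False
    then show False
      using variety_bounded_member[OF KD(1) B(1,2)] variety_C4_or_D4[OF KD(1)] no by metis
  next
    case f: True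
    have le1: "x \<preceq>\<^bsub>B\<^esub> \<one>\<^bsub>B\<^esub>" if x: "x \<in> carrier B" for x
    proof (rule ccontr)
      assume "\<not> x \<preceq>\<^bsub>B\<^esub> \<one>\<^bsub>B\<^esub>"
      then obtain D :: "'u irl_alg" where D: "th_le B D" "prime_dmm D" "embeds alg_S3 D"
        using not_le_one_quotient_S3[OF f x] by metis
      interpret D: prime_dmm D by (rule D)
      show False
        using variety_closed[OF KD(1) B(1) D.sig_algebra D(1)] D(3) no by blast
    qed
    have "x = \<one>\<^bsub>B\<^esub> \<or> x = \<f>" if x: "x \<in> carrier B" for x
      using one_le_or_le_f[OF x] le1[OF x] le1[of "\<^bold>\<not>\<^bsub>B\<^esub> x"] f_le_iff[OF x] le_antisym x by auto
    then have car: "carrier B = {\<one>\<^bsub>B\<^esub>, \<f>}"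
      by auto
    then have "th_le alg_2 B"
      using two_th_le[OF f] by blast
    then show False
      using \<epsilon> B(4) unfolding th_le_def by blast
  qed
qed

lemma generated_variety_iso:
  fixes B :: "'u irl_alg"
  assumes "sig_algebra A" "sig_algebra B" "irl_isomorphic A B"
  shows "\<V> A = (\<V> B :: 'u irl_alg set)"
proof -
  note iso = th_le_iso[OF assms(1,3)]
  have "th_le A D \<longleftrightarrow> th_le B D" for D :: "'u irl_alg"
    using th_le_trans[OF iso(1), of D] th_le_trans[OF iso(2), of D] by blast
  then show ?thesis
    unfolding generated_variety_eq[OF assms] generated_variety_self[OF assms(2)] by simp
qed

lemma S5_th_le_S3: "th_le alg_S5 alg_S3"
proof (rule th_le_inj[OF sig_algebra_concrete(2)])
  show "id \<in> irl_hom alg_S3 alg_S5"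
    unfolding irl_hom_def carrier_S3 carrier_S5 by (simp add: sugihara_def)
qed simp

text \<open>Prime odd algebras are chains, so \<open>S\<^sub>5\<close> embeds into them as soon as they have two
  elements above \<open>e\<close>.\<close>

lemma S5_generates:
  fixes A :: "'u irl_alg"
  assumes A: "sig_algebra A" "th_le alg_S5 A" "\<not> th_le alg_S3 A"
  shows "th_le A alg_S5"
proof -
  interpret A: de_morgan_monoid A
    using de_morgan_monoid_th_le[OF de_morgan_monoid_sugihara A(1,2)] .
  obtain \<epsilon> where \<epsilon>: "satisfies_eq alg_S3 \<epsilon>" "\<not> satisfies_eq A \<epsilon>"
    using A(3) by (auto simp: th_le_def)
  obtain B :: "'u irl_alg" where B: "prime_dmm B" "th_le A B" "\<not> satisfies_eq B \<epsilon>"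
    by (rule A.prime_quotient_not_satisfies[OF \<epsilon>(2)])
  interpret B: prime_dmm B by (rule B)
  have "satisfies_eq B eq_odd"
    using th_le_trans[OF A(2) B(2)] satisfied_concrete(3) unfolding th_le_def by blast
  then have "irl_f B = \<one>\<^bsub>B\<^esub>"
    by (simp add: satisfies_eqs[OF B.sig_algebra])
  then have "embeds alg_S5 B"
    using B.odd_th_le_S3 \<epsilon>(1) B(3) unfolding th_le_def by blast
  then have "th_le B alg_S5"
    using embedsD(2) sig_algebra_concrete(3) by blast
  then show ?thesis
    using th_le_trans B(2) by blast
qed

lemma join_irreducible_cover_S3:
  fixes K :: "'u irl_alg set"
  assumes inf: "infinite (UNIV :: 'u set)" and K: "join_irreducible_cover K (\<V> alg_S3)"
  shows "K = \<V> alg_S5"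
proof -
  note sc = sig_algebra_concrete and fc = finite_concrete
  note KD = join_irreducible_coverD[OF inf sc(2) fc(2) K]
  note omit = join_irreducible_cover_not_embeds[OF inf sc(2) fc(2) K]
  have no: "\<not> embeds alg_2 B" "\<not> embeds alg_C4 B" "\<not> embeds alg_D4 B" if "B \<in> K" for B
    using omit[OF sc(1) not_th_le_concrete(4,1) that] omit[OF sc(4) not_th_le_concrete(5,8) that]
      omit[OF sc(5) not_th_le_concrete(6,11) that] by simp_all
  obtain A \<epsilon> where A: "A \<in> K" "\<not> satisfies_eq A \<epsilon>" and \<epsilon>: "satisfies_eq alg_S3 \<epsilon>"
    using KD(4) by (auto simp: th_le_def)
  obtain B where B: "B \<in> K" "prime_dmm B" "nontrivial B" "\<not> satisfies_eq B \<epsilon>"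
    using variety_prime[OF KD(1,2) A] by metis
  interpret prime_dmm B by (rule B)
  have "\<f> \<preceq>\<^bsub>B\<^esub> \<one>\<^bsub>B\<^esub>"
    using variety_bounded_member[OF KD(1) B(1,2)] variety_C4_or_D4[OF KD(1)] no by metis
  then have "\<f> = \<one>\<^bsub>B\<^esub>"
    using embeds_2 no B by blast
  then have "embeds alg_S5 B"
    using odd_th_le_S3 \<epsilon> B(4) unfolding th_le_def by blast
  then obtain S where S: "subuniverse B S" "irl_isomorphic alg_S5 (B\<lparr>carrier := S\<rparr>)"
    using embedsD(1)[OF _ sc(3)] by blast
  note iso = th_le_iso[OF sc(3) S(2)]
  have "B\<lparr>carrier := S\<rparr> \<in> K"
    using KD(1) B(1) S(1) by (rule variety_subuniverse)
  moreover have "\<not> th_le alg_S3 (B\<lparr>carrier := S\<rparr>)"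
    using not_th_le_S3_S5 th_le_trans iso(2) by blast
  ultimately have "K = \<V> (B\<lparr>carrier := S\<rparr>)"
    by (rule KD(5))
  also have "\<dots> = \<V> alg_S5"
    using generated_variety_iso[OF sc(3) sig_algebra_subuniverse[OF S(1)] S(2)] by simp
  finally show ?thesis .
qed

lemma bottom_subvariety_lattice:
  "\<bottom>\<^bsub>subvariety_lattice\<^esub> = {A :: 'u irl_alg. sig_algebra A \<and> \<not> nontrivial A}"
proof -
  let ?L = "subvariety_lattice :: 'u irl_alg set gorder"
  let ?T = "{A :: 'u irl_alg. sig_algebra A \<and> \<not> nontrivial A}"
  have triv: "satisfies_eq A \<epsilon>" if "A \<in> ?T" for A :: "'u irl_alg" and \<epsilon>
    using that satisfies_eq_trivial by blast
  have least: "?T \<subseteq> W" if "variety W" for W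
    using that triv unfolding variety_def by blast
  have "?T = {A. sig_algebra A \<and> (\<forall>\<epsilon> \<in> {(Var 0, Var 1)}. satisfies_eq A \<epsilon>)}"
  proof -
    have "\<not> nontrivial A" if "satisfies_eq A (Var 0, Var 1)" for A :: "'u irl_alg"
      using satisfies_eq_val3[OF that] by (auto simp: nontrivial_def)
    then show ?thesis
      using triv by blast
  qed
  then have "variety ?T"
    unfolding variety_def by blast
  then have T: "?T \<in> carrier ?L"
    using least[OF variety_DMM] by (simp add: subvariety_lattice_def)
  have "least ?L J (carrier ?L) \<longleftrightarrow> J = ?T" for J
  proof
    assume J: "least ?L J (carrier ?L)"
    then have "J \<subseteq> ?T" "?T \<subseteq> J"
      using T least unfolding least_def by (auto simp: subvariety_lattice_def)
    then show "J = ?T"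
      by blast
  next
    assume "J = ?T"
    then show "least ?L J (carrier ?L)"
      using T least unfolding least_def by (simp add: subvariety_lattice_def)
  qed
  then show ?thesis
    by (simp add: bottom_def)
qed

text \<open>Any member of \<open>\<V> alg_S5\<close> outside \<open>\<V> alg_S3\<close> generates
  all of \<open>\<V> alg_S5\<close> (\<open>gen\<close>). So \<open>\<V> alg_S3\<close> contains
  every proper subvariety, which gives both covering and join-irreducibility.\<close>

lemma join_irreducible_cover_S5:
  assumes inf: "infinite (UNIV :: 'u set)"
  shows "join_irreducible_cover (\<V> alg_S5 :: 'u irl_alg set) (\<V> alg_S3)"
proof -
  note sc = sig_algebra_concrete and fc = finite_concrete
  let ?L = "subvariety_lattice :: 'u irl_alg set gorder"
  let ?V3 = "\<V> alg_S3 :: 'u irl_alg set" and ?V5 = "\<V> alg_S5 :: 'u irl_alg set"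
  have V3: "?V3 = {D. sig_algebra D \<and> th_le alg_S3 D}" and V5: "?V5 = {D. sig_algebra D \<and> th_le alg_S5 D}"
    using generated_variety_finite[OF sc(2) fc(2) inf] generated_variety_finite[OF sc(3) fc(3) inf] by blast+
  have var: "variety ?V3" "variety ?V5"
    unfolding V3 V5 by (rule variety_models)+
  have D5: "?V5 \<subseteq> DMM"
    unfolding V5 DMM_def using de_morgan_monoid_th_le[OF de_morgan_monoid_sugihara] by blast
  have sub: "?V3 \<subseteq> ?V5"
    unfolding V3 V5 using th_le_trans[OF S5_th_le_S3] by blast
  obtain D :: "'u irl_alg" where D: "sig_algebra D" "irl_isomorphic alg_S5 D"
    using sig_algebra_finite_copy[OF sc(3) fc(3) inf] by blast
  note isoD = th_le_iso[OF sc(3) D(2)]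
  have D3: "\<not> th_le alg_S3 D"
    using not_th_le_S3_S5 th_le_trans isoD(2) by blast
  then have ne: "?V3 \<noteq> ?V5"
    unfolding V3 V5 using D isoD(1) by blast
  have gen: "?V5 \<subseteq> Z" if Z: "variety Z" and A: "A \<in> Z" "A \<in> ?V5" "A \<notin> ?V3" for Z A
  proof -
    have "th_le A alg_S5"
      using A S5_generates unfolding V3 V5 by blast
    then show ?thesis
      unfolding V5 using variety_closed[OF Z A(1)] th_le_trans by blast
  qed
  have L: "?V3 \<in> carrier ?L" "?V5 \<in> carrier ?L"
    using var D5 sub by (auto simp: subvariety_lattice_def)
  have "covers ?L ?V5 ?V3"
    unfolding covers_def
  proof (intro conjI L)
    show "?V3 \<sqsubset>\<^bsub>?L\<^esub> ?V5"
      using sub ne by (simp add: subvariety_lattice_def lless_def)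
    show "\<not> (\<exists>Z\<in>carrier ?L. ?V3 \<sqsubset>\<^bsub>?L\<^esub> Z \<and> Z \<sqsubset>\<^bsub>?L\<^esub> ?V5)"
    proof
      assume "\<exists>Z\<in>carrier ?L. ?V3 \<sqsubset>\<^bsub>?L\<^esub> Z \<and> Z \<sqsubset>\<^bsub>?L\<^esub> ?V5"
      then obtain Z where Z: "variety Z" "?V3 \<subset> Z" "Z \<subset> ?V5"
        by (auto simp: subvariety_lattice_def lless_def)
      then show False
        using gen[OF Z(1)] by blast
    qed
  qed
  moreover have "join_irreducible ?L ?V5"
    unfolding join_irreducible_def
  proof (intro conjI L ballI impI)
    have "nontrivial D"
      using satisfies_eq_trivial[OF D(1)] D3 unfolding th_le_def by blast
    moreover have "D \<in> ?V5"
      unfolding V5 using D isoD(1) by blast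
    ultimately show "?V5 \<noteq> \<bottom>\<^bsub>?L\<^esub>"
      unfolding bottom_subvariety_lattice by blast
    fix Y Z assume Y: "Y \<in> carrier ?L" and Z: "Z \<in> carrier ?L" and eq: "?V5 = Y \<squnion>\<^bsub>?L\<^esub> Z"
    have YZ: "variety Y" "variety Z" "Y \<union> Z \<subseteq> DMM"
      using Y Z by (auto simp: subvariety_lattice_def)
    have J: "?V5 = variety_join Y Z"
      using eq join_subvariety_lattice[OF Y Z variety_join_least[OF variety_DMM YZ(3)]] by simp
    then have up: "Y \<subseteq> ?V5" "Z \<subseteq> ?V5"
      using variety_join_upper[OF YZ(1,2)] by auto
    show "?V5 = Y \<or> ?V5 = Z"
    proof (rule ccontr)
      assume "\<not> ?thesis"
      then have "Y \<union> Z \<subseteq> ?V3"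
        using gen[OF YZ(1)] gen[OF YZ(2)] up by blast
      then have "?V5 \<subseteq> ?V3"
        unfolding J by (rule variety_join_least[OF var(1)])
      then show False
        using sub ne by blast
    qed
  qed
  ultimately show ?thesis
    by (simp add: join_irreducible_cover_def)
qed

text \<open>The identity of \<open>M\<close> serves as the separating equation for \<open>C4\<close>
  and \<open>D4\<close> alike: it holds in \<open>X\<close> and fails in the subalgebra generated by
  \<open>x\<close>, which therefore generates \<open>K\<close>.\<close>

lemma variety_simple_extension:
  fixes K :: "'u irl_alg set"
  assumes K: "variety K" and B: "B \<in> K" "bounded_prime_dmm B"
    and cone: "\<And>y. \<lbrakk>y \<in> carrier B; y \<preceq>\<^bsub>B\<^esub> \<one>\<^bsub>B\<^esub>\<rbrakk> \<Longrightarrow> y = \<one>\<^bsub>B\<^esub> \<or> y = irl_zero B"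
    and X: "bounded_prime_dmm.four_hom B \<in> irl_hom X B" "carrier X = UNIV" "sig_algebra X"
    and x: "x \<in> carrier B" "x \<notin> {irl_zero B, \<one>\<^bsub>B\<^esub>, irl_f B, irl_f B \<otimes>\<^bsub>B\<^esub> irl_f B}"
    and M: "satisfies_eq X eq_M"
    and KX: "\<And>D. \<lbrakk>D \<in> K; \<not> th_le X D\<rbrakk> \<Longrightarrow> K = \<V> D"
  shows "\<exists>A :: 'u irl_alg. de_morgan_monoid A \<and> simple_alg A \<and> n_generated 1 A \<and>
    proper_subalgebra_of X A \<and> K = \<V> A"
proof -
  interpret bounded_prime_dmm B by (rule B)
  obtain S where S: "subuniverse B S" "de_morgan_monoid (B\<lparr>carrier := S\<rparr>)"
    "simple_alg (B\<lparr>carrier := S\<rparr>)" "n_generated 1 (B\<lparr>carrier := S\<rparr>)"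
    "proper_subalgebra_of X (B\<lparr>carrier := S\<rparr>)" "\<not> satisfies_eq (B\<lparr>carrier := S\<rparr>) eq_M"
    using embeds_four_if_negative_cone[OF cone X x] by metis
  have "\<not> th_le X (B\<lparr>carrier := S\<rparr>)"
    using M S(6) unfolding th_le_def by blast
  then have "K = \<V> (B\<lparr>carrier := S\<rparr>)"
    using KX variety_subuniverse[OF K B(1) S(1)] by blast
  then show ?thesis
    using S by blast
qed

text \<open>With \<open>C4\<close> excluded, \<open>\<one> \<and> f = z\<close>. Then an element
  strictly below \<open>\<one>\<close> is below \<open>f\<close> by primeness, hence is
  \<open>z\<close>: already \<open>B\<close> has the negative cone for which \<open>C4\<close>
  requires a quotient.\<close>

lemma join_irreducible_cover_D4:
  fixes K :: "'u irl_alg set"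
  assumes inf: "infinite (UNIV :: 'u set)" and K: "join_irreducible_cover K (\<V> alg_D4)"
  shows "\<exists>A :: 'u irl_alg. de_morgan_monoid A \<and> simple_alg A \<and> n_generated 1 A \<and>
      proper_subalgebra_of alg_D4 A \<and> K = \<V> A"
    and "\<forall>A \<in> K. anti_idempotent A"
proof -
  note sc = sig_algebra_concrete and fc = finite_concrete
  note KD = join_irreducible_coverD[OF inf sc(5) fc(5) K]
  note omit = join_irreducible_cover_not_embeds[OF inf sc(5) fc(5) K]
  have no: "\<not> embeds alg_2 B \<and> \<not> embeds alg_S3 B" and no4: "\<not> embeds alg_C4 B" if "B \<in> K" for B
    using omit[OF sc(1) not_th_le_concrete(10,3) that] omit[OF sc(2) not_th_le_concrete(11,6) that]
      omit[OF sc(4) not_th_le_concrete(12,9) that] by simp_all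
  show "\<forall>A \<in> K. anti_idempotent A"
    using variety_anti_idempotent_if_omits[OF KD(1,2) no] by blast
  obtain A \<epsilon> where A: "A \<in> K" "\<not> satisfies_eq A \<epsilon>" and \<epsilon>: "satisfies_eq alg_D4 \<epsilon>"
    using KD(4) by (auto simp: th_le_def)
  obtain B where B: "B \<in> K" "prime_dmm B" "nontrivial B" "\<not> satisfies_eq B \<epsilon>"
    using variety_prime[OF KD(1,2) A] by metis
  interpret bounded_prime_dmm B
    using variety_bounded_if_omits[OF KD(1) no B(1-3)] .
  have ef: "\<one>\<^bsub>B\<^esub> \<^bold>\<and>\<^bsub>B\<^esub> \<f> = \<z>"
  proof (rule ccontr)
    assume "\<one>\<^bsub>B\<^esub> \<^bold>\<and>\<^bsub>B\<^esub> \<f> \<noteq> \<z>"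
    then obtain D :: "'u irl_alg" where D: "th_le B D" "bounded_prime_dmm D" "embeds alg_C4 D"
      by (rule C4_quotient)
    interpret D: bounded_prime_dmm D by (rule D)
    show False
      using variety_closed[OF KD(1) B(1) D.sig_algebra D(1)] D(3) no4 by blast
  qed
  have cone: "y = \<one>\<^bsub>B\<^esub> \<or> y = \<z>" if y: "y \<in> carrier B" "y \<preceq>\<^bsub>B\<^esub> \<one>\<^bsub>B\<^esub>" for y
  proof (cases "\<one>\<^bsub>B\<^esub> \<preceq>\<^bsub>B\<^esub> y")
    case True
    then show ?thesis
      using le_antisym y by simp
  next
    case False
    then have "y \<preceq>\<^bsub>B\<^esub> \<one>\<^bsub>B\<^esub> \<^bold>\<and>\<^bsub>B\<^esub> \<f>"
      using one_le_or_le_f[OF y(1)] y by (simp add: le_wedge_iff)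
    then show ?thesis
      using ef le_z_iff y by simp
  qed
  note hom = D4_hom[OF ef]
  have U: "carrier alg_D4 = UNIV"
    by (simp add: alg_D4_def)
  have "carrier B \<noteq> {\<z>, \<one>\<^bsub>B\<^esub>, \<f>, \<t>}"
  proof
    assume "carrier B = {\<z>, \<one>\<^bsub>B\<^esub>, \<f>, \<t>}"
    then have "th_le alg_D4 B"
      using th_le_surj[OF sc(5) hom] four_hom_range U by simp
    then show False
      using \<epsilon> B(4) unfolding th_le_def by blast
  qed
  moreover have "{\<z>, \<one>\<^bsub>B\<^esub>, \<f>, \<t>} \<subseteq> carrier B"
    by simp
  ultimately obtain x where x: "x \<in> carrier B" "x \<notin> {\<z>, \<one>\<^bsub>B\<^esub>, \<f>, \<t>}"
    by blast
  show "\<exists>A :: 'u irl_alg. de_morgan_monoid A \<and> simple_alg A \<and> n_generated 1 A \<and>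
      proper_subalgebra_of alg_D4 A \<and> K = \<V> A"
    using variety_simple_extension[OF KD(1) B(1) bounded_prime_dmm_axioms cone hom U sc(5) x
        satisfied_concrete(9) KD(5)] .
qed

lemma join_irreducible_cover_C4_cases:
  fixes K :: "'u irl_alg set" and C :: "nat \<Rightarrow> 'u irl_alg"
  assumes inf: "infinite (UNIV :: 'u set)"
    and C: "\<And>n. n \<in> {5, 6, 7, 8} \<Longrightarrow> crystalline_dmm (C n) \<and> n_generated 0 (C n)"
    and noniso: "\<And>m n. \<lbrakk>m \<in> {5, 6, 7, 8}; n \<in> {5, 6, 7, 8}; m \<noteq> n\<rbrakk> \<Longrightarrow> \<not> irl_isomorphic (C m) (C n)"
    and K: "join_irreducible_cover K (\<V> alg_C4)"
  shows "\<forall>A \<in> K. anti_idempotent A"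
    and "K \<subseteq> variety_M \<or> (\<exists>n \<in> {5, 6, 7, 8}. K = \<V> (C n)) \<or>
      (\<exists>A :: 'u irl_alg. de_morgan_monoid A \<and> simple_alg A \<and> n_generated 1 A \<and>
        proper_subalgebra_of alg_C4 A \<and> K = \<V> A)"
proof -
  note sc = sig_algebra_concrete and fc = finite_concrete
  note KD = join_irreducible_coverD[OF inf sc(4) fc(4) K]
  note omit = join_irreducible_cover_not_embeds[OF inf sc(4) fc(4) K]
  have no: "\<not> embeds alg_2 B \<and> \<not> embeds alg_S3 B" and no4: "\<not> embeds alg_D4 B" if "B \<in> K" for B
    using omit[OF sc(1) not_th_le_concrete(7,2) that] omit[OF sc(2) not_th_le_concrete(8,5) that]
      omit[OF sc(5) not_th_le_concrete(9,12) that] by simp_all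
  show anti: "\<forall>A \<in> K. anti_idempotent A"
    using variety_anti_idempotent_if_omits[OF KD(1,2) no] by blast
  show "K \<subseteq> variety_M \<or> (\<exists>n \<in> {5, 6, 7, 8}. K = \<V> (C n)) \<or>
      (\<exists>A :: 'u irl_alg. de_morgan_monoid A \<and> simple_alg A \<and> n_generated 1 A \<and>
        proper_subalgebra_of alg_C4 A \<and> K = \<V> A)"
  proof (cases "K \<subseteq> variety_M")
    case False
    then obtain A where A: "A \<in> K" "A \<notin> variety_M"
      by blast
    then have "de_morgan_monoid A"
      using KD(2) by (auto simp: DMM_def)
    then have "\<not> satisfies_eq A eq_e_le_f \<or> \<not> satisfies_eq A eq_M"
      using A anti variety_sig[OF KD(1) A(1)] unfolding variety_M_def by (simp add: satisfies_eqs)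
    then obtain \<epsilon> where \<epsilon>: "\<epsilon> = eq_e_le_f \<or> \<epsilon> = eq_M" "\<not> satisfies_eq A \<epsilon>"
      by blast
    obtain B where B: "B \<in> K" "prime_dmm B" "nontrivial B" "\<not> satisfies_eq B \<epsilon>"
      using variety_prime[OF KD(1,2) A(1) \<epsilon>(2)] by metis
    interpret bounded_prime_dmm B
      using variety_bounded_if_omits[OF KD(1) no B(1-3)] .
    show ?thesis
    proof (cases "\<one>\<^bsub>B\<^esub> \<preceq>\<^bsub>B\<^esub> \<f>")
      case False
      then interpret crystalline_dmm B
        using embeds_D4 no4 B(1) by unfold_locales blast+
      \<comment> \<open>The failure of \<open>\<one> \<preceq> f\<close> concerns constants only, so
        the subalgebra they generate already violates an equation of \<open>C4\<close> and generates
        \<open>K\<close>.\<close>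
      let ?S = "generated_subuniverse B {}"
      let ?D = "B\<lparr>carrier := ?S\<rparr>"
      have S: "subuniverse B ?S"
        using generated_subuniverse[OF sig_algebra] by simp
      interpret D: crystalline_dmm ?D
        using S by (rule crystalline_dmm_subuniverse)
      have gen: "n_generated 0 ?D"
        by (rule n_generated_generated_subuniverse[OF sig_algebra]) simp_all
      have "\<exists>n \<in> {5, 6, 7, 8}. irl_isomorphic ?D (C n)"
        by (rule crystalline_isomorphic_one_of_four) (fact C noniso D.crystalline_dmm_axioms gen)+
      then obtain n where n: "n \<in> {5, 6, 7, 8}" "irl_isomorphic ?D (C n)"
        by (rule bexE)
      have "\<not> satisfies_eq ?D eq_e_le_f"
        using D.not_one_le_f by (simp add: satisfies_eqs[OF D.sig_algebra])
      then have "\<not> th_le alg_C4 ?D"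
        using satisfied_concrete(4) unfolding th_le_def by blast
      then have "K = \<V> ?D"
        using KD(5) variety_subuniverse[OF KD(1) B(1) S] by blast
      moreover have "sig_algebra (C n)"
        using C[OF n(1)] by (intro irl.sig_algebra)
          (simp add: crystalline_dmm_def bounded_prime_dmm_def prime_dmm_def de_morgan_monoid_def square_increasing_irl_def)
      ultimately have "K = \<V> (C n)"
        using generated_variety_iso[OF D.sig_algebra _ n(2)] by simp
      then show ?thesis
        using n(1) by blast
    next
      case ef: True
      then have "satisfies_eq B eq_e_le_f"
        by (simp add: satisfies_eqs[OF sig_algebra])
      then have "\<not> satisfies_eq B eq_M"
        using \<epsilon>(1) B(4) by blast
      then obtain x where x: "x \<in> carrier B" "\<f> \<otimes>\<^bsub>B\<^esub> x = \<t>" "\<f> \<otimes>\<^bsub>B\<^esub> \<^bold>\<not>\<^bsub>B\<^esub> x = \<t>"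
        using M_identity_fails_iff unfolding satisfies_eqs[OF sig_algebra] by blast
      \<comment> \<open>Starting from the least deductive filter and avoiding \<open>z\<close>, the
        quotient \<open>D\<close> has only \<open>z\<close> and \<open>\<one>\<close> below
        \<open>\<one>\<close>.\<close>
      let ?F = "{y \<in> carrier B. \<one>\<^bsub>B\<^esub> \<preceq>\<^bsub>B\<^esub> y}"
      have F: "deductive_filter B ?F"
        by (rule deductive_filter_principal) simp_all
      have zF: "\<z> \<notin> ?F"
        using constants_distinct le_z_iff by simp
      obtain D :: "'u irl_alg" and r where r: "r \<in> irl_hom B D" and D: "th_le B D" "bounded_prime_dmm D"
        and cone: "\<And>y. \<lbrakk>y \<in> carrier D; y \<preceq>\<^bsub>D\<^esub> \<one>\<^bsub>D\<^esub>\<rbrakk> \<Longrightarrow> y = \<one>\<^bsub>D\<^esub> \<or> y = irl_zero D"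
        using bounded_quotient[OF F zF] by metis
      interpret D: bounded_prime_dmm D by (rule D)
      note rh = irl_homD[OF r] and rd = irl_hom_derived[OF r sig_algebra]
      have DK: "D \<in> K"
        using variety_closed[OF KD(1) B(1) D.sig_algebra D(1)] .
      have efD: "\<one>\<^bsub>D\<^esub> \<preceq>\<^bsub>D\<^esub> irl_f D"
        using rd(4)[OF _ _ ef] rh(1) rd(1) by simp
      \<comment> \<open>The failure of the identity, written as two equations on \<open>x\<close>,
        survives in the quotient, and none of the four constants satisfies both.\<close>
      have "irl_f D \<otimes>\<^bsub>D\<^esub> r x = irl_f D \<otimes>\<^bsub>D\<^esub> irl_f D" "irl_f D \<otimes>\<^bsub>D\<^esub> \<^bold>\<not>\<^bsub>D\<^esub> (r x) = irl_f D \<otimes>\<^bsub>D\<^esub> irl_f D"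
        using rh(3)[of \<f> x] rh(3)[of \<f> "\<^bold>\<not>\<^bsub>B\<^esub> x"] rh(3)[of \<f> \<f>] rh(6)[of x] rd(1) x by simp_all
      then have "r x \<notin> {irl_zero D, \<one>\<^bsub>D\<^esub>, irl_f D, irl_f D \<otimes>\<^bsub>D\<^esub> irl_f D}"
        using D.constants_distinct D.constants_distinct[symmetric] by auto
      moreover have "r x \<in> carrier D"
        using rh(2) x(1) by blast
      moreover have "carrier alg_C4 = UNIV"
        by (simp add: alg_C4_def)
      ultimately show ?thesis
        using variety_simple_extension[OF KD(1) DK D.bounded_prime_dmm_axioms cone D.C4_hom[OF efD] _ sc(4) _ _
            satisfied_concrete(8) KD(5)] by blast
    qed
  qed simp
qed

lemma variety_M_satisfies:
  assumes "A \<in> variety_M"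
  shows "sig_algebra A" "satisfies_eq A eq_top" "satisfies_eq A eq_e_le_f" "satisfies_eq A eq_M"
proof -
  interpret de_morgan_monoid A
    using assms by (simp add: variety_M_def)
  show "sig_algebra A" "satisfies_eq A eq_top" "satisfies_eq A eq_e_le_f" "satisfies_eq A eq_M"
    using assms sig_algebra unfolding variety_M_def satisfies_eqs[OF sig_algebra] anti_idempotent_def by simp_all
qed

theorem theorem7p2:
  fixes C :: "nat \<Rightarrow> 'u irl_alg"
  assumes infinite_universe: "infinite (UNIV :: 'u set)"
    and C5_to_C8: "remaining_four C"
  shows "\<not> (\<exists>K :: 'u irl_alg set. join_irreducible_cover K (\<V> alg_2))
    \<and> (\<forall>K :: 'u irl_alg set. join_irreducible_cover K (\<V> alg_S3) \<longleftrightarrow> K = \<V> alg_S5)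
    \<and> (\<forall>K :: 'u irl_alg set. join_irreducible_cover K (\<V> alg_C4) \<longrightarrow>
         (\<forall>A \<in> K. anti_idempotent A) \<and>
         (let P1 = K \<subseteq> variety_M;
              P2 = (\<exists>n \<in> {5, 6, 7, 8}. K = \<V> (C n));
              P3 = (\<exists>A :: 'u irl_alg. de_morgan_monoid A \<and> simple_alg A \<and> n_generated 1 A \<and>
                      proper_subalgebra_of alg_C4 A \<and> K = \<V> A)
          in (P1 \<or> P2 \<or> P3) \<and> \<not> (P1 \<and> P2) \<and> \<not> (P1 \<and> P3) \<and> \<not> (P2 \<and> P3)))
    \<and> (\<forall>K :: 'u irl_alg set. join_irreducible_cover K (\<V> alg_D4) \<longrightarrow>
         (\<exists>A :: 'u irl_alg. de_morgan_monoid A \<and> simple_alg A \<and> n_generated 1 A \<and>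
            proper_subalgebra_of alg_D4 A \<and> K = \<V> A) \<and>
         (\<forall>A \<in> K. anti_idempotent A))"
proof -
  have C: "crystalline_dmm (C n) \<and> n_generated 0 (C n)" if "n \<in> {5, 6, 7, 8}" for n
    using C5_to_C8 that de_morgan_monoid.zero_generated_fsi_crystalline unfolding remaining_four_def by blast
  have noniso: "\<not> irl_isomorphic (C m) (C n)" if "m \<in> {5, 6, 7, 8}" "n \<in> {5, 6, 7, 8}" "m \<noteq> n" for m n
    using C5_to_C8 that unfolding remaining_four_def by blast
  have self: "A \<in> \<V> A" if "sig_algebra A" for A :: "'u irl_alg"
    unfolding generated_variety_self[OF that] using that by (simp add: th_le_def)
  have Cn: "sig_algebra (C n)" "\<not> satisfies_eq (C n) eq_e_le_f" if n: "n \<in> {5, 6, 7, 8}" for n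
  proof -
    interpret crystalline_dmm "C n"
      using C[OF n] by blast
    show "sig_algebra (C n)" "\<not> satisfies_eq (C n) eq_e_le_f"
      using sig_algebra not_one_le_f by (simp_all add: satisfies_eqs[OF sig_algebra])
  qed
  \<comment> \<open>Exclusivity: each \<open>C n\<close> violates \<open>\<one> \<preceq> f\<close>,
    which holds throughout \<open>M\<close> and in every extension of \<open>C4\<close>, being
    inherited from the constants of \<open>C4\<close>.\<close>
  have M_C: "\<not> (K \<subseteq> variety_M \<and> K = \<V> (C n))" if "n \<in> {5, 6, 7, 8}" for K :: "'u irl_alg set" and n
    using self Cn[OF that] variety_M_satisfies(3) by blast
  have M_simple: "\<not> (K \<subseteq> variety_M \<and> K = \<V> A)"
    if "de_morgan_monoid A" "simple_alg A" "proper_subalgebra_of alg_C4 A" for K :: "'u irl_alg set" and A :: "'u irl_alg"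
  proof
    interpret de_morgan_monoid A by (rule that)
    assume "K \<subseteq> variety_M \<and> K = \<V> A"
    then have "A \<in> variety_M"
      using self sig_algebra by blast
    then show False
      using simple_C4_extension_not_M that variety_M_satisfies by blast
  qed
  have C_simple: "\<not> (K = \<V> (C n) \<and> K = \<V> A)"
    if n: "n \<in> {5, 6, 7, 8}" and A: "de_morgan_monoid A" "proper_subalgebra_of alg_C4 A"
    for K :: "'u irl_alg set" and n and A :: "'u irl_alg"
  proof
    interpret de_morgan_monoid A by (rule A)
    assume "K = \<V> (C n) \<and> K = \<V> A"
    then have th: "th_le A (C n)"
      using self[OF Cn(1)[OF n]] generated_variety_self[OF sig_algebra] by blast
    obtain S h where "subuniverse A S" and h: "h \<in> irl_hom alg_C4 (A\<lparr>carrier := S\<rparr>)"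
      using A(2) unfolding proper_subalgebra_of_def irl_isomorphic_iff by blast
    have "E4 \<preceq>\<^bsub>alg_C4\<^esub> F4" "E4 \<in> carrier alg_C4" "F4 \<in> carrier alg_C4"
      by (simp_all add: irl_le_def alg_C4_def)
    then have "h E4 \<preceq>\<^bsub>A\<^esub> h F4"
      using irl_hom_derived(4)[OF h sig_algebra_concrete(4), of E4 F4] by simp
    then have "\<one>\<^bsub>A\<^esub> \<preceq>\<^bsub>A\<^esub> irl_f A"
      using irl_hom_derived(1)[OF h sig_algebra_concrete(4)] irl_homD(1)[OF h] by (simp add: concrete_constants)
    then have "satisfies_eq A eq_e_le_f"
      by (simp add: satisfies_eqs[OF sig_algebra])
    then show False
      using th Cn(2)[OF n] unfolding th_le_def by blast
  qed
  have C4: "\<forall>A \<in> K. anti_idempotent A"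
    "K \<subseteq> variety_M \<or> (\<exists>n \<in> {5, 6, 7, 8}. K = \<V> (C n)) \<or>
      (\<exists>A :: 'u irl_alg. de_morgan_monoid A \<and> simple_alg A \<and> n_generated 1 A \<and>
        proper_subalgebra_of alg_C4 A \<and> K = \<V> A)"
    if "join_irreducible_cover K (\<V> alg_C4)" for K :: "'u irl_alg set"
    by (rule join_irreducible_cover_C4_cases; fact infinite_universe C noniso that)+
  show ?thesis
  proof (intro conjI allI impI)
    show "\<not> (\<exists>K :: 'u irl_alg set. join_irreducible_cover K (\<V> alg_2))"
      using no_join_irreducible_cover_2[OF infinite_universe] by blast
  next
    fix K :: "'u irl_alg set"
    show "join_irreducible_cover K (\<V> alg_S3) \<longleftrightarrow> K = \<V> alg_S5"
      using join_irreducible_cover_S3[OF infinite_universe, of K]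
        join_irreducible_cover_S5[OF infinite_universe] by auto
  next
    fix K :: "'u irl_alg set"
    assume K: "join_irreducible_cover K (\<V> alg_C4)"
    show "\<forall>A \<in> K. anti_idempotent A"
      using C4(1)[OF K] .
    show "let P1 = K \<subseteq> variety_M;
              P2 = (\<exists>n \<in> {5, 6, 7, 8}. K = \<V> (C n));
              P3 = (\<exists>A :: 'u irl_alg. de_morgan_monoid A \<and> simple_alg A \<and> n_generated 1 A \<and>
                      proper_subalgebra_of alg_C4 A \<and> K = \<V> A)
          in (P1 \<or> P2 \<or> P3) \<and> \<not> (P1 \<and> P2) \<and> \<not> (P1 \<and> P3) \<and> \<not> (P2 \<and> P3)"
      unfolding Let_def
    proof (intro conjI)
      show "\<not> (K \<subseteq> variety_M \<and> (\<exists>n \<in> {5, 6, 7, 8}. K = \<V> (C n)))"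
        using M_C[of _ K] by blast
      show "\<not> (K \<subseteq> variety_M \<and> (\<exists>A :: 'u irl_alg. de_morgan_monoid A \<and> simple_alg A \<and> n_generated 1 A \<and>
          proper_subalgebra_of alg_C4 A \<and> K = \<V> A))"
        using M_simple[of _ K] by blast
      show "\<not> ((\<exists>n \<in> {5, 6, 7, 8}. K = \<V> (C n)) \<and>
          (\<exists>A :: 'u irl_alg. de_morgan_monoid A \<and> simple_alg A \<and> n_generated 1 A \<and>
            proper_subalgebra_of alg_C4 A \<and> K = \<V> A))"
        using C_simple[of _ _ K] by blast
    qed (use C4(2)[OF K] in blast)
  next
    fix K :: "'u irl_alg set"
    assume K: "join_irreducible_cover K (\<V> alg_D4)"
    show "\<exists>A :: 'u irl_alg. de_morgan_monoid A \<and> simple_alg A \<and> n_generated 1 A \<and>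
        proper_subalgebra_of alg_D4 A \<and> K = \<V> A"
      using join_irreducible_cover_D4(1)[OF infinite_universe K] .
    show "\<forall>A \<in> K. anti_idempotent A"
      using join_irreducible_cover_D4(2)[OF infinite_universe K] .
  qed
qed

end
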